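(* Let $n\in\mathbb{N}$, let $\Omega\subset\mathbb{R}^n$ be an open bounded $C^{1,1}$ domain, let $M\in\mathbb{R}^{n\times n}$, and let $K=K(\theta)\subset\mathbb{R}^{n\times n}$, for some fixed $\theta\in\mathbb{R}_+$, be the set of energy wells defined in the context. For $\epsilon>0$ let $$E_{\epsilon}=\min_{\nabla u=M \text{ a.e. in } \mathbb{R}^n\setminus\overline{\Omega}}\left\{\int_{\Omega}\operatorname{dist}^2(\nabla u,K)\,dx+\epsilon^2\int_{\Omega}|\nabla^2u|^2\,dx\right\}.$$ Assume that there exist constants $C>1$, $\epsilon_0>0$ and $\mu\in(0,\tfrac12)$ such that for all $\epsilon\in(0,\epsilon_0)$ $$\epsilon^{2\mu}\le C\,E_{\epsilon}.$$ Suppose that $u:\mathbb{R}^n\to\mathbb{R}^n$ is a solution to $$\nabla u\in K \ \text{ a.e. in } \Omega,\qquad \nabla u=M\ \text{ a.e. in } \mathbb{R}^n\setminus\overline{\Omega}.$$ If, for some $b\in\mathbb{R}^n$ and $s\in\mathbb{R}$, the function $v(x):=u(x)-Mx-b$ satisfies $v\in H^{1+s}(\mathbb{R}^n)$, $\operatorname{supp}(v)\subset\overline{\Omega}$ and $\nabla v\in L^{\infty}(\mathbb{R}^n)$, then $s\le\mu$.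
   Context: Energy wells: for $\theta\in\mathbb{R}_+$ and a fixed critical temperature $\theta_c\in\mathbb{R}_+$, $$K(\theta)=\begin{cases}\alpha(\theta)\,SO(n) & \text{if }\theta>\theta_c,\\ \bigcup_{j=1}^{m}SO(n)\,U_j(\theta) & \text{if }\theta\le\theta_c,\end{cases}$$ where $\alpha:\mathbb{R}_+\to\mathbb{R}_+$ is a given function, $m\in\mathbb{N}$, and $U_j(\theta)=U_j(\theta)^t\in\mathbb{R}^{n\times n}$, $j=1,\dots,m$, are given symmetric matrices. $\operatorname{dist}(\cdot,K)$ is the Euclidean (Frobenius) distance to $K$ in $\mathbb{R}^{n\times n}$. The minimum (read as an infimum) defining the energy is over maps $u:\mathbb{R}^n\to\mathbb{R}^n$ in $H^1_{loc}(\mathbb{R}^n;\mathbb{R}^n)$ with $\nabla u=M$ a.e. in $\mathbb{R}^n\setminus\overline{\Omega}$ and $\nabla^2u\in L^2(\Omega)$ (second distributional derivative in $\Omega$). $H^{\sigma}(\mathbb{R}^n)$, $\sigma\in\mathbb{R}$, is the $L^2$-based Sobolev space with norm $\|u\|_{H^{\sigma}(\mathbb{R}^n)}=\|\mathcal{F}^{-1}[(|\xi|^2+1)^{\sigma/2}\mathcal{F}u]\|_{L^2(\mathbb{R}^n)}$, where $\mathcal{F}$ is the Fourier transform; vector-valued functions are treated componentwise. *)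

theory Defs
  imports "HOL-Analysis.Analysis"
begin

subsection \<open>Smooth functions, test functions, Schwartz functions\<close>

definition partial_deriv :: "'n::finite \<Rightarrow> (real^'n \<Rightarrow> 'b::real_normed_vector) \<Rightarrow> real^'n \<Rightarrow> 'b" where
  "partial_deriv i f x = frechet_derivative f (at x) (axis i 1)"

primrec iter_partial :: "'n::finite list \<Rightarrow> (real^'n \<Rightarrow> 'b::real_normed_vector) \<Rightarrow> real^'n \<Rightarrow> 'b" where
  "iter_partial [] f = f"
| "iter_partial (i # is) f = partial_deriv i (iter_partial is f)"

definition smooth :: "(real^'n::finite \<Rightarrow> 'b::real_normed_vector) \<Rightarrow> bool" where
  "smooth f \<longleftrightarrow> (\<forall>is x. iter_partial is f differentiable (at x))"

definition test_functions :: "(real^'n::finite) set \<Rightarrow> (real^'n \<Rightarrow> real) set" where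
  "test_functions S =
     {\<phi>. smooth \<phi> \<and> compact (closure {x. \<phi> x \<noteq> 0}) \<and> closure {x. \<phi> x \<noteq> 0} \<subseteq> S}"

definition schwartz :: "(real^'n::finite \<Rightarrow> complex) set" where
  "schwartz = {\<psi>. smooth \<psi> \<and>
     (\<forall>(k::nat) is. bounded (range (\<lambda>x. (1 + norm x) ^ k *\<^sub>R iter_partial is \<psi> x)))}"


subsection \<open>Lebesgue spaces and weak derivatives\<close>

definition locally_integrable :: "(real^'n::finite) set \<Rightarrow> (real^'n \<Rightarrow> real) \<Rightarrow> bool" where
  "locally_integrable S f \<longleftrightarrow> (\<forall>C. compact C \<and> C \<subseteq> S \<longrightarrow> set_integrable lebesgue C f)"

definition L2_on :: "(real^'n::finite) set \<Rightarrow> (real^'n \<Rightarrow> 'b::euclidean_space) \<Rightarrow> bool" where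
  "L2_on S f \<longleftrightarrow> set_borel_measurable lebesgue S f \<and>
     set_integrable lebesgue S (\<lambda>x. (norm (f x))\<^sup>2)"

definition L2_loc :: "(real^'n::finite \<Rightarrow> 'b::euclidean_space) \<Rightarrow> bool" where
  "L2_loc f \<longleftrightarrow> (\<forall>C. compact C \<longrightarrow> L2_on C f)"

definition Linf :: "(real^'n::finite \<Rightarrow> 'b::euclidean_space) \<Rightarrow> bool" where
  "Linf f \<longleftrightarrow> f \<in> borel_measurable lebesgue \<and> (\<exists>B. AE x in lebesgue. norm (f x) \<le> B)"

text \<open>The support of an almost-everywhere equivalence class of functions, i.e. the support
  of the induced distribution.\<close>

definition ess_support :: "(real^'n::finite \<Rightarrow> 'b::zero) \<Rightarrow> (real^'n) set" where
  "ess_support f = - \<Union>{V. open V \<and> (AE x\<in>V in lebesgue. f x = 0)}"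

definition has_weak_partial ::
    "(real^'n::finite) set \<Rightarrow> 'n \<Rightarrow> (real^'n \<Rightarrow> real) \<Rightarrow> (real^'n \<Rightarrow> real) \<Rightarrow> bool" where
  "has_weak_partial S j f g \<longleftrightarrow> locally_integrable S f \<and> locally_integrable S g \<and>
     (\<forall>\<phi>\<in>test_functions S.
        (LINT x:S|lebesgue. f x * partial_deriv j \<phi> x) = - (LINT x:S|lebesgue. g x * \<phi> x))"

text \<open>Index convention: row \<open>i\<close>, column \<open>j\<close> of the gradient is the \<open>j\<close>-th partial
  derivative of the \<open>i\<close>-th component.\<close>

definition has_weak_gradient ::
    "(real^'n::finite) set \<Rightarrow> (real^'n \<Rightarrow> real^'m::finite) \<Rightarrow> (real^'n \<Rightarrow> real^'n^'m) \<Rightarrow> bool" where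
  "has_weak_gradient S u G \<longleftrightarrow>
     (\<forall>i j. has_weak_partial S j (\<lambda>x. u x $ i) (\<lambda>x. G x $ i $ j))"

definition has_weak_matrix_gradient ::
    "(real^'n::finite) set \<Rightarrow> (real^'n \<Rightarrow> real^'n^'m::finite) \<Rightarrow> (real^'n \<Rightarrow> real^'n^'n^'m) \<Rightarrow> bool" where
  "has_weak_matrix_gradient S G H \<longleftrightarrow>
     (\<forall>i j k. has_weak_partial S k (\<lambda>x. G x $ i $ j) (\<lambda>x. H x $ i $ j $ k))"


subsection \<open>Fourier transform and Sobolev spaces of real order\<close>

definition fourier :: "(real^'n::finite \<Rightarrow> complex) \<Rightarrow> real^'n \<Rightarrow> complex" where
  "fourier \<psi> \<xi> = (LINT x|lebesgue. cis (- (x \<bullet> \<xi>)) * \<psi> x)"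

text \<open>Both \<open>f\<close> and \<open>g\<close> induce tempered distributions, and the distribution \<open>g\<close> is the
  Fourier transform of the distribution \<open>f\<close>.\<close>

definition has_fourier ::
    "(real^'n::finite \<Rightarrow> complex) \<Rightarrow> (real^'n \<Rightarrow> complex) \<Rightarrow> bool" where
  "has_fourier f g \<longleftrightarrow> (\<forall>\<psi>\<in>schwartz.
     integrable lebesgue (\<lambda>x. f x * \<psi> x) \<and>
     integrable lebesgue (\<lambda>\<xi>. g \<xi> * \<psi> \<xi>) \<and>
     (LINT \<xi>|lebesgue. g \<xi> * \<psi> \<xi>) = (LINT x|lebesgue. f x * fourier \<psi> x))"

text \<open>The functions belonging to the Sobolev space of order \<open>\<sigma>\<close>. Here \<open>g\<close> is the Fourier
  transform of \<open>f\<close>, and \<open>h\<close> is the inverse Fourier transform of the weighted \<open>g\<close>, whose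
  \<open>L\<^sup>2\<close> norm is the Sobolev norm of \<open>f\<close>. For negative \<open>\<sigma>\<close> the full space also contains
  distributions that are not functions; only its functions are represented.\<close>

definition sobolev_H :: "real \<Rightarrow> (real^'n::finite \<Rightarrow> complex) set" where
  "sobolev_H \<sigma> = {f. \<exists>g h. has_fourier f g \<and>
     has_fourier h (\<lambda>\<xi>. ((norm \<xi>)\<^sup>2 + 1) powr (\<sigma> / 2) *\<^sub>R g \<xi>) \<and> L2_on UNIV h}"

definition in_sobolev_H :: "real \<Rightarrow> (real^'n::finite \<Rightarrow> real^'m::finite) \<Rightarrow> bool" where
  "in_sobolev_H \<sigma> v \<longleftrightarrow> (\<forall>i. (\<lambda>x. complex_of_real (v x $ i)) \<in> sobolev_H \<sigma>)"


subsection \<open>Domains with boundary of class \<open>C\<^bsup>1,1\<^esup>\<close>\<close>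

definition C11_function :: "(real^'n::finite \<Rightarrow> real) \<Rightarrow> bool" where
  "C11_function \<gamma> \<longleftrightarrow> (\<exists>D L. (\<forall>x. GDERIV \<gamma> x :> D x) \<and> L-lipschitz_on UNIV D)"

text \<open>Near each boundary point the set is the region above the graph of a function over the
  hyperplane orthogonal to a unit vector \<open>e\<close>. The vector \<open>e\<close> replaces the usual rotation of
  coordinates; \<open>\<gamma>\<close> is only evaluated on the hyperplane, and a function on the hyperplane
  extends to the whole space by being constant in direction \<open>e\<close>.\<close>

definition C11_boundary :: "(real^'n::finite) set \<Rightarrow> bool" where
  "C11_boundary \<Omega> \<longleftrightarrow> (\<forall>p\<in>frontier \<Omega>. \<exists>r>0. \<exists>e \<gamma>. norm e = 1 \<and> C11_function \<gamma> \<and>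
     \<Omega> \<inter> ball p r = {x\<in>ball p r. \<gamma> (x - (x \<bullet> e) *\<^sub>R e) < x \<bullet> e})"


subsection \<open>Energy wells and the singularly perturbed energy\<close>

definition SO :: "(real^'n::finite^'n) set" where
  "SO = {Q. rotation_matrix Q}"

definition energy_wells ::
    "(real \<Rightarrow> real) \<Rightarrow> real \<Rightarrow> nat \<Rightarrow> (nat \<Rightarrow> real \<Rightarrow> real^'n::finite^'n) \<Rightarrow> real \<Rightarrow> (real^'n^'n) set" where
  "energy_wells \<alpha> \<theta>\<^sub>c m U \<theta> =
     (if \<theta> > \<theta>\<^sub>c then (\<lambda>Q. \<alpha> \<theta> *\<^sub>R Q) ` SO
      else (\<Union>j\<in>{1..m}. (\<lambda>Q. Q ** U j \<theta>) ` SO))"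

text \<open>A competitor \<open>u\<close> is listed together with (representatives of) its weak gradient \<open>G\<close> and
  its second weak derivative \<open>H\<close> in \<open>\<Omega>\<close>, which it determines almost everywhere.\<close>

definition admissible ::
    "(real^'n::finite) set \<Rightarrow> real^'n^'n \<Rightarrow>
     ((real^'n \<Rightarrow> real^'n) \<times> (real^'n \<Rightarrow> real^'n^'n) \<times> (real^'n \<Rightarrow> real^'n^'n^'n)) set" where
  "admissible \<Omega> M = {(u, G, H).
     L2_loc u \<and> L2_loc G \<and> has_weak_gradient UNIV u G \<and>
     (AE x\<in>- closure \<Omega> in lebesgue. G x = M) \<and>
     has_weak_matrix_gradient \<Omega> G H \<and> L2_on \<Omega> H}"

text \<open>The norms on \<open>real^'n^'n\<close> and \<open>real^'n^'n^'n\<close> are the Euclidean (Frobenius) norms.\<close>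

definition energy ::
    "(real^'n::finite) set \<Rightarrow> (real^'n^'n) set \<Rightarrow> real \<Rightarrow>
     (real^'n \<Rightarrow> real^'n^'n) \<Rightarrow> (real^'n \<Rightarrow> real^'n^'n^'n) \<Rightarrow> ennreal" where
  "energy \<Omega> K \<epsilon> G H =
     (\<integral>\<^sup>+x\<in>\<Omega>. ennreal ((infdist (G x) K)\<^sup>2) \<partial>lebesgue) +
     ennreal (\<epsilon>\<^sup>2) * (\<integral>\<^sup>+x\<in>\<Omega>. ennreal ((norm (H x))\<^sup>2) \<partial>lebesgue)"

definition min_energy ::
    "(real^'n::finite) set \<Rightarrow> (real^'n^'n) set \<Rightarrow> real^'n^'n \<Rightarrow> real \<Rightarrow> ennreal" where
  "min_energy \<Omega> K M \<epsilon> = (INF (u, G, H)\<in>admissible \<Omega> M. energy \<Omega> K \<epsilon> G H)"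

end

(*
  Suppose s > \<mu>; put r = min s (1/2). Then G' = G - M is a bounded weak gradient of v (the wells form
  a bounded set, and the boundary is a null set) supported in the closure of \<Omega>. By Plancherel,
  membership of v in H^(1+s) means \<parallel>G'(. - y) - G'\<parallel> = O(|y|^r) in L2. Mollify v at scale \<epsilon> and multiply by a
  cutoff that vanishes within distance of order \<epsilon> from the complement of \<Omega>. Away from a boundary layer
  the shift bound gives errors \<epsilon>^r for the gradient and \<epsilon>^(r-1) for the second derivative. In the layer,
  whose volume is O(\<epsilon>), the errors are O(1) and O(1/\<epsilon>), since v is Lipschitz and vanishes outside \<Omega>.
  Hence E_\<epsilon> = O(\<epsilon>^(2r) + \<epsilon>) = O(\<epsilon>^(2r)), which contradicts the lower bound \<epsilon>^(2\<mu>) because \<mu> < r.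
*)

theory Submission
  imports Defs "HOL-Probability.Characteristic_Functions"
begin

section \<open>Functions with continuous partial derivatives and smooth functions\<close>

text \<open>The cap at 1/2 in \<open>r\<close> reflects the boundary layer: it contributes order
  \<epsilon> to the energy however regular v is, and for \<epsilon> < 1 the bound \<epsilon> \<le>
  \<epsilon> powr (2 * r) asks for 2 * r \<le> 1. The second derivative is of order \<epsilon> powr
  (r - 1) and not 1/\<epsilon> because a derivative of a mollifier has mean zero, so that
  convolution with it sees only differences of G'. Each derivative of the cutoff costs a factor
  1/\<epsilon>; in the layer this is paid for by a bound of order \<epsilon> on the mollified v,
  since every boundary point has, at distance of order \<epsilon>, a point whose neighbourhood
  misses \<Omega>. On the Fourier side the Sobolev hypothesis provides a distributional transform of
  v, known through pairings with Schwartz functions. Gaussians times characters identify it almost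
  everywhere with the transform of an integrable representative of v, and Gaussian regularisation
  also proves Plancherel in the form of two inequalities. The estimates are carried out for single
  components and Borel representatives over \<open>lborel\<close>, while the definitions speak of
  \<open>lebesgue\<close>.\<close>

definition has_partials ::
    "(real^'n::finite \<Rightarrow> 'b::real_normed_vector) \<Rightarrow> ('n \<Rightarrow> real^'n \<Rightarrow> 'b) \<Rightarrow> bool" where
  "has_partials f f' \<longleftrightarrow> (\<forall>x. (f has_derivative (\<lambda>h. \<Sum>i\<in>UNIV. h $ i *\<^sub>R f' i x)) (at x))"

text \<open>Uniqueness of the Frechet derivative. This is the bridge from
  \<open>has_partials\<close>, where derivatives are exhibited, to \<open>partial_deriv\<close>, on
  which smoothness and weak derivatives are built.\<close>

lemma has_partials_partial_deriv:
  assumes "has_partials f f'"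
  shows "partial_deriv i f = f' i"
proof
  fix x
  have "frechet_derivative f (at x) = (\<lambda>h. \<Sum>i\<in>UNIV. h $ i *\<^sub>R f' i x)"
    using assms unfolding has_partials_def by (intro frechet_derivative_at[symmetric]) blast
  then have "partial_deriv i f x = (\<Sum>j\<in>UNIV. axis i 1 $ j *\<^sub>R f' j x)"
    by (simp add: partial_deriv_def)
  also have "\<dots> = (\<Sum>j\<in>UNIV. if j = i then f' j x else 0)"
    by (intro sum.cong) (auto simp: axis_def)
  finally show "partial_deriv i f x = f' i x" by simp
qed

lemma has_partials_differentiable: "has_partials f f' \<Longrightarrow> f differentiable (at x)"
  unfolding has_partials_def differentiable_def by blast

lemma has_partials_continuous: "has_partials f f' \<Longrightarrow> continuous_on UNIV f"
  unfolding has_partials_def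
  by (meson continuous_at_imp_continuous_on has_derivative_continuous)

lemma differentiable_has_partials:
  assumes "\<And>x. f differentiable (at x)"
  shows "has_partials f (\<lambda>i. partial_deriv i f)"
  unfolding has_partials_def
proof
  fix x
  let ?D = "frechet_derivative f (at x)"
  have D: "(f has_derivative ?D) (at x)"
    using assms frechet_derivative_works by blast
  then interpret D: bounded_linear ?D by (rule has_derivative_bounded_linear)
  have "?D h = (\<Sum>i\<in>UNIV. h $ i *\<^sub>R partial_deriv i f x)" for h
  proof -
    have "?D h = ?D (\<Sum>i\<in>UNIV. h $ i *\<^sub>R axis i 1)"
      by (simp flip: scalar_mult_eq_scaleR add: basis_expansion)
    also have "\<dots> = (\<Sum>i\<in>UNIV. h $ i *\<^sub>R ?D (axis i 1))"
      by (simp add: D.sum D.scaleR)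
    finally show ?thesis by (simp add: partial_deriv_def)
  qed
  then have "?D = (\<lambda>h. \<Sum>i\<in>UNIV. h $ i *\<^sub>R partial_deriv i f x)" by blast
  then show "(f has_derivative (\<lambda>h. \<Sum>i\<in>UNIV. h $ i *\<^sub>R partial_deriv i f x)) (at x)"
    using D by simp
qed

text \<open>\<open>iter_partial\<close> adds new derivatives on the outside; moving one to the
  inside shows that derivatives of smooth functions are smooth.\<close>

lemma iter_partial_append: "iter_partial is (partial_deriv i f) = iter_partial (is @ [i]) f"
  by (induction "is") auto

text \<open>Every iterated derivative stays in a class that is closed under differentiation, so
  smoothness reduces to exhibiting such a class. The second conclusion transfers decay bounds from
  the class to all derivatives.\<close>

lemma smooth_coinduct:
  assumes "f \<in> F" and F: "\<And>f. f \<in> F \<Longrightarrow> \<exists>f'. has_partials f f' \<and> (\<forall>i. f' i \<in> F)"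
  shows "smooth f" "iter_partial is f \<in> F"
proof -
  have *: "iter_partial is f \<in> F" for "is"
  proof (induction "is")
    case (Cons i "is")
    then obtain f' where "has_partials (iter_partial is f) f'" "\<And>i. f' i \<in> F"
      using F by blast
    then show ?case by (simp add: has_partials_partial_deriv)
  qed (simp add: assms)
  then show "iter_partial is f \<in> F" .
  show "smooth f"
    unfolding smooth_def using * F has_partials_differentiable by blast
qed

lemma smooth_has_partials:
  assumes "smooth f"
  shows "has_partials f (\<lambda>i. partial_deriv i f)"
proof (rule differentiable_has_partials)
  show "f differentiable (at x)" for x
    using assms unfolding smooth_def by (metis iter_partial.simps(1))
qed

lemma smooth_partial_deriv: "smooth f \<Longrightarrow> smooth (partial_deriv i f)"
  unfolding smooth_def iter_partial_append by blast

lemma smooth_continuous: "smooth f \<Longrightarrow> continuous_on UNIV f"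
  using has_partials_continuous smooth_has_partials by blast

lemma has_partials_mult:
  fixes f g :: "real^'n::finite \<Rightarrow> real"
  assumes "has_partials f f'" "has_partials g g'"
  shows "has_partials (\<lambda>x. f x * g x) (\<lambda>i x. f' i x * g x + f x * g' i x)"
  unfolding has_partials_def
proof
  fix x
  show "((\<lambda>x. f x * g x) has_derivative
      (\<lambda>h. \<Sum>i\<in>UNIV. h $ i *\<^sub>R (f' i x * g x + f x * g' i x))) (at x)"
    using assms unfolding has_partials_def
    by (auto intro!: derivative_eq_intros simp: sum_distrib_left sum_distrib_right
        sum.distrib[symmetric] algebra_simps intro!: ext sum.cong)
qed

lemma has_partials_add:
  assumes "has_partials f f'" "has_partials g g'"
  shows "has_partials (\<lambda>x. f x + g x) (\<lambda>i x. f' i x + g' i x)"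
  unfolding has_partials_def
proof
  fix x
  show "((\<lambda>x. f x + g x) has_derivative
      (\<lambda>h. \<Sum>i\<in>UNIV. h $ i *\<^sub>R (f' i x + g' i x))) (at x)"
    using assms unfolding has_partials_def
    by (auto intro!: derivative_eq_intros simp:
        sum.distrib[symmetric] algebra_simps intro!: ext sum.cong)
qed

lemma has_partials_scaleR:
  assumes "has_partials f f'"
  shows "has_partials (\<lambda>x. c *\<^sub>R f x) (\<lambda>i x. c *\<^sub>R f' i x)"
  unfolding has_partials_def
proof
  fix x
  show "((\<lambda>x. c *\<^sub>R f x) has_derivative
      (\<lambda>h. \<Sum>i\<in>UNIV. h $ i *\<^sub>R (c *\<^sub>R f' i x))) (at x)"
    using assms unfolding has_partials_def
    by (auto intro!: derivative_eq_intros simp: scaleR_sum_right mult.commute intro!: ext sum.cong)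
qed

lemma has_partials_const: "has_partials (\<lambda>x. c) (\<lambda>i x. 0)"
  unfolding has_partials_def by simp

lemma has_partials_coord_scaleR:
  assumes "has_partials f f'"
  shows "has_partials (\<lambda>x. x $ j *\<^sub>R f x) (\<lambda>i x. (if i = j then 1 else 0) *\<^sub>R f x + x $ j *\<^sub>R f' i x)"
  unfolding has_partials_def
proof
  fix x
  have "(\<Sum>i\<in>UNIV. h $ i *\<^sub>R ((if i = j then 1 else 0) *\<^sub>R f x + x $ j *\<^sub>R f' i x))
      = h $ j *\<^sub>R f x + x $ j *\<^sub>R (\<Sum>i\<in>UNIV. h $ i *\<^sub>R f' i x)" for h
  proof -
    have "(\<Sum>i\<in>UNIV. h $ i *\<^sub>R ((if i = j then 1 else 0) *\<^sub>R f x))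
        = (\<Sum>i\<in>UNIV. if i = j then h $ i *\<^sub>R f x else 0)"
      by (intro sum.cong) auto
    then show ?thesis
      by (simp add: scaleR_add_right sum.distrib scaleR_sum_right mult.commute)
  qed
  moreover have "((\<lambda>x. x $ j *\<^sub>R f x) has_derivative
      (\<lambda>h. x $ j *\<^sub>R (\<Sum>i\<in>UNIV. h $ i *\<^sub>R f' i x) + h $ j *\<^sub>R f x)) (at x)"
    using assms unfolding has_partials_def
    by (auto intro!: has_derivative_scaleR bounded_linear.has_derivative[OF bounded_linear_vec_nth] has_derivative_ident)
  ultimately show "((\<lambda>x. x $ j *\<^sub>R f x) has_derivative
      (\<lambda>h. \<Sum>i\<in>UNIV. h $ i *\<^sub>R ((if i = j then 1 else 0) *\<^sub>R f x + x $ j *\<^sub>R f' i x))) (at x)"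
    by (simp add: add.commute)
qed

text \<open>The form \<open>a + t *\<^sub>R x\<close> covers translations, dilations and the
  reflection inside a convolution at once.\<close>

lemma has_partials_affine:
  assumes "has_partials f f'"
  shows "has_partials (\<lambda>x. f (a + t *\<^sub>R x)) (\<lambda>i x. t *\<^sub>R f' i (a + t *\<^sub>R x))"
  unfolding has_partials_def
proof
  fix x
  have "((\<lambda>x. f (a + t *\<^sub>R x)) has_derivative
     (\<lambda>h. \<Sum>i\<in>UNIV. (t *\<^sub>R h) $ i *\<^sub>R f' i (a + t *\<^sub>R x))) (at x)"
  proof (rule has_derivative_compose[where f = "\<lambda>x. a + t *\<^sub>R x" and f' = "\<lambda>h. t *\<^sub>R h"
        and g = f and g' = "\<lambda>h. \<Sum>i\<in>UNIV. h $ i *\<^sub>R f' i (a + t *\<^sub>R x)"])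
    show "((\<lambda>x. a + t *\<^sub>R x) has_derivative (\<lambda>h. t *\<^sub>R h)) (at x)"
      by (auto intro!: derivative_eq_intros)
    show "(f has_derivative (\<lambda>h. \<Sum>i\<in>UNIV. h $ i *\<^sub>R f' i (a + t *\<^sub>R x))) (at (a + t *\<^sub>R x))"
      using assms unfolding has_partials_def by blast
  qed
  then show "((\<lambda>x. f (a + t *\<^sub>R x)) has_derivative
      (\<lambda>h. \<Sum>i\<in>UNIV. h $ i *\<^sub>R t *\<^sub>R f' i (a + t *\<^sub>R x))) (at x)"
    by (simp add: mult.commute)
qed

lemma smooth_affine:
  assumes "smooth f"
  shows "smooth (\<lambda>x. c *\<^sub>R f (a + t *\<^sub>R x))"
proof -
  let ?F = "{g. \<exists>f c. smooth f \<and> g = (\<lambda>x. c *\<^sub>R f (a + t *\<^sub>R x))}"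
  show ?thesis
  proof (rule smooth_coinduct)
    show "(\<lambda>x. c *\<^sub>R f (a + t *\<^sub>R x)) \<in> ?F" using assms by blast
    fix g assume "g \<in> ?F"
    then obtain f c where f: "smooth f" and g: "g = (\<lambda>x. c *\<^sub>R f (a + t *\<^sub>R x))" by blast
    have "has_partials g (\<lambda>i x. c *\<^sub>R t *\<^sub>R partial_deriv i f (a + t *\<^sub>R x))"
      unfolding g
      using has_partials_scaleR has_partials_affine smooth_has_partials[OF f] by blast
    then show "\<exists>g'. has_partials g g' \<and> (\<forall>i. g' i \<in> ?F)"
      using smooth_partial_deriv[OF f]
      by (intro exI[of _ "\<lambda>i x. c *\<^sub>R t *\<^sub>R partial_deriv i f (a + t *\<^sub>R x)"]) fastforce
  qed
qed

text \<open>By Leibniz' rule the derivative of a product is a sum of two products, so sums have to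
  be included before the class is closed under differentiation.\<close>

inductive_set product_span :: "(real^'n::finite \<Rightarrow> real) set" where
  prod: "smooth f \<Longrightarrow> smooth g \<Longrightarrow> (\<lambda>x. f x * g x) \<in> product_span"
| add: "f \<in> product_span \<Longrightarrow> g \<in> product_span \<Longrightarrow> (\<lambda>x. f x + g x) \<in> product_span"

lemma smooth_mult:
  fixes f g :: "real^'n::finite \<Rightarrow> real"
  assumes "smooth f" "smooth g"
  shows "smooth (\<lambda>x. f x * g x)"
proof (rule smooth_coinduct)
  show "(\<lambda>x. f x * g x) \<in> product_span" using assms by (rule product_span.prod)
  fix h :: "real^'n \<Rightarrow> real" assume "h \<in> product_span"
  then show "\<exists>h'. has_partials h h' \<and> (\<forall>i. h' i \<in> product_span)"
  proof induction
    case (prod f g)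
    show ?case
      by (intro exI conjI, rule has_partials_mult[OF smooth_has_partials smooth_has_partials, OF prod])
        (intro allI product_span.intros smooth_partial_deriv prod)
  next
    case (add f g)
    then obtain f' g' where fg: "has_partials f f'" "has_partials g g'"
      "\<And>i. f' i \<in> product_span" "\<And>i. g' i \<in> product_span" by blast
    show ?case
      by (intro exI conjI, rule has_partials_add[OF fg(1,2)]) (intro allI product_span.add fg)
  qed
qed

text \<open>If the derivatives of the functions in \<open>B\<close> lie in the span of \<open>B\<close> over the polynomials, then
  this span is closed under differentiation, and coinduction gives smoothness.\<close>

inductive_set polyspan :: "(real^'n::finite \<Rightarrow> 'b::real_normed_vector) set \<Rightarrow> (real^'n \<Rightarrow> 'b) set"
  for B where
  base: "f \<in> B \<Longrightarrow> f \<in> polyspan B"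
| coord: "f \<in> polyspan B \<Longrightarrow> (\<lambda>x. x $ i *\<^sub>R f x) \<in> polyspan B"
| add: "f \<in> polyspan B \<Longrightarrow> g \<in> polyspan B \<Longrightarrow> (\<lambda>x. f x + g x) \<in> polyspan B"
| scale: "f \<in> polyspan B \<Longrightarrow> (\<lambda>x. c *\<^sub>R f x) \<in> polyspan B"

lemma polyspan_has_partials:
  assumes B: "\<And>b. b \<in> B \<Longrightarrow> \<exists>b'. has_partials b b' \<and> (\<forall>i. b' i \<in> polyspan B)"
    and "f \<in> polyspan B"
  shows "\<exists>f'. has_partials f f' \<and> (\<forall>i. f' i \<in> polyspan B)"
  using assms(2)
proof induction
  case (base f)
  then show ?case by (rule B)
next
  case (coord f j)
  then obtain f' where "has_partials f f'" "\<forall>i. f' i \<in> polyspan B" by blast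
  from has_partials_coord_scaleR[OF this(1), of j] this(2) coord.hyps show ?case
    by (intro exI[of _ "\<lambda>i x. (if i = j then 1 else 0) *\<^sub>R f x + x $ j *\<^sub>R f' i x"] conjI allI
      polyspan.add polyspan.scale polyspan.coord) auto
next
  case (add f g)
  then obtain f' g' where fg: "has_partials f f'" "has_partials g g'"
    "\<And>i. f' i \<in> polyspan B" "\<And>i. g' i \<in> polyspan B" by blast
  show ?case
    by (intro exI conjI, rule has_partials_add[OF fg(1,2)]) (intro allI polyspan.add fg)
next
  case (scale f c)
  then obtain f' where f: "has_partials f f'" "\<And>i. f' i \<in> polyspan B" by blast
  show ?case
    by (intro exI conjI, rule has_partials_scaleR[OF f(1)]) (intro allI polyspan.scale f)
qed

lemma polyspan_iter_partial:
  assumes "\<And>b. b \<in> B \<Longrightarrow> \<exists>b'. has_partials b b' \<and> (\<forall>i. b' i \<in> polyspan B)"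
    and "f \<in> polyspan B"
  shows "smooth f" "iter_partial is f \<in> polyspan B"
  using smooth_coinduct[OF assms(2), OF polyspan_has_partials, OF assms(1)] by auto

text \<open>The two-parameter family is closed under differentiation. Real sines and cosines take
  the place of characters because \<open>test_functions\<close> contains real functions.\<close>

lemma trig_has_partials:
  "has_partials (\<lambda>x. a * cos (x \<bullet> \<xi>) + b * sin (x \<bullet> \<xi>))
     (\<lambda>i x. (b * \<xi> $ i) * cos (x \<bullet> \<xi>) + (- a * \<xi> $ i) * sin (x \<bullet> \<xi>))"
  unfolding has_partials_def
proof
  fix x
  have "((\<lambda>x. a * cos (x \<bullet> \<xi>) + b * sin (x \<bullet> \<xi>)) has_derivative
      (\<lambda>h. (h \<bullet> \<xi>) * (b * cos (x \<bullet> \<xi>) - a * sin (x \<bullet> \<xi>)))) (at x)"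
    by (auto intro!: derivative_eq_intros simp: algebra_simps)
  then show "((\<lambda>x. a * cos (x \<bullet> \<xi>) + b * sin (x \<bullet> \<xi>)) has_derivative
      (\<lambda>h. \<Sum>i\<in>UNIV. h $ i *\<^sub>R (b * \<xi> $ i * cos (x \<bullet> \<xi>) + - a * \<xi> $ i * sin (x \<bullet> \<xi>)))) (at x)"
    by (rule has_derivative_eq_rhs)
      (simp add: inner_vec_def[of _ \<xi>] sum_distrib_right right_diff_distrib distrib_left
        sum_subtractf sum_distrib_left mult_ac)
qed

lemma smooth_trig: "smooth (\<lambda>x. a * cos (x \<bullet> \<xi>) + b * sin (x \<bullet> \<xi>))"
proof -
  let ?F = "{f. \<exists>a b. f = (\<lambda>x. a * cos (x \<bullet> \<xi>) + b * sin (x \<bullet> \<xi>))}"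
  show ?thesis
  proof (rule smooth_coinduct)
    show "(\<lambda>x. a * cos (x \<bullet> \<xi>) + b * sin (x \<bullet> \<xi>)) \<in> ?F" by blast
    show "\<exists>f'. has_partials f f' \<and> (\<forall>i. f' i \<in> ?F)" if "f \<in> ?F" for f
      using that trig_has_partials by fast
  qed
qed

text \<open>A quadratic remainder beats the sublinear one that differentiability asks for. Used
  where explicit remainders are at hand: at the flat point of the bump and under an integral
  sign.\<close>

lemma has_derivative_quadratic:
  assumes D: "bounded_linear D" and C: "\<And>y. norm (f y - f x - D (y - x)) \<le> C * (norm (y - x))\<^sup>2"
  shows "(f has_derivative D) (at x)"
  unfolding has_derivative_at2
proof (intro conjI D)
  \<comment> \<open>The absolute value is taken because no sign of \<open>C\<close> is
    assumed.\<close>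
  have *: "norm ((1 / norm (y - x)) *\<^sub>R (f y - (f x + D (y - x)))) \<le> \<bar>C\<bar> * norm (y - x)" for y
  proof (cases "y = x")
    case False
    have "norm (f y - (f x + D (y - x))) \<le> \<bar>C\<bar> * (norm (y - x))\<^sup>2"
      using C[of y] by (smt (verit) mult_right_mono zero_le_power2 diff_diff_eq)
    with False show ?thesis
      by (simp add: divide_le_eq power2_eq_square mult.assoc)
  qed simp
  have "((\<lambda>y. \<bar>C\<bar> * norm (y - x)) \<longlongrightarrow> \<bar>C\<bar> * norm (x - x)) (at x)"
    by (intro tendsto_intros)
  then have "((\<lambda>y. \<bar>C\<bar> * norm (y - x)) \<longlongrightarrow> 0) (at x)" by simp
  then show "((\<lambda>y. (1 / norm (y - x)) *\<^sub>R (f y - (f x + D (y - x)))) \<longlongrightarrow> 0) (at x)"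
    by (rule Lim_null_comparison[rotated]) (use * in simp)
qed

section \<open>The standard bump function\<close>

lemma power_le_fact_exp:
  fixes u :: real
  assumes "u \<ge> 0"
  shows "u ^ m \<le> fact m * exp u"
proof -
  have s: "(\<lambda>n. u ^ n /\<^sub>R fact n) sums exp u" by (rule exp_converges)
  have "(\<Sum>n\<in>{m}. u ^ n /\<^sub>R fact n) \<le> exp u"
    using sum_le_suminf[OF sums_summable[OF s], of "{m}"] s assms
    by (simp add: sums_iff)
  then show ?thesis by (simp add: field_simps)
qed

text \<open>Differentiating \<open>exp (- (1 / t))\<close> produces powers of 1/t; with the index
  \<open>k\<close> the linear span of the family is closed under differentiation.\<close>

definition flat_exp :: "nat \<Rightarrow> real \<Rightarrow> real" where
  "flat_exp k t = (if t > 0 then exp (- (1 / t)) / t ^ k else 0)"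

text \<open>With u = 1/t, the exponential bound for \<open>u ^ (k + 2)\<close> cancels the
  denominator \<open>t ^ k\<close> and leaves two powers of t, which is the quadratic remainder
  wanted at 0.\<close>

lemma flat_exp_le:
  assumes "\<bar>t\<bar> \<le> 1"
  shows "norm (flat_exp k t) \<le> fact (k + 2) * t\<^sup>2"
proof (cases "t > 0")
  case True
  have "(1 / t) ^ (k + 2) \<le> fact (k + 2) * exp (1 / t)"
    using True by (intro power_le_fact_exp) auto
  then have "1 \<le> t ^ (k+2) * (fact (k + 2) * exp (1 / t))"
    using True by (simp add: field_simps)
  then have "exp (- (1/t)) \<le> t ^ (k+2) * fact (k + 2)"
    by (simp add: exp_minus field_simps)
  then have "exp (- (1/t)) / t ^ k \<le> fact (k + 2) * t\<^sup>2"
    using True by (simp add: divide_le_eq power_add power2_eq_square mult_ac del: fact_Suc)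
  then show ?thesis using True by (simp add: flat_exp_def)
qed (simp add: flat_exp_def)

lemma flat_exp_has_derivative:
  "(flat_exp k has_real_derivative flat_exp (k + 2) t - k * flat_exp (k + 1) t) (at t)"
proof (cases t "0 :: real" rule: linorder_cases)
  case less
  have "((\<lambda>_. 0) has_real_derivative 0) (at t)" by simp
  then have "(flat_exp k has_real_derivative 0) (at t)"
    by (rule has_field_derivative_transform_within_open[where S = "{..<0}"])
      (use less in \<open>auto simp: flat_exp_def\<close>)
  then show ?thesis using less by (simp add: flat_exp_def)
next
  case equal
  \<comment> \<open>Value and derivative at 0 both vanish, but the quadratic bound must hold for
    every y: near 0 it is \<open>flat_exp_le\<close>, and for y \<ge> 1 the function is at most
    1.\<close>
  have "norm (flat_exp k y - flat_exp k 0 - 0 * (y - 0)) \<le> fact (k+2) * (norm (y - 0))\<^sup>2" for y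
  proof (cases "\<bar>y\<bar> \<le> 1")
    case True then show ?thesis using flat_exp_le[OF True, of k] by (simp add: flat_exp_def)
  next
    case False
    show ?thesis
    proof (cases "y > 0")
      case True
      then have y: "y \<ge> 1" using False by auto
      then have "exp (- (1/y)) / y ^ k \<le> 1 / 1"
        by (intro frac_le) (auto simp: one_le_power)
      also have "1 / 1 \<le> fact (k+2) * y\<^sup>2"
        using mult_mono[of 1 "fact (k+2)" 1 "y\<^sup>2"] y by (simp del: fact_Suc add: fact_ge_1)
      finally show ?thesis using y by (simp add: flat_exp_def)
    qed (simp add: flat_exp_def)
  qed
  then have "(flat_exp k has_real_derivative 0) (at 0)"
    unfolding has_field_derivative_def
    by (intro has_derivative_quadratic[OF bounded_linear_mult_right])
  then show ?thesis using equal by (simp add: flat_exp_def)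
next
  case greater
  define u where "u = inverse t"
  \<comment> \<open>The truncated \<open>k - 1\<close> of the power rule does no harm at
    \<open>k = 0\<close>, where the factor \<open>real k\<close> vanishes.\<close>
  have k: "real k * u ^ (k - 1) * u = real k * u ^ k" by (cases k) auto
  have fe: "flat_exp m t = exp (- u) * u ^ m" for m
    using greater by (simp add: flat_exp_def u_def divide_inverse power_inverse)
  have "((\<lambda>t. exp (- inverse t)) has_real_derivative exp (- u) * u\<^sup>2) (at t)"
    using greater by (auto intro!: derivative_eq_intros simp: u_def power2_eq_square)
  moreover have "((\<lambda>t. inverse t ^ k) has_real_derivative real k * u ^ (k - 1) * - u\<^sup>2) (at t)"
    using greater by (auto intro!: derivative_eq_intros simp: u_def power2_eq_square)
  ultimately have "((\<lambda>t. exp (- inverse t) * inverse t ^ k) has_real_derivative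
     exp (- u) * u\<^sup>2 * u ^ k + (real k * u ^ (k - 1) * - u\<^sup>2) * exp (- u)) (at t)"
    unfolding u_def by (rule DERIV_mult)
  also have "exp (- u) * u\<^sup>2 * u ^ k + (real k * u ^ (k - 1) * - u\<^sup>2) * exp (- u) =
     exp (- u) * u\<^sup>2 * u ^ k - (real k * u ^ (k - 1) * u) * u * exp (- u)"
    by (simp add: power2_eq_square)
  also have "\<dots> = flat_exp (k + 2) t - k * flat_exp (k + 1) t"
    unfolding k fe by (simp add: power_add power2_eq_square algebra_simps)
  finally show ?thesis
    by (rule has_field_derivative_transform_within_open[where S = "{0<..}"])
      (use greater in \<open>auto simp: flat_exp_def divide_inverse power_inverse\<close>)
qed

text \<open>\<open>1 - (norm x)\<^sup>2\<close> is a polynomial, so the singularity of the norm at 0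
  does not enter; it is positive exactly on the open unit ball.\<close>

definition bump :: "real^'n::finite \<Rightarrow> real" where
  "bump x = flat_exp 0 (1 - (norm x)\<^sup>2)"

lemma bump_smooth: "smooth (bump :: real^'n::finite \<Rightarrow> real)"
proof -
  let ?b = "\<lambda>k (x::real^'n). flat_exp k (1 - (norm x)\<^sup>2)"
  show ?thesis
  proof (rule polyspan_iter_partial)
    show "bump \<in> polyspan (range ?b)"
      by (rule polyspan.base) (auto simp: bump_def[abs_def])
    fix b assume "b \<in> range ?b"
    then obtain k where b: "b = ?b k" by blast
    \<comment> \<open>The factor \<open>(-2) * x $ i\<close> is the partial derivative of
      \<open>1 - (norm x)\<^sup>2\<close>; the bracket is the derivative of
      \<open>flat_exp k\<close>.\<close>
    let ?d = "\<lambda>i x. (-2) *\<^sub>R (x $ i *\<^sub>R (?b (k+2) x + (- real k) *\<^sub>R ?b (k+1) x))"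
    have "has_partials b ?d"
      unfolding has_partials_def b power2_norm_eq_inner
    proof
      fix x :: "real^'n"
      have "((\<lambda>x. 1 - x \<bullet> x) has_derivative (\<lambda>h. - 2 * (x \<bullet> h))) (at x)"
        by (auto intro!: derivative_eq_intros simp: inner_commute)
      from has_derivative_compose[OF this
          flat_exp_has_derivative[of k "1 - x \<bullet> x", unfolded has_field_derivative_def]]
      show "((\<lambda>x. flat_exp k (1 - x \<bullet> x)) has_derivative
          (\<lambda>h. \<Sum>i\<in>UNIV. h $ i *\<^sub>R - 2 *\<^sub>R x $ i *\<^sub>R
              (flat_exp (k + 2) (1 - x \<bullet> x) + - real k *\<^sub>R flat_exp (k + 1) (1 - x \<bullet> x)))) (at x)"
      proof (rule has_derivative_eq_rhs, intro ext)
        fix h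
        define c where "c = flat_exp (k + 2) (1 - x \<bullet> x) + - real k *\<^sub>R flat_exp (k + 1) (1 - x \<bullet> x)"
        have "(\<Sum>i\<in>UNIV. h $ i *\<^sub>R - 2 *\<^sub>R x $ i *\<^sub>R c) = (\<Sum>i\<in>UNIV. x $ i * h $ i) * (- 2 * c)"
          unfolding sum_distrib_right by (intro sum.cong) auto
        also have "\<dots> = (x \<bullet> h) * (- 2 * c)" by (simp add: inner_vec_def)
        finally show "(flat_exp (k + 2) (1 - x \<bullet> x) - real k * flat_exp (k + 1) (1 - x \<bullet> x)) * (- 2 * (x \<bullet> h))
            = (\<Sum>i\<in>UNIV. h $ i *\<^sub>R - 2 *\<^sub>R x $ i *\<^sub>R
              (flat_exp (k + 2) (1 - x \<bullet> x) + - real k *\<^sub>R flat_exp (k + 1) (1 - x \<bullet> x)))"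
          unfolding c_def[symmetric] by (simp add: c_def algebra_simps)
      qed
    qed
    moreover have "?d i \<in> polyspan (range ?b)" for i
      by (intro polyspan.intros(2-4); rule polyspan.base; blast)
    ultimately show "\<exists>b'. has_partials b b' \<and> (\<forall>i. b' i \<in> polyspan (range ?b))" by blast
  qed
qed

lemma bump_simps:
  "0 \<le> bump x" "bump x \<le> 1" "bump 0 = exp (- 1)" "norm x \<ge> 1 \<Longrightarrow> bump x = 0"
  "norm x < 1 \<Longrightarrow> bump x > 0"
  using abs_square_less_1[of "norm x"]
  by (auto simp: bump_def flat_exp_def)

text \<open>All derivatives are polynomials times the same modulated Gaussian, and Gaussian decay
  beats every polynomial.\<close>

lemma modulated_gaussian_schwartz:
  fixes a :: "real^'n::finite"
  assumes "\<delta> > 0"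
  shows "(\<lambda>\<xi>. cis (- (a \<bullet> \<xi>)) * exp (- \<delta> * (norm \<xi>)\<^sup>2)) \<in> schwartz"
proof -
  \<comment> \<open>The complex constant \<open>c\<close> is left free because
    \<open>polyspan\<close> allows real scalars only, while differentiating the character produces
    the factor \<open>- \<i> * a $ i\<close>.\<close>
  let ?e = "\<lambda>c (\<xi>::real^'n). c * (cis (- (a \<bullet> \<xi>)) * complex_of_real (exp (- \<delta> * (norm \<xi>)\<^sup>2)))"
  let ?P = "polyspan (range ?e)"
  have B: "\<exists>b'. has_partials b b' \<and> (\<forall>i. b' i \<in> ?P)" if "b \<in> range ?e" for b
  proof -
    from that obtain c where b: "b = ?e c" by blast
    let ?d = "\<lambda>i \<xi>. ?e (- (\<i> * c * of_real (a $ i))) \<xi> + (- 2 * \<delta>) *\<^sub>R (\<xi> $ i *\<^sub>R ?e c \<xi>)"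
    have "has_partials b ?d"
      unfolding has_partials_def b power2_norm_eq_inner
    proof
      fix x :: "real^'n"
      have 1: "((\<lambda>\<xi>. cis (- (a \<bullet> \<xi>))) has_derivative (\<lambda>h. - (a \<bullet> h) *\<^sub>R (\<i> * cis (- (a \<bullet> x))))) (at x)"
        by (auto intro!: derivative_eq_intros)
      have 2: "((\<lambda>\<xi>. exp (- \<delta> * (\<xi> \<bullet> \<xi>))) has_derivative
          (\<lambda>h. exp (- \<delta> * (x \<bullet> x)) * (- \<delta> * (2 * (x \<bullet> h))))) (at x)"
        by (auto intro!: derivative_eq_intros ext simp: inner_commute)
      have 3: "((\<lambda>\<xi>. complex_of_real (exp (- \<delta> * (\<xi> \<bullet> \<xi>)))) has_derivative
          (\<lambda>h. complex_of_real (exp (- \<delta> * (x \<bullet> x)) * (- \<delta> * (2 * (x \<bullet> h)))))) (at x)"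
        using bounded_linear.has_derivative[OF bounded_linear_of_real 2] .
      show "((\<lambda>\<xi>. c * (cis (- (a \<bullet> \<xi>)) * complex_of_real (exp (- \<delta> * (\<xi> \<bullet> \<xi>))))) has_derivative
         (\<lambda>h. \<Sum>i\<in>UNIV. h $ i *\<^sub>R (- (\<i> * c * of_real (a $ i)) *
            (cis (- (a \<bullet> x)) * complex_of_real (exp (- \<delta> * (x \<bullet> x)))) +
            (- 2 * \<delta>) *\<^sub>R (x $ i *\<^sub>R (c * (cis (- (a \<bullet> x)) * complex_of_real (exp (- \<delta> * (x \<bullet> x))))))))) (at x)"
      proof (rule has_derivative_eq_rhs, rule has_derivative_mult_right, rule has_derivative_mult[OF 1 3], intro ext)
        fix h
        define E where "E = complex_of_real (exp (- \<delta> * (x \<bullet> x)))"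
        have a: "complex_of_real (a \<bullet> h) = (\<Sum>i\<in>UNIV. of_real (h $ i) * of_real (a $ i))"
          and x: "complex_of_real (x \<bullet> h) = (\<Sum>i\<in>UNIV. of_real (h $ i) * of_real (x $ i))"
          by (simp_all add: inner_vec_def mult.commute)
        have "(\<Sum>i\<in>UNIV. h $ i *\<^sub>R (- (\<i> * c * complex_of_real (a $ i)) * (cis (- (a \<bullet> x)) * E) +
            (- 2 * \<delta>) *\<^sub>R (x $ i *\<^sub>R (c * (cis (- (a \<bullet> x)) * E)))))
          = (\<Sum>i\<in>UNIV. of_real (h $ i) * of_real (a $ i) * (- (\<i> * c * cis (- (a \<bullet> x)) * E))
             + of_real (h $ i) * of_real (x $ i) * (of_real (- 2 * \<delta>) * c * cis (- (a \<bullet> x)) * E))"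
          by (intro sum.cong) (simp_all add: scaleR_conv_of_real algebra_simps)
        also have "\<dots> = of_real (a \<bullet> h) * (- (\<i> * c * cis (- (a \<bullet> x)) * E)) +
            of_real (x \<bullet> h) * (of_real (- 2 * \<delta>) * c * cis (- (a \<bullet> x)) * E)"
          unfolding a x sum.distrib sum_distrib_right ..
        finally show "c * (cis (- (a \<bullet> x)) * complex_of_real (exp (- \<delta> * (x \<bullet> x)) * (- \<delta> * (2 * (x \<bullet> h)))) +
             - (a \<bullet> h) *\<^sub>R (\<i> * cis (- (a \<bullet> x))) * complex_of_real (exp (- \<delta> * (x \<bullet> x)))) =
             (\<Sum>i\<in>UNIV. h $ i *\<^sub>R (- (\<i> * c * of_real (a $ i)) *
            (cis (- (a \<bullet> x)) * complex_of_real (exp (- \<delta> * (x \<bullet> x)))) +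
            (- 2 * \<delta>) *\<^sub>R (x $ i *\<^sub>R (c * (cis (- (a \<bullet> x)) * complex_of_real (exp (- \<delta> * (x \<bullet> x))))))))"
          unfolding of_real_mult E_def[symmetric] by (simp add: scaleR_conv_of_real algebra_simps)
      qed
    qed
    moreover have "?d i \<in> ?P" for i
      by (intro polyspan.intros(2-4); rule polyspan.base; blast)
    ultimately show ?thesis by blast
  qed
  \<comment> \<open>Multiplication by a coordinate raises \<open>m\<close> by one; for a sum the
    exponents may be added, since \<open>1 + norm x\<close> is at least 1.\<close>
  have bound: "\<exists>C m. \<forall>x. norm (f x) \<le> C * (1 + norm x) ^ m * exp (- \<delta> * (norm x)\<^sup>2)" if "f \<in> ?P" for f
    using that
  proof induction
    case (base f)
    then obtain c where "f = ?e c" by blast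
    then have "norm (f x) \<le> norm c * (1 + norm x) ^ 0 * exp (- \<delta> * (norm x)\<^sup>2)" for x
      by (simp add: norm_mult)
    then show ?case by blast
  next
    case (coord f i)
    then obtain C m where C: "\<And>x. norm (f x) \<le> C * (1 + norm x) ^ m * exp (- \<delta> * (norm x)\<^sup>2)" by blast
    have "norm (x $ i *\<^sub>R f x) \<le> C * (1 + norm x) ^ Suc m * exp (- \<delta> * (norm x)\<^sup>2)" for x
    proof -
      have "norm (x $ i *\<^sub>R f x) \<le> (1 + norm x) * (C * (1 + norm x) ^ m * exp (- \<delta> * (norm x)\<^sup>2))"
        unfolding norm_scaleR
        by (intro mult_mono C) (use component_le_norm_cart[of x i] in auto)
      then show ?thesis by (simp add: algebra_simps)
    qed
    then show ?case by blast
  next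
    case (add f g)
    then obtain C m D k where C: "\<And>x. norm (f x) \<le> C * (1 + norm x) ^ m * exp (- \<delta> * (norm x)\<^sup>2)"
       and D: "\<And>x. norm (g x) \<le> D * (1 + norm x) ^ k * exp (- \<delta> * (norm x)\<^sup>2)" by blast
    have "norm (f x + g x) \<le> (\<bar>C\<bar> + \<bar>D\<bar>) * (1 + norm x) ^ (m + k) * exp (- \<delta> * (norm x)\<^sup>2)" for x
    proof -
      have "C * (1 + norm x) ^ m \<le> \<bar>C\<bar> * (1 + norm x) ^ (m + k)"
        by (intro mult_mono power_increasing) auto
      moreover have "D * (1 + norm x) ^ k \<le> \<bar>D\<bar> * (1 + norm x) ^ (m + k)"
        by (intro mult_mono power_increasing) auto
      ultimately have "C * (1 + norm x) ^ m + D * (1 + norm x) ^ k \<le> (\<bar>C\<bar> + \<bar>D\<bar>) * (1 + norm x) ^ (m + k)"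
        by (simp add: algebra_simps)
      from mult_right_mono[OF this, of "exp (- \<delta> * (norm x)\<^sup>2)"] norm_triangle_ineq[of "f x" "g x"] C[of x] D[of x]
      show ?thesis unfolding distrib_right by simp
    qed
    then show ?case by blast
  next
    case (scale f c)
    then obtain C m where C: "\<And>x. norm (f x) \<le> C * (1 + norm x) ^ m * exp (- \<delta> * (norm x)\<^sup>2)" by blast
    have "norm (c *\<^sub>R f x) \<le> (\<bar>c\<bar> * C) * (1 + norm x) ^ m * exp (- \<delta> * (norm x)\<^sup>2)" for x
      using mult_left_mono[OF C[of x], of "\<bar>c\<bar>"] by (simp add: mult.assoc)
    then show ?case by blast
  qed
  have growth: "(1 + r) ^ N * exp (- \<delta> * r\<^sup>2) \<le> fact N * exp (1 + 1 / (4 * \<delta>))" if "r \<ge> 0" for r N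
  proof -
    have "(1 + r) ^ N * exp (- \<delta> * r\<^sup>2) \<le> fact N * exp (1 + r) * exp (- \<delta> * r\<^sup>2)"
      using that by (intro mult_right_mono power_le_fact_exp) auto
    also have "\<dots> = fact N * exp (1 + r - \<delta> * r\<^sup>2)"
      by (simp add: exp_add exp_diff exp_minus field_simps)
    also have "\<dots> \<le> fact N * exp (1 + 1 / (4 * \<delta>))"
    proof -
      \<comment> \<open>Completing the square: the maximum over r is attained at 1 / (2 *
        \<delta>).\<close>
      have "r - \<delta> * r\<^sup>2 = 1 / (4 * \<delta>) - \<delta> * (r - 1 / (2 * \<delta>))\<^sup>2"
        using assms by (simp add: field_simps power2_eq_square)
      then have "r - \<delta> * r\<^sup>2 \<le> 1 / (4 * \<delta>)" using assms by simp
      then show ?thesis by simp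
    qed
    finally show ?thesis .
  qed
  have e: "?e 1 \<in> ?P" by (rule polyspan.base) blast
  have "bounded (range (\<lambda>x. (1 + norm x) ^ k *\<^sub>R iter_partial is (?e 1) x))" for k "is"
  proof -
    have "iter_partial is (?e 1) \<in> ?P" using polyspan_iter_partial(2)[OF B e] by blast
    then obtain C m where C: "\<And>x. norm (iter_partial is (?e 1) x)
        \<le> C * (1 + norm x) ^ m * exp (- \<delta> * (norm x)\<^sup>2)" using bound by blast
    have "norm ((1 + norm x) ^ k *\<^sub>R iter_partial is (?e 1) x) \<le> \<bar>C\<bar> * (fact (m+k) * exp (1 + 1 / (4 * \<delta>)))" for x
    proof -
      have "norm ((1 + norm x) ^ k *\<^sub>R iter_partial is (?e 1) x)
         \<le> (1 + norm x) ^ k * (C * (1 + norm x) ^ m * exp (- \<delta> * (norm x)\<^sup>2))"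
        unfolding norm_scaleR by (intro mult_mono C) auto
      also have "\<dots> = C * ((1 + norm x) ^ (m+k) * exp (- \<delta> * (norm x)\<^sup>2))"
        by (simp add: power_add algebra_simps)
      also have "\<dots> \<le> \<bar>C\<bar> * (fact (m+k) * exp (1 + 1 / (4 * \<delta>)))"
        by (intro mult_mono growth) auto
      finally show ?thesis .
    qed
    then show ?thesis unfolding bounded_iff by blast
  qed
  moreover have "smooth (?e 1)" using polyspan_iter_partial(1)[OF B e] by blast
  ultimately show ?thesis unfolding schwartz_def by simp
qed

section \<open>Convolution and integration by parts\<close>

lemma nn_integral_lborel_affine:
  fixes f :: "'a::euclidean_space \<Rightarrow> ennreal"
  assumes [measurable]: "f \<in> borel_measurable borel" and c: "c \<noteq> 0"
  shows "(\<integral>\<^sup>+x. f x \<partial>lborel) = ennreal (\<bar>c\<bar> ^ DIM('a)) * (\<integral>\<^sup>+x. f (t + c *\<^sub>R x) \<partial>lborel)"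
  by (subst lborel_affine[OF c, of t])
     (simp add: nn_integral_density nn_integral_distr nn_integral_cmult)

lemma integrable_lborel_affine:
  fixes f :: "'a::euclidean_space \<Rightarrow> 'b::{banach, second_countable_topology}"
  assumes f: "integrable lborel f" and c: "c \<noteq> 0"
  shows "integrable lborel (\<lambda>x. f (t + c *\<^sub>R x))"
proof -
  have [measurable]: "f \<in> borel_measurable borel" using f by auto
  have "ennreal (\<bar>c\<bar> ^ DIM('a)) * (\<integral>\<^sup>+x. norm (f (t + c *\<^sub>R x)) \<partial>lborel) < \<infinity>"
    using f unfolding integrable_iff_bounded
    by (subst nn_integral_lborel_affine[symmetric, where f = "\<lambda>x. ennreal (norm (f x))"]) (use c in auto)
  then show ?thesis
    using c unfolding integrable_iff_bounded by (auto simp: ennreal_mult_less_top)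
qed

lemma integral_lborel_affine:
  fixes f :: "'a::euclidean_space \<Rightarrow> 'b::{banach, second_countable_topology}"
  assumes [measurable]: "f \<in> borel_measurable borel" and c: "c \<noteq> 0"
  shows "(LINT x|lborel. f x) = \<bar>c\<bar> ^ DIM('a) *\<^sub>R (LINT x|lborel. f (t + c *\<^sub>R x))"
  by (subst lborel_affine[OF c, of t]) (simp add: integral_density integral_distr)

lemma integral_lborel_translate:
  fixes f :: "'a::euclidean_space \<Rightarrow> 'b::{banach, second_countable_topology}"
  assumes [measurable]: "f \<in> borel_measurable borel"
  shows "(LINT x|lborel. f (t + x)) = (LINT x|lborel. f x)"
  using integral_lborel_affine[OF assms, of 1 t] by simp

lemma integral_lborel_reflect:
  fixes f :: "'a::euclidean_space \<Rightarrow> 'b::{banach, second_countable_topology}"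
  assumes [measurable]: "f \<in> borel_measurable borel"
  shows "(LINT x|lborel. f (t - x)) = (LINT x|lborel. f x)"
  using integral_lborel_affine[OF assms, of "-1" t] by simp

lemma nn_integral_lborel_translate:
  fixes f :: "'a::euclidean_space \<Rightarrow> ennreal"
  assumes [measurable]: "f \<in> borel_measurable borel"
  shows "(\<integral>\<^sup>+x. f (t + x) \<partial>lborel) = (\<integral>\<^sup>+x. f x \<partial>lborel)"
  using nn_integral_lborel_affine[OF assms, of 1 t] by simp

lemma nn_integral_lborel_reflect:
  fixes f :: "'a::euclidean_space \<Rightarrow> ennreal"
  assumes [measurable]: "f \<in> borel_measurable borel"
  shows "(\<integral>\<^sup>+x. f (t - x) \<partial>lborel) = (\<integral>\<^sup>+x. f x \<partial>lborel)"
  using nn_integral_lborel_affine[OF assms, of "-1" t] by simp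

lemma continuous_compact_bounded:
  fixes f :: "'a::euclidean_space \<Rightarrow> 'b::real_normed_vector"
  assumes "continuous_on UNIV f" and "\<And>x. norm x > R \<Longrightarrow> f x = 0"
  obtains B where "B > 0" "\<And>x. norm (f x) \<le> B"
proof -
  have "compact (f ` cball 0 R)"
    using assms(1) by (intro compact_continuous_image) (auto intro: continuous_on_subset)
  then have "bounded (f ` cball 0 R)" by (rule compact_imp_bounded)
  then obtain B where B: "B > 0" "\<And>x. x \<in> cball 0 R \<Longrightarrow> norm (f x) \<le> B"
    unfolding bounded_pos by auto
  have "norm (f x) \<le> B" for x
    using B assms(2)[of x] by (cases "norm x > R") (auto simp: less_imp_le)
  then show thesis using that B(1) by blast
qed

lemma integrable_lborel_bounded_support:
  fixes f :: "'a::euclidean_space \<Rightarrow> 'b::{banach, second_countable_topology}"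
  assumes [measurable]: "f \<in> borel_measurable borel" and "\<And>x. norm (f x) \<le> B"
    and "\<And>x. norm x > R \<Longrightarrow> f x = 0"
  shows "integrable lborel f"
proof (rule Bochner_Integration.integrable_bound)
  show "integrable lborel (\<lambda>x. B * indicator (cball 0 R) x :: real)"
    by (intro integrable_mult_right integrable_real_indicator)
      (use emeasure_lborel_cball_finite[of 0 R] in auto)
  show "AE x in lborel. norm (f x) \<le> norm (B * indicator (cball 0 R) x :: real)"
    using assms(2,3) by (intro AE_I2) (auto simp: indicator_def abs_mult intro: order_trans[OF _ abs_ge_self])
qed simp

lemma integrable_lborel_continuous_compact:
  fixes f :: "'a::euclidean_space \<Rightarrow> 'b::{banach, second_countable_topology}"
  assumes "continuous_on UNIV f" and "\<And>x. norm x > R \<Longrightarrow> f x = 0"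
  shows "integrable lborel f"
proof -
  obtain B where "\<And>x. norm (f x) \<le> B" using continuous_compact_bounded[OF assms] by blast
  with borel_measurable_continuous_onI[OF assms(1)] show ?thesis
    by (rule integrable_lborel_bounded_support) (use assms(2) in auto)
qed

text \<open>Near \<open>x\<close> the function agrees with 0, because the complement of
  \<open>S\<close> is open. Hence derivatives of kernels keep the support radius.\<close>

lemma has_partials_vanish:
  assumes "has_partials f f'" "closed S" "\<And>y. y \<notin> S \<Longrightarrow> f y = 0" "x \<notin> S"
  shows "f' i x = 0"
proof -
  have "((\<lambda>y. 0) has_derivative (\<lambda>h. 0)) (at x)" by simp
  then have "(f has_derivative (\<lambda>h. 0)) (at x)"
    by (rule has_derivative_transform_within_open[where s = "- S"]) (use assms in auto)
  moreover have "(f has_derivative (\<lambda>h. \<Sum>i\<in>UNIV. h $ i *\<^sub>R f' i x)) (at x)"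
    using assms(1) unfolding has_partials_def by blast
  ultimately have "(\<lambda>h. 0) = (\<lambda>h. \<Sum>i\<in>UNIV. h $ i *\<^sub>R f' i x)"
    by (rule has_derivative_unique)
  then have "0 = (\<Sum>j\<in>UNIV. axis i 1 $ j *\<^sub>R f' j x)" by metis
  also have "\<dots> = (\<Sum>j\<in>UNIV. if j = i then f' j x else 0)"
    by (intro sum.cong) (auto simp: axis_def)
  finally show ?thesis by simp
qed

section \<open>Mean value and Taylor estimates\<close>

lemma has_partials_line:
  fixes f :: "real^'n::finite \<Rightarrow> real"
  assumes "has_partials f f'"
  shows "((\<lambda>t. f (x + t *\<^sub>R h)) has_real_derivative (\<Sum>i\<in>UNIV. h $ i * f' i (x + t *\<^sub>R h))) (at t)"
proof -
  have "((\<lambda>t. f (x + t *\<^sub>R h)) has_derivative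
     (\<lambda>s. \<Sum>i\<in>UNIV. (s *\<^sub>R h) $ i *\<^sub>R f' i (x + t *\<^sub>R h))) (at t)"
  proof (rule has_derivative_compose[where f = "\<lambda>t. x + t *\<^sub>R h" and f' = "\<lambda>s. s *\<^sub>R h"
        and g = f and g' = "\<lambda>k. \<Sum>i\<in>UNIV. k $ i *\<^sub>R f' i (x + t *\<^sub>R h)"])
    show "((\<lambda>t. x + t *\<^sub>R h) has_derivative (\<lambda>s. s *\<^sub>R h)) (at t)"
      by (auto intro!: derivative_eq_intros)
    show "(f has_derivative (\<lambda>k. \<Sum>i\<in>UNIV. k $ i *\<^sub>R f' i (x + t *\<^sub>R h))) (at (x + t *\<^sub>R h))"
      using assms unfolding has_partials_def by blast
  qed
  then show ?thesis
    unfolding has_field_derivative_def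
    by (rule has_derivative_eq_rhs) (auto simp: sum_distrib_left mult_ac intro!: ext)
qed

lemma has_partials_mvt:
  fixes f :: "real^'n::finite \<Rightarrow> real"
  assumes "has_partials f f'"
  obtains t where "0 < t" "t < 1" "f (x + h) - f x = (\<Sum>i\<in>UNIV. h $ i * f' i (x + t *\<^sub>R h))"
  using MVT2[of 0 1 "\<lambda>t. f (x + t *\<^sub>R h)", OF zero_less_one has_partials_line[OF assms]]
  by auto

text \<open>The factor \<open>CARD('n)\<close> comes from estimating each coordinate of
  \<open>h\<close> separately by \<open>norm h\<close>.\<close>

lemma has_partials_lipschitz:
  fixes f :: "real^'n::finite \<Rightarrow> real" and B :: real
  assumes "has_partials f f'" and B: "\<And>i x. \<bar>f' i x\<bar> \<le> B"
  shows "\<bar>f (x + h) - f x\<bar> \<le> CARD('n) * B * norm h"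
proof -
  obtain t where "f (x + h) - f x = (\<Sum>i\<in>UNIV. h $ i * f' i (x + t *\<^sub>R h))"
    using has_partials_mvt[OF assms(1)] by blast
  moreover have "\<bar>\<Sum>i\<in>UNIV. h $ i * f' i (x + t *\<^sub>R h)\<bar> \<le> (\<Sum>i\<in>(UNIV::'n set). norm h * B)"
    by (rule order_trans[OF sum_abs], rule sum_mono, unfold abs_mult, rule mult_mono)
      (use B component_le_norm_cart in auto)
  ultimately show ?thesis by (simp add: algebra_simps)
qed

text \<open>The mean value theorem for \<open>f\<close>, then the Lipschitz bound for each
  \<open>f' i\<close>. The squared norm is the shape that \<open>has_derivative_quadratic\<close>
  accepts.\<close>

lemma has_partials_taylor:
  fixes f :: "real^'n::finite \<Rightarrow> real" and B :: real
  assumes f: "has_partials f f'" and f': "\<And>i. has_partials (f' i) (f'' i)"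
    and B: "\<And>i j x. \<bar>f'' i j x\<bar> \<le> B"
  shows "\<bar>f (x + h) - f x - (\<Sum>i\<in>UNIV. h $ i * f' i x)\<bar> \<le> (CARD('n))\<^sup>2 * B * (norm h)\<^sup>2"
proof -
  obtain t where t: "0 < t" "t < 1" "f (x + h) - f x = (\<Sum>i\<in>UNIV. h $ i * f' i (x + t *\<^sub>R h))"
    using has_partials_mvt[OF f] by blast
  have B0: "0 \<le> B" by (rule order_trans[OF abs_ge_zero B])
  have "f (x + h) - f x - (\<Sum>i\<in>UNIV. h $ i * f' i x) = (\<Sum>i\<in>UNIV. h $ i * (f' i (x + t *\<^sub>R h) - f' i x))"
    by (simp add: t(3) right_diff_distrib sum_subtractf)
  also have "\<bar>\<dots>\<bar> \<le> (\<Sum>i\<in>(UNIV::'n set). norm h * (CARD('n) * B * norm h))"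
  proof (rule order_trans[OF sum_abs], rule sum_mono, unfold abs_mult, rule mult_mono)
    fix i
    have "\<bar>f' i (x + t *\<^sub>R h) - f' i x\<bar> \<le> CARD('n) * B * norm (t *\<^sub>R h)"
      by (rule has_partials_lipschitz[OF f' B])
    also have "\<dots> \<le> CARD('n) * B * norm h"
      using t B0 by (intro mult_left_mono) (auto simp: mult_left_le_one_le)
    finally show "\<bar>f' i (x + t *\<^sub>R h) - f' i x\<bar> \<le> CARD('n) * B * norm h" .
  qed (use component_le_norm_cart in auto)
  also have "\<dots> = (CARD('n))\<^sup>2 * B * (norm h)\<^sup>2" by (simp add: power2_eq_square)
  finally show ?thesis .
qed

section \<open>Convolution with smooth kernels\<close>

definition conv :: "(real^'n::finite \<Rightarrow> real) \<Rightarrow> (real^'n \<Rightarrow> real) \<Rightarrow> real^'n \<Rightarrow> real" where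
  "conv f \<rho> x = (LINT y|lborel. f y * \<rho> (x - y))"

text \<open>The support radius is kept explicit because it later becomes the mollification
  scale.\<close>

definition kernel :: "real \<Rightarrow> (real^'n::finite \<Rightarrow> real) \<Rightarrow> bool" where
  "kernel R \<rho> \<longleftrightarrow> smooth \<rho> \<and> (\<forall>x. norm x > R \<longrightarrow> \<rho> x = 0)"

lemma kernel_partial_deriv: "kernel R \<rho> \<Longrightarrow> kernel R (partial_deriv i \<rho>)"
  unfolding kernel_def
  using has_partials_vanish[OF smooth_has_partials, of \<rho> "cball 0 R"] smooth_partial_deriv[of \<rho> i]
  by auto

lemma kernel_continuous: "kernel R \<rho> \<Longrightarrow> continuous_on UNIV \<rho>"
  unfolding kernel_def using smooth_continuous by blast

lemma kernel_measurable: "kernel R \<rho> \<Longrightarrow> \<rho> \<in> borel_measurable borel"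
  using kernel_continuous borel_measurable_continuous_onI by blast

lemma kernel_has_partials: "kernel R \<rho> \<Longrightarrow> has_partials \<rho> (\<lambda>i. partial_deriv i \<rho>)"
  unfolding kernel_def using smooth_has_partials by blast

lemma kernel_bounded:
  assumes "kernel R \<rho>"
  obtains B where "B > 0" "\<And>x. norm (\<rho> x) \<le> B"
  using continuous_compact_bounded[OF kernel_continuous[OF assms], of R] assms
  unfolding kernel_def by blast

lemma kernel_integrable: "kernel R \<rho> \<Longrightarrow> integrable lborel \<rho>"
  using integrable_lborel_continuous_compact[OF kernel_continuous] unfolding kernel_def by blast

text \<open>The alternative stands for the assumption that \<open>t\<close> is nonzero: for
  \<open>t = 0\<close> the function is constant and may fail to have compact support.\<close>

lemma kernel_test_function:
  assumes "kernel R \<rho>"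
  shows "(\<lambda>x. \<rho> (a + t *\<^sub>R x)) \<in> test_functions UNIV \<or> t = 0"
proof (cases "t = 0")
  case False
  have "{x. \<rho> (a + t *\<^sub>R x) \<noteq> 0} \<subseteq> cball 0 ((R + norm a) / \<bar>t\<bar>)"
  proof
    fix x assume "x \<in> {x. \<rho> (a + t *\<^sub>R x) \<noteq> 0}"
    then have "norm (a + t *\<^sub>R x) \<le> R" using assms unfolding kernel_def by force
    then have "norm (t *\<^sub>R x) \<le> R + norm a"
      using norm_triangle_ineq4[of "a + t *\<^sub>R x" a] by simp
    then show "x \<in> cball 0 ((R + norm a) / \<bar>t\<bar>)" using False by (simp add: field_simps)
  qed
  then have "bounded {x. \<rho> (a + t *\<^sub>R x) \<noteq> 0}" using bounded_cball bounded_subset by blast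
  then have "compact (closure {x. \<rho> (a + t *\<^sub>R x) \<noteq> 0})" by simp
  moreover have "smooth (\<lambda>x. \<rho> (a + t *\<^sub>R x))"
    using smooth_affine[of \<rho> 1 a t] assms unfolding kernel_def by simp
  ultimately show ?thesis unfolding test_functions_def by simp
qed simp

lemma test_function_kernel:
  assumes "\<phi> \<in> test_functions S"
  obtains R where "kernel R \<phi>"
proof -
  have "bounded {x. \<phi> x \<noteq> 0}"
    using assms compact_imp_bounded bounded_subset closure_subset unfolding test_functions_def by blast
  then obtain R where "\<And>x. \<phi> x \<noteq> 0 \<Longrightarrow> norm x \<le> R" unfolding bounded_iff by blast
  then have "kernel R \<phi>" using assms unfolding kernel_def test_functions_def by force
  then show thesis by (rule that)
qed

lemma integrable_mult_kernel:
  assumes "integrable lborel f" "kernel R \<rho>"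
  shows "integrable lborel (\<lambda>y. f y * \<rho> (x - y))"
proof -
  obtain B where B: "B > 0" "\<And>x. norm (\<rho> x) \<le> B" using kernel_bounded[OF assms(2)] by blast
  note [measurable] = kernel_measurable[OF assms(2)]
  have [measurable]: "f \<in> borel_measurable borel" using assms(1) by auto
  show ?thesis
  proof (rule Bochner_Integration.integrable_bound)
    show "integrable lborel (\<lambda>y. B * f y)" using assms(1) by simp
    show "AE y in lborel. norm (f y * \<rho> (x - y)) \<le> norm (B * f y)"
      using B by (intro AE_I2) (simp add: abs_mult mult.commute[of B] mult_left_mono)
  qed simp
qed

text \<open>Differentiation under the integral without a limit theorem: the Taylor remainder of the
  kernel is quadratic uniformly in the base point, and integrating it against \<open>f\<close>
  leaves a quadratic remainder for the convolution.\<close>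

lemma conv_has_partials:
  assumes f: "integrable lborel f" and \<rho>: "kernel R \<rho>"
  shows "has_partials (conv f \<rho>) (\<lambda>i. conv f (partial_deriv i \<rho>))"
  unfolding has_partials_def
proof
  fix x
  let ?d = "\<lambda>i. partial_deriv i \<rho>" and ?dd = "\<lambda>i j. partial_deriv j (partial_deriv i \<rho>)"
  have k: "kernel R (?d i)" "kernel R (?dd i j)" for i j using \<rho> kernel_partial_deriv by blast+
  have ex: "\<exists>B. \<forall>x. \<bar>?dd i j x\<bar> \<le> B" for i j
    using kernel_bounded[OF k(2)[of j i]] unfolding real_norm_def by metis
  define B where "B i j = (SOME B. \<forall>x. \<bar>?dd i j x\<bar> \<le> B)" for i j
  have B: "\<bar>?dd i j x\<bar> \<le> B i j" for i j x
    using someI_ex[OF ex] unfolding B_def by blast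
  \<comment> \<open>The sum of the individual bounds serves all pairs of indices at once, as the
    Taylor estimate requires.\<close>
  define B' where "B' = (\<Sum>i\<in>UNIV. \<Sum>j\<in>UNIV. B i j)"
  have B0: "0 \<le> B i j" for i j by (rule order_trans[OF abs_ge_zero B])
  have "B i j \<le> B'" for i j
  proof -
    have "B i j \<le> (\<Sum>j\<in>UNIV. B i j)" using B0 by (intro member_le_sum) auto
    also have "\<dots> \<le> B'" unfolding B'_def
      by (rule member_le_sum[of i UNIV "\<lambda>i. \<Sum>j\<in>UNIV. B i j"]) (auto intro: sum_nonneg B0)
    finally show ?thesis .
  qed
  then have B': "\<bar>?dd i j x\<bar> \<le> B'" for i j x using B order_trans by blast
  define L where "L = (CARD('a))\<^sup>2 * B'"
  have T: "\<bar>\<rho> (z + h) - \<rho> z - (\<Sum>i\<in>UNIV. h $ i * ?d i z)\<bar> \<le> L * (norm h)\<^sup>2" for z h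
    unfolding L_def by (rule has_partials_taylor[OF kernel_has_partials[OF \<rho>] kernel_has_partials[OF k(1)] B'])
  show "(conv f \<rho> has_derivative (\<lambda>h. \<Sum>i\<in>UNIV. h $ i *\<^sub>R conv f (?d i) x)) (at x)"
  proof (rule has_derivative_quadratic)
    show "bounded_linear (\<lambda>h. \<Sum>i\<in>UNIV. h $ i *\<^sub>R conv f (?d i) x)"
      by (intro bounded_linear_sum bounded_linear_scaleR_const bounded_linear_vec_nth)
    fix y
    define h where "h = y - x"
    note int = integrable_mult_kernel[OF f \<rho>] integrable_mult_kernel[OF f k(1)]
    have "conv f \<rho> y - conv f \<rho> x - (\<Sum>i\<in>UNIV. (y - x) $ i *\<^sub>R conv f (?d i) x)
       = (LINT z|lborel. f z * (\<rho> (x - z + h) - \<rho> (x - z) - (\<Sum>i\<in>UNIV. h $ i * ?d i (x - z))))"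
    proof -
      have "(LINT z|lborel. (f z * \<rho> (y - z) - f z * \<rho> (x - z)) - (\<Sum>i\<in>UNIV. h $ i * (f z * ?d i (x - z))))
         = conv f \<rho> y - conv f \<rho> x - (\<Sum>i\<in>UNIV. h $ i * conv f (?d i) x)"
        unfolding conv_def using int by simp
      then show ?thesis
        by (simp add: h_def algebra_simps sum_distrib_left)
    qed
    also have "norm \<dots> \<le> (LINT z|lborel. norm (f z) * (L * (norm h)\<^sup>2))"
    proof (rule Bochner_Integration.integral_norm_bound_integral)
      have "integrable lborel (\<lambda>z. (f z * \<rho> (y - z) - f z * \<rho> (x - z)) - (\<Sum>i\<in>UNIV. h $ i * (f z * ?d i (x - z))))"
        using int by simp
      then show "integrable lborel (\<lambda>z. f z * (\<rho> (x - z + h) - \<rho> (x - z) - (\<Sum>i\<in>UNIV. h $ i * ?d i (x - z))))"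
        by (simp add: h_def algebra_simps sum_distrib_left)
      show "integrable lborel (\<lambda>z. norm (f z) * (L * (norm h)\<^sup>2))" using f by simp
      show "norm (f z * (\<rho> (x - z + h) - \<rho> (x - z) - (\<Sum>i\<in>UNIV. h $ i * ?d i (x - z))))
         \<le> norm (f z) * (L * (norm h)\<^sup>2)" for z
        unfolding norm_mult by (intro mult_left_mono) (use T in auto)
    qed
    also have "\<dots> = (L * (LINT z|lborel. norm (f z))) * (norm (y - x))\<^sup>2"
      by (simp add: h_def mult_ac)
    finally show "norm (conv f \<rho> y - conv f \<rho> x - (\<Sum>i\<in>UNIV. (y - x) $ i *\<^sub>R conv f (?d i) x))
      \<le> (L * (LINT z|lborel. norm (f z))) * (norm (y - x))\<^sup>2" .
  qed
qed

text \<open>By translation invariance every difference quotient has integral zero, and dominated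
  convergence passes this to the derivative.\<close>

lemma integral_partial_eq_0:
  fixes f :: "real^'n::finite \<Rightarrow> real"
  assumes f: "has_partials f f'" and c: "continuous_on UNIV (f' j)" and R: "\<And>x. norm x > R \<Longrightarrow> f x = 0"
  shows "(LINT x|lborel. f' j x) = 0"
proof -
  have z: "f' j x = 0" if "norm x > R" for x
    using has_partials_vanish[OF f, of "cball 0 R"] that R by auto
  obtain B where B: "B > 0" "\<And>x. norm (f' j x) \<le> B"
    using continuous_compact_bounded[OF c z] by blast
  have intf: "integrable lborel f"
    by (rule integrable_lborel_continuous_compact[OF has_partials_continuous[OF f] R])
  have [measurable]: "f \<in> borel_measurable borel" using intf by auto
  have [measurable]: "f' j \<in> borel_measurable borel" by (rule borel_measurable_continuous_onI[OF c])
  let ?h = "\<lambda>n::nat. 1 / real (Suc n)"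
  let ?q = "\<lambda>n x. (f (x + ?h n *\<^sub>R axis j 1) - f x) / ?h n"
  have "(\<lambda>n. LINT x|lborel. ?q n x) \<longlonglongrightarrow> (LINT x|lborel. f' j x)"
  \<comment> \<open>The steps \<open>?h n\<close> are at most 1, so all difference quotients are
    supported in the ball of radius \<open>R + 1\<close>; the mean value theorem bounds them by
    \<open>B\<close>.\<close>
  proof (rule integral_dominated_convergence[where w = "\<lambda>x. B * indicator (cball 0 (R + 1)) x"])
    show "integrable lborel (\<lambda>x. B * indicator (cball 0 (R + 1)) x :: real)"
      by (intro integrable_mult_right integrable_real_indicator)
      (use emeasure_lborel_cball_finite[of 0 "R + 1"] in auto)
    have axis: "(\<Sum>i\<in>UNIV. axis j 1 $ i * g i) = g j" for g :: "'n \<Rightarrow> real"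
    proof -
      have "(\<Sum>i\<in>UNIV. axis j 1 $ i * g i) = (\<Sum>i\<in>UNIV. if i = j then g i else 0)"
        by (intro sum.cong) (auto simp: axis_def)
      then show ?thesis by simp
    qed
    show "AE x in lborel. (\<lambda>n. ?q n x) \<longlonglongrightarrow> f' j x"
    proof (intro AE_I2)
      fix x
      have "((\<lambda>t. f (x + t *\<^sub>R axis j 1)) has_real_derivative f' j x) (at 0)"
        using has_partials_line[OF f, of x "axis j 1" 0] by (simp add: axis)
      then have "((\<lambda>h. (f (x + h *\<^sub>R axis j 1) - f x) / h) \<longlongrightarrow> f' j x) (at 0)"
        unfolding DERIV_def by simp
      moreover have "filterlim ?h (at 0) sequentially"
        using LIMSEQ_inverse_real_of_nat
        by (intro filterlim_atI) (auto simp: divide_inverse simp del: of_nat_Suc)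
      ultimately show "(\<lambda>n. ?q n x) \<longlonglongrightarrow> f' j x"
        by (rule filterlim_compose)
    qed
    show "AE x in lborel. norm (?q n x) \<le> B * indicator (cball 0 (R + 1)) x" for n
    proof (intro AE_I2)
      fix x
      show "norm (?q n x) \<le> B * indicator (cball 0 (R + 1)) x"
      proof (cases "norm x \<le> R + 1")
        case True
        obtain t where t: "f (x + ?h n *\<^sub>R axis j 1) - f x
             = (\<Sum>i\<in>UNIV. (?h n *\<^sub>R axis j 1) $ i * f' i (x + t *\<^sub>R (?h n *\<^sub>R axis j 1)))"
          using has_partials_mvt[OF f] by blast
        also have "\<dots> = ?h n * (\<Sum>i\<in>UNIV. axis j 1 $ i * f' i (x + t *\<^sub>R (?h n *\<^sub>R axis j 1)))"
          unfolding sum_distrib_left by (intro sum.cong) auto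
        also have "\<dots> = ?h n * f' j (x + t *\<^sub>R (?h n *\<^sub>R axis j 1))" unfolding axis ..
        finally have "?q n x = f' j (x + t *\<^sub>R (?h n *\<^sub>R axis j 1))" by simp
        then show ?thesis using B True by simp
      next
        case False
        define w :: "real^'n" where "w = ?h n *\<^sub>R axis j 1"
        have "norm w \<le> 1" by (simp add: w_def)
        moreover have "norm x \<le> norm (x + w) + norm w"
          using norm_triangle_ineq4[of "x + w" w] by simp
        ultimately have "norm (x + w) > R" using False by linarith
        then have "f (x + ?h n *\<^sub>R axis j 1) = 0" unfolding w_def by (rule R)
        then show ?thesis using False R by simp
      qed
    qed
  qed auto
  moreover have "(LINT x|lborel. ?q n x) = 0" for n
  proof -
    have "integrable lborel (\<lambda>x. f (x + ?h n *\<^sub>R axis j 1))"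
      using integrable_lborel_affine[OF intf, of 1 "?h n *\<^sub>R axis j 1"] by (simp add: add.commute)
    moreover have "(LINT x|lborel. f (x + ?h n *\<^sub>R axis j 1)) = (LINT x|lborel. f x)"
      using integral_lborel_translate[of f "?h n *\<^sub>R axis j 1"] by (simp add: add.commute)
    ultimately show ?thesis by (simp add: intf del: of_nat_Suc)
  qed
  ultimately have "(\<lambda>n::nat. 0) \<longlonglongrightarrow> (LINT x|lborel. f' j x)" by simp
  then show ?thesis by (simp add: LIMSEQ_const_iff)
qed

text \<open>The product of \<open>f\<close> with the test function has compact support, so the
  integral of its derivative vanishes.\<close>

lemma integration_by_parts:
  fixes f :: "real^'n::finite \<Rightarrow> real"
  assumes f: "has_partials f f'" and c: "continuous_on UNIV (f' j)" and \<phi>: "kernel R \<phi>"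
  shows "(LINT x|lborel. f x * partial_deriv j \<phi> x) = - (LINT x|lborel. f' j x * \<phi> x)"
proof -
  let ?d = "partial_deriv j \<phi>"
  have k: "kernel R ?d" using kernel_partial_deriv[OF \<phi>] .
  have i1: "integrable lborel (\<lambda>x. f x * ?d x)"
    by (rule integrable_lborel_continuous_compact[of _ R])
      (use k in \<open>auto intro!: continuous_intros has_partials_continuous[OF f] kernel_continuous[OF k] simp: kernel_def\<close>)
  have i2: "integrable lborel (\<lambda>x. f' j x * \<phi> x)"
    by (rule integrable_lborel_continuous_compact[of _ R])
      (use \<phi> in \<open>auto intro!: continuous_intros c kernel_continuous[OF \<phi>] simp: kernel_def\<close>)
  have "(LINT x|lborel. f' j x * \<phi> x + f x * ?d x) = 0"
    by (rule integral_partial_eq_0[OF has_partials_mult[OF f kernel_has_partials[OF \<phi>]], of j R])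
      (use \<phi> k in \<open>auto intro!: continuous_intros c has_partials_continuous[OF f]
          kernel_continuous[OF k] kernel_continuous[OF \<phi>] simp: kernel_def\<close>)
  then show ?thesis using i1 i2 by simp
qed

lemma kernel_shift_partial:
  assumes "kernel R \<rho>"
  shows "partial_deriv j (\<lambda>y. \<rho> (x - y)) y = - partial_deriv j \<rho> (x - y)"
  using has_partials_partial_deriv[OF has_partials_affine[OF kernel_has_partials[OF assms], of x "-1"], of j]
  by simp

text \<open>The reflected translate of the kernel is itself a test function, and the sign from the
  reflection cancels the sign in the weak derivative.\<close>

lemma conv_weak_partial:
  assumes "\<And>\<phi>. \<phi> \<in> test_functions UNIV \<Longrightarrow>
      (LINT x|lborel. f x * partial_deriv j \<phi> x) = - (LINT x|lborel. g x * \<phi> x)"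
    and \<rho>: "kernel R \<rho>"
  shows "conv f (partial_deriv j \<rho>) = conv g \<rho>"
proof
  fix x
  have "(\<lambda>y. \<rho> (x - y)) \<in> test_functions UNIV"
    using kernel_test_function[OF \<rho>, of x "-1"] by simp
  from assms(1)[OF this] show "conv f (partial_deriv j \<rho>) x = conv g \<rho> x"
    unfolding conv_def kernel_shift_partial[OF \<rho>] by simp
qed

lemma conv_bound:
  assumes g: "\<And>x. \<bar>g x\<bar> \<le> B" and ig: "integrable lborel g" and \<rho>: "kernel R \<rho>"
  shows "\<bar>conv g \<rho> x\<bar> \<le> B * (LINT y|lborel. \<bar>\<rho> y\<bar>)"
proof -
  note [measurable] = kernel_measurable[OF \<rho>]
  have i: "integrable lborel (\<lambda>y. \<bar>\<rho> (x - y)\<bar>)"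
    using integrable_lborel_affine[OF kernel_integrable[OF \<rho>], of "-1" x] by simp
  have "norm (conv g \<rho> x) \<le> (LINT y|lborel. B * \<bar>\<rho> (x - y)\<bar>)"
    unfolding conv_def
    by (rule Bochner_Integration.integral_norm_bound_integral)
     (use integrable_mult_kernel[OF ig \<rho>] i g in \<open>auto simp: abs_mult mult_right_mono\<close>)
  also have "\<dots> = B * (LINT y|lborel. \<bar>\<rho> y\<bar>)"
    using integral_lborel_reflect[of "\<lambda>y. \<bar>\<rho> y\<bar>" x] by simp
  finally show ?thesis by simp
qed

lemma conv_reflect:
  assumes [measurable]: "g \<in> borel_measurable borel" and \<rho>: "kernel R \<rho>"
  shows "conv g \<rho> x = (LINT y|lborel. \<rho> y * g (x - y))"
proof -
  note [measurable] = kernel_measurable[OF \<rho>]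
  show ?thesis
    unfolding conv_def
    using integral_lborel_reflect[of "\<lambda>y. g y * \<rho> (x - y)" x] by (simp add: mult.commute)
qed

text \<open>The left-hand difference is an average of \<open>g (x - y) - g x\<close> with weights
  \<open>\<rho> y\<close>; Cauchy-Schwarz with respect to the weight and Fubini give the bound. The
  total mass of the kernel is left general on purpose: it is 1 for the mollifier, which yields the
  gradient error, and 0 for its derivatives, which yields the second derivative bound.\<close>

lemma conv_L2_modulus:
  fixes g :: "real^'n::finite \<Rightarrow> real"
  assumes g: "integrable lborel g" and \<rho>: "kernel R \<rho>"
    and M: "\<And>y. norm y \<le> R \<Longrightarrow> (\<integral>\<^sup>+x. ennreal ((g (x - y) - g x)\<^sup>2) \<partial>lborel) \<le> M"
  shows "(\<integral>\<^sup>+x. ennreal ((conv g \<rho> x - (LINT y|lborel. \<rho> y) * g x)\<^sup>2) \<partial>lborel)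
      \<le> ennreal ((LINT y|lborel. \<bar>\<rho> y\<bar>)\<^sup>2) * M"
proof -
  define I where "I = (LINT y|lborel. \<bar>\<rho> y\<bar>)"
  have I: "(\<integral>\<^sup>+y. ennreal \<bar>\<rho> y\<bar> \<partial>lborel) = ennreal I" "I \<ge> 0"
    unfolding I_def using kernel_integrable[OF \<rho>] by (auto intro!: nn_integral_eq_integral)
  note [measurable] = kernel_measurable[OF \<rho>]
  have [measurable]: "g \<in> borel_measurable borel" using g by auto
  have pt: "ennreal ((conv g \<rho> x - (LINT y|lborel. \<rho> y) * g x)\<^sup>2)
     \<le> ennreal I * (\<integral>\<^sup>+y. ennreal \<bar>\<rho> y\<bar> * ennreal ((g (x - y) - g x)\<^sup>2) \<partial>lborel)" for x
  proof -
    have "integrable lborel (\<lambda>y. \<rho> y * g (x - y))"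
      using integrable_lborel_affine[OF integrable_mult_kernel[OF g \<rho>, of x], of "-1" x]
      by (simp add: mult.commute)
    then have "conv g \<rho> x - (LINT y|lborel. \<rho> y) * g x = (LINT y|lborel. \<rho> y * g (x - y) - \<rho> y * g x)"
      using kernel_integrable[OF \<rho>] by (simp add: conv_reflect[OF _ \<rho>])
    also have "ennreal (norm (\<dots>)) \<le> (\<integral>\<^sup>+y. norm (\<rho> y * g (x - y) - \<rho> y * g x) \<partial>lborel)"
      by (rule integral_norm_bound_ennreal)
        (use \<open>integrable lborel (\<lambda>y. \<rho> y * g (x - y))\<close> kernel_integrable[OF \<rho>] in simp)
    \<comment> \<open>The weight is split into two square roots so that Cauchy-Schwarz leaves the
      full weight in both factors.\<close>
    also have "\<dots> = (\<integral>\<^sup>+y. ennreal (sqrt \<bar>\<rho> y\<bar>) * ennreal (sqrt \<bar>\<rho> y\<bar> * \<bar>g (x - y) - g x\<bar>) \<partial>lborel)"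
      by (intro nn_integral_cong)
        (simp add: ennreal_mult[symmetric] right_diff_distrib[symmetric] abs_mult mult.assoc[symmetric])
    finally have "(ennreal \<bar>conv g \<rho> x - (LINT y|lborel. \<rho> y) * g x\<bar>)\<^sup>2 \<le>
        (\<integral>\<^sup>+y. ennreal (sqrt \<bar>\<rho> y\<bar>) * ennreal (sqrt \<bar>\<rho> y\<bar> * \<bar>g (x - y) - g x\<bar>) \<partial>lborel)\<^sup>2"
      by (intro power_mono) auto
    also have "\<dots> \<le> (\<integral>\<^sup>+y. (ennreal (sqrt \<bar>\<rho> y\<bar>))\<^sup>2 \<partial>lborel) *
         (\<integral>\<^sup>+y. (ennreal (sqrt \<bar>\<rho> y\<bar> * \<bar>g (x - y) - g x\<bar>))\<^sup>2 \<partial>lborel)"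
      by (intro Cauchy_Schwarz_nn_integral) auto
    also have "\<dots> = ennreal I * (\<integral>\<^sup>+y. ennreal \<bar>\<rho> y\<bar> * ennreal ((g (x - y) - g x)\<^sup>2) \<partial>lborel)"
      by (simp add: ennreal_power power_mult_distrib ennreal_mult I)
    finally show ?thesis by (simp add: ennreal_power)
  qed
  have "(\<integral>\<^sup>+x. ennreal ((conv g \<rho> x - (LINT y|lborel. \<rho> y) * g x)\<^sup>2) \<partial>lborel)
      \<le> (\<integral>\<^sup>+x. ennreal I * (\<integral>\<^sup>+y. ennreal \<bar>\<rho> y\<bar> * ennreal ((g (x - y) - g x)\<^sup>2) \<partial>lborel) \<partial>lborel)"
    by (intro nn_integral_mono pt)
  also have "\<dots> = ennreal I * (\<integral>\<^sup>+y. (\<integral>\<^sup>+x. ennreal \<bar>\<rho> y\<bar> * ennreal ((g (x - y) - g x)\<^sup>2) \<partial>lborel) \<partial>lborel)"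
    by (subst nn_integral_cmult, measurable) (subst lborel_pair.Fubini', auto)
  also have "\<dots> \<le> ennreal I * (\<integral>\<^sup>+y. ennreal \<bar>\<rho> y\<bar> * M \<partial>lborel)"
  proof (intro mult_left_mono nn_integral_mono)
    fix y
    show "(\<integral>\<^sup>+x. ennreal \<bar>\<rho> y\<bar> * ennreal ((g (x - y) - g x)\<^sup>2) \<partial>lborel) \<le> ennreal \<bar>\<rho> y\<bar> * M"
    proof (cases "norm y \<le> R")
      case True
      then show ?thesis using M by (subst nn_integral_cmult) (auto intro: mult_left_mono)
    next
      case False
      then have "\<rho> y = 0" using \<rho> unfolding kernel_def by auto
      then show ?thesis by simp
    qed
  qed auto
  also have "\<dots> = ennreal (I\<^sup>2) * M"
    using I by (subst nn_integral_multc)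
      (auto simp: ennreal_mult power2_eq_square mult.assoc)
  finally show ?thesis unfolding I_def .
qed

section \<open>Gaussians and the Fourier transform\<close>

text \<open>The characteristic function of the standard normal law, cleared of its normalising
  factor.\<close>

lemma integral_cis_gaussian_1d:
  "integrable lborel (\<lambda>x::real. cis (t * x) * of_real (exp (- (x\<^sup>2) / 2)))"
  "(LINT x|lborel. cis (t * x) * of_real (exp (- (x\<^sup>2) / 2))) = of_real (sqrt (2 * pi) * exp (- (t\<^sup>2) / 2))"
proof -
  have "char std_normal_distribution t = (LINT x|lborel. std_normal_density x *\<^sub>R cis (t * x))"
    unfolding char_def by (subst integral_density) (auto simp: cis_conv_exp)
  also have "\<dots> = (LINT x|lborel. of_real (1 / sqrt (2 * pi)) * (cis (t * x) * of_real (exp (- (x\<^sup>2) / 2))))"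
    by (simp add: std_normal_density_def scaleR_conv_of_real mult_ac)
  also have "\<dots> = of_real (1 / sqrt (2 * pi)) * (LINT x|lborel. cis (t * x) * of_real (exp (- (x\<^sup>2) / 2)))"
    by (rule integral_mult_right_zero)
  finally have "of_real (1 / sqrt (2 * pi)) * (LINT x|lborel. cis (t * x) * of_real (exp (- (x\<^sup>2) / 2))) =
      (of_real (exp (- (t\<^sup>2) / 2)) :: complex)"
    by (simp add: char_std_normal_distribution)
  then show "(LINT x|lborel. cis (t * x) * of_real (exp (- (x\<^sup>2) / 2))) = of_real (sqrt (2 * pi) * exp (- (t\<^sup>2) / 2))"
    by (simp add: field_simps)
  have "integrable lborel (\<lambda>x. sqrt (2 * pi) * std_normal_density x)"
    by simp
  then show "integrable lborel (\<lambda>x::real. cis (t * x) * of_real (exp (- (x\<^sup>2) / 2)))"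
    by (rule Bochner_Integration.integrable_bound)
      (auto simp: norm_mult std_normal_density_def intro!: borel_measurable_continuous_onI continuous_intros)
qed

text \<open>This is (2 * pi) powr (n / 2); its square is the factor in Plancherel's identity for the
  transform without normalisation.\<close>

abbreviation gauss_const :: "'a::euclidean_space itself \<Rightarrow> real" where
  "gauss_const TYPE('a) \<equiv> sqrt (2 * pi) ^ DIM('a)"

text \<open>The integrand factors over the coordinates, and \<open>lborel\<close> is the image of a
  product of one-dimensional measures.\<close>

lemma integral_cis_gaussian:
  fixes \<xi> :: "'a::euclidean_space"
  shows "integrable lborel (\<lambda>x::'a. cis (- (x \<bullet> \<xi>)) * of_real (exp (- (norm x)\<^sup>2 / 2)))" (is ?I)
    and "(LINT x|lborel. cis (- (x \<bullet> \<xi>)) * of_real (exp (- (norm x)\<^sup>2 / 2)))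
        = of_real (gauss_const TYPE('a) * exp (- (norm \<xi>)\<^sup>2 / 2))" (is ?E)
proof -
  let ?f = "\<lambda>b x. cis (- (\<xi> \<bullet> b) * x) * (of_real (exp (- (x\<^sup>2) / 2)) :: complex)"
  interpret product_sigma_finite "\<lambda>_::'a. lborel :: real measure" ..
  have norm2: "(norm x)\<^sup>2 = (\<Sum>b\<in>Basis. (x \<bullet> b)\<^sup>2)" for x :: 'a
    unfolding power2_norm_eq_inner by (subst euclidean_inner) (simp add: power2_eq_square)
  have cis_sum: "cis (\<Sum>b\<in>B. g b) = (\<Prod>b\<in>B. cis (g b))" if "finite B" for B :: "'a set" and g
    using that by induction (auto simp: cis_mult[symmetric])
  have eq: "cis (- (x \<bullet> \<xi>)) * of_real (exp (- (norm x)\<^sup>2 / 2)) = (\<Prod>b\<in>Basis. ?f b (x \<bullet> b))" for x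
  proof -
    have "cis (- (x \<bullet> \<xi>)) = (\<Prod>b\<in>Basis. cis (- (\<xi> \<bullet> b) * (x \<bullet> b)))"
      by (subst cis_sum[symmetric], simp, subst euclidean_inner) (simp add: sum_negf mult.commute)
    moreover have "exp (- (norm x)\<^sup>2 / 2) = (\<Prod>b\<in>Basis. exp (- ((x \<bullet> b)\<^sup>2) / 2))"
      unfolding norm2 by (subst exp_sum[symmetric]) (auto simp: sum_divide_distrib sum_negf)
    ultimately show ?thesis by (simp add: prod.distrib)
  qed
  have inn: "(\<Sum>b\<in>Basis. f b *\<^sub>R b) \<bullet> c = f c" if "c \<in> Basis" for f :: "'a \<Rightarrow> real" and c
    using that by simp
  have meas: "(\<lambda>x. \<Prod>b\<in>Basis. ?f b (x \<bullet> b)) \<in> borel_measurable (borel :: 'a measure)"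
    by (intro borel_measurable_continuous_onI continuous_intros) auto
  have int: "integrable lborel (?f b)" for b by (rule integral_cis_gaussian_1d)
  have "integrable (\<Pi>\<^sub>M b\<in>Basis. lborel) (\<lambda>x. \<Prod>b\<in>Basis. ?f b (x b))"
    by (intro product_integrable_prod int) auto
  then have "integrable (\<Pi>\<^sub>M b\<in>Basis. lborel) (\<lambda>f. \<Prod>b\<in>Basis. ?f b ((\<Sum>b\<in>Basis. f b *\<^sub>R b) \<bullet> b))"
    by (simp add: inn cong: prod.cong)
  then show ?I
    unfolding eq by (subst lborel_eq, subst integrable_distr_eq[OF _ meas]) auto
  have "(LINT x|lborel. (\<Prod>b\<in>Basis. ?f b (x \<bullet> b))) =
      (LINT f|(\<Pi>\<^sub>M b\<in>Basis. lborel). (\<Prod>b\<in>Basis. ?f b ((\<Sum>b\<in>Basis. f b *\<^sub>R b) \<bullet> b)))"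
    by (subst lborel_eq, subst integral_distr[OF _ meas]) auto
  also have "\<dots> = (LINT f|(\<Pi>\<^sub>M b\<in>Basis. lborel). (\<Prod>b\<in>Basis. ?f b (f b)))"
    by (simp add: inn cong: prod.cong)
  also have "\<dots> = (\<Prod>b\<in>(Basis::'a set). integral\<^sup>L lborel (?f b))"
    by (intro product_integral_prod int) auto
  also have "\<dots> = (\<Prod>b\<in>(Basis::'a set). of_real (sqrt (2 * pi) * exp (- ((\<xi> \<bullet> b)\<^sup>2) / 2)))"
    unfolding integral_cis_gaussian_1d(2) by simp
  also have "\<dots> = of_real (gauss_const TYPE('a) * exp (- (norm \<xi>)\<^sup>2 / 2))"
    unfolding norm2 of_real_prod[symmetric] prod.distrib
    by (subst exp_sum[symmetric]) (auto simp: sum_divide_distrib sum_negf exp_sum)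
  finally show ?E unfolding eq .
qed

text \<open>The Fourier transform of \<open>gauss \<delta>\<close> is a multiple of the probability density \<open>heat \<delta>\<close>, which
  concentrates at the origin as \<open>\<delta>\<close> tends to 0.\<close>

definition gauss :: "real \<Rightarrow> 'a::euclidean_space \<Rightarrow> real" where
  "gauss \<delta> x = exp (- (\<delta> / 2) * (norm x)\<^sup>2)"

definition heat :: "real \<Rightarrow> 'a::euclidean_space \<Rightarrow> real" where
  "heat \<delta> x = exp (- (norm x)\<^sup>2 / (2 * \<delta>)) / (gauss_const TYPE('a) * sqrt \<delta> ^ DIM('a))"

lemma gauss_measurable [measurable]: "gauss \<delta> \<in> borel_measurable borel"
  unfolding gauss_def[abs_def] by (intro borel_measurable_continuous_onI continuous_intros)

lemma heat_measurable [measurable]: "heat \<delta> \<in> borel_measurable borel"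
  unfolding heat_def[abs_def] by measurable

lemma gauss_simps: "gauss \<delta> x > 0" "gauss \<delta> (- x) = gauss \<delta> x" "\<delta> > 0 \<Longrightarrow> gauss \<delta> x \<le> 1"
  by (auto simp: gauss_def)

lemma heat_simps: "\<delta> > 0 \<Longrightarrow> heat \<delta> x > 0" "heat \<delta> (- x) = heat \<delta> x"
  by (auto simp: heat_def)

lemma heat_commute: "heat \<delta> (x - y) = heat \<delta> (y - x)"
  unfolding heat_def by (simp add: norm_minus_commute)

text \<open>Substituting \<open>sqrt \<delta> *\<^sub>R x\<close> reduces to the unit Gaussian at
  the frequency divided by \<open>sqrt \<delta>\<close>.\<close>

lemma fourier_gauss:
  fixes \<xi> :: "'a::euclidean_space"
  assumes "\<delta> > 0"
  shows "integrable lborel (\<lambda>x::'a. cis (- (x \<bullet> \<xi>)) * of_real (gauss \<delta> x))"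
    and "(LINT x|lborel. cis (- (x \<bullet> \<xi>)) * of_real (gauss \<delta> x)) = of_real ((gauss_const TYPE('a))\<^sup>2 * heat \<delta> \<xi>)"
proof -
  let ?c = "sqrt \<delta>" and ?\<eta> = "(1 / sqrt \<delta>) *\<^sub>R \<xi>"
  let ?g = "\<lambda>x::'a. cis (- (x \<bullet> ?\<eta>)) * complex_of_real (exp (- (norm x)\<^sup>2 / 2))"
  have eq: "?g (0 + ?c *\<^sub>R x) = cis (- (x \<bullet> \<xi>)) * of_real (gauss \<delta> x)" for x
    using assms by (simp add: gauss_def power_mult_distrib)
  show "integrable lborel (\<lambda>x::'a. cis (- (x \<bullet> \<xi>)) * of_real (gauss \<delta> x))"
    using integrable_lborel_affine[OF integral_cis_gaussian(1)[of ?\<eta>], of ?c 0] assms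
    unfolding eq by simp
  have m: "?g \<in> borel_measurable borel" using integral_cis_gaussian(1)[of ?\<eta>] by (auto dest: borel_measurable_integrable)
  have 1: "(LINT x|lborel. ?g x) = sqrt \<delta> ^ DIM('a) *\<^sub>R (LINT x|lborel. cis (- (x \<bullet> \<xi>)) * of_real (gauss \<delta> x))"
    using integral_lborel_affine[OF m, of ?c 0] assms unfolding eq by simp
  have 2: "(LINT x|lborel. ?g x) = of_real (gauss_const TYPE('a) * exp (- (norm \<xi>)\<^sup>2 / (2 * \<delta>)))"
    using integral_cis_gaussian(2)[of ?\<eta>] assms by (simp add: power_divide)
  have "of_real (sqrt \<delta> ^ DIM('a)) * (LINT x|lborel. cis (- (x \<bullet> \<xi>)) * of_real (gauss \<delta> x)) =
      (of_real (gauss_const TYPE('a) * exp (- (norm \<xi>)\<^sup>2 / (2 * \<delta>))) :: complex)"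
    unfolding 2[symmetric] 1 scaleR_conv_of_real ..
  moreover have "gauss_const TYPE('a) * exp (- (norm \<xi>)\<^sup>2 / (2 * \<delta>)) =
      sqrt \<delta> ^ DIM('a) * ((gauss_const TYPE('a))\<^sup>2 * heat \<delta> \<xi>)"
    using assms by (simp add: heat_def power2_eq_square)
  ultimately have "of_real (sqrt \<delta> ^ DIM('a)) * (LINT x|lborel. cis (- (x \<bullet> \<xi>)) * of_real (gauss \<delta> x)) =
      (of_real (sqrt \<delta> ^ DIM('a)) * of_real ((gauss_const TYPE('a))\<^sup>2 * heat \<delta> \<xi>) :: complex)"
    by (simp only: of_real_mult)
  then show "(LINT x|lborel. cis (- (x \<bullet> \<xi>)) * of_real (gauss \<delta> x)) = of_real ((gauss_const TYPE('a))\<^sup>2 * heat \<delta> \<xi>)"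
    using assms by (subst (asm) mult_cancel_left) simp
qed

lemma gauss_integrable: "\<delta> > 0 \<Longrightarrow> integrable lborel (gauss \<delta> :: 'a::euclidean_space \<Rightarrow> real)"
  using integrable_norm[OF fourier_gauss(1)[of \<delta> "0::'a"]]
  by (simp add: abs_of_pos gauss_simps(1))

lemma heat_eq_gauss: "\<delta> > 0 \<Longrightarrow> heat \<delta> (x::'a::euclidean_space)
    = gauss (1/\<delta>) x / (gauss_const TYPE('a) * sqrt \<delta> ^ DIM('a))"
  unfolding heat_def gauss_def by simp

text \<open>\<open>heat \<delta>\<close> is a multiple of the Gaussian with parameter 1/\<delta>, so
  its mass is read off from the transform of that Gaussian at frequency 0.\<close>

lemma heat_integral:
  assumes "\<delta> > 0"
  shows "integrable lborel (heat \<delta> :: 'a::euclidean_space \<Rightarrow> real)" "(LINT x::'a|lborel. heat \<delta> x) = 1"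
    "(\<integral>\<^sup>+x. heat \<delta> (x::'a) \<partial>lborel) = 1"
proof -
  show i: "integrable lborel (heat \<delta> :: 'a \<Rightarrow> real)"
    unfolding heat_eq_gauss[OF assms, abs_def] using gauss_integrable[of "1/\<delta>", where 'a = 'a] assms by simp
  have "complex_of_real (LINT x::'a|lborel. gauss (1/\<delta>) x) = of_real ((gauss_const TYPE('a))\<^sup>2 * heat (1/\<delta>) (0::'a))"
    using fourier_gauss(2)[of "1/\<delta>" "0::'a"] assms by simp
  then have "(LINT x::'a|lborel. gauss (1/\<delta>) x) = (gauss_const TYPE('a))\<^sup>2 * heat (1/\<delta>) (0::'a)"
    using of_real_eq_iff by blast
  then show e: "(LINT x::'a|lborel. heat \<delta> x) = 1"
    unfolding heat_eq_gauss[OF assms] using assms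
    by (simp add: heat_def power2_eq_square real_sqrt_divide power_divide)
  show "(\<integral>\<^sup>+x. heat \<delta> (x::'a) \<partial>lborel) = 1"
    using nn_integral_eq_integral[OF i AE_I2] e heat_simps(1)[OF assms, where 'a = 'a] by (simp add: less_imp_le)
qed

lemma heat_shift_integral:
  assumes "\<delta> > 0"
  shows "(\<integral>\<^sup>+x. heat \<delta> (x - (a::'a::euclidean_space)) \<partial>lborel) = 1" "(\<integral>\<^sup>+x. heat \<delta> (a - x) \<partial>lborel) = 1"
    "(\<integral>\<^sup>+x. heat \<delta> (x + a) \<partial>lborel) = 1"
    "integrable lborel (\<lambda>x. heat \<delta> (x - a))"
proof -
  show 2: "(\<integral>\<^sup>+x. heat \<delta> (a - x) \<partial>lborel) = 1"
    using nn_integral_lborel_reflect[of "\<lambda>x. ennreal (heat \<delta> x)" a] heat_integral(3)[OF assms, where 'a = 'a] by simp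
  then show "(\<integral>\<^sup>+x. heat \<delta> (x - a) \<partial>lborel) = 1" by (subst heat_commute)
  show "(\<integral>\<^sup>+x. heat \<delta> (x + a) \<partial>lborel) = 1"
    using nn_integral_lborel_translate[of "\<lambda>x. ennreal (heat \<delta> x)" a] heat_integral(3)[OF assms, where 'a = 'a]
    by (simp add: add.commute)
  show "integrable lborel (\<lambda>x. heat \<delta> (x - a))"
    using integrable_lborel_affine[OF heat_integral(1)[OF assms], of 1 "- a"] by simp
qed

section \<open>The Fourier transform of integrable functions\<close>

definition ft :: "('a::euclidean_space \<Rightarrow> complex) \<Rightarrow> 'a \<Rightarrow> complex" where
  "ft f \<xi> = (LINT x|lborel. cis (- (x \<bullet> \<xi>)) * f x)"

lemma integrable_cis_mult:
  assumes "integrable lborel f"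
  shows "integrable lborel (\<lambda>x. cis (- (x \<bullet> \<xi>)) * f x)"
proof (rule Bochner_Integration.integrable_bound[OF assms])
  have [measurable]: "f \<in> borel_measurable borel" using assms by auto
  have [measurable]: "(\<lambda>x. cis (- (x \<bullet> \<xi>))) \<in> borel_measurable borel"
    by (intro borel_measurable_continuous_onI continuous_intros)
  show "(\<lambda>x. cis (- (x \<bullet> \<xi>)) * f x) \<in> borel_measurable lborel" by simp
qed (simp add: norm_mult)

lemma measurable_cis_inner [measurable]:
  "(\<lambda>p. cis (- (fst p \<bullet> snd p))) \<in> borel_measurable (borel \<Otimes>\<^sub>M (borel :: 'a::euclidean_space measure))"
proof -
  have "(\<lambda>p::'a\<times>'a. cis (- (fst p \<bullet> snd p))) \<in> borel_measurable borel"
    by (intro borel_measurable_continuous_onI continuous_intros)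
  then show ?thesis by (simp add: borel_prod)
qed

lemma ft_measurable [measurable]:
  assumes [measurable]: "f \<in> borel_measurable borel"
  shows "ft f \<in> borel_measurable (borel :: 'a::euclidean_space measure)"
proof -
  have "(\<lambda>p::'a\<times>'a. cis (- (snd p \<bullet> fst p)) * f (snd p)) \<in> borel_measurable (lborel \<Otimes>\<^sub>M lborel)"
    using measurable_cis_inner by (simp add: inner_commute cong: measurable_cong_sets)
  then have "(\<lambda>(\<xi>, x). cis (- (x \<bullet> \<xi>)) * f x) \<in> borel_measurable (lborel \<Otimes>\<^sub>M lborel)"
    by (simp add: case_prod_beta)
  from lborel.borel_measurable_lebesgue_integral[OF this]
  show ?thesis unfolding ft_def[abs_def] by simp
qed

lemma ft_bound:
  assumes "integrable lborel f"
  shows "norm (ft f \<xi>) \<le> (LINT x|lborel. norm (f x))"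
  using integral_norm_bound[of lborel "\<lambda>x. cis (- (x \<bullet> \<xi>)) * f x"] by (simp add: ft_def norm_mult)

text \<open>The multiplication formula: Fubini applies since \<open>f (fst p) * g (snd p)\<close> is
  integrable on the product and the character has modulus 1.\<close>

lemma ft_mult:
  fixes f g :: "'a::euclidean_space \<Rightarrow> complex"
  assumes f: "integrable lborel f" and g: "integrable lborel g"
  shows "(LINT x|lborel. ft f x * g x) = (LINT x|lborel. f x * ft g x)"
proof -
  have [measurable]: "f \<in> borel_measurable borel" "g \<in> borel_measurable borel" using f g by auto
  have "integrable (lborel \<Otimes>\<^sub>M lborel) (\<lambda>p::'a\<times>'a. f (fst p) * g (snd p))"
    using lborel_pair.Fubini_integrable[of "\<lambda>p::'a\<times>'a. f (fst p) * g (snd p)"] f g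
    by (simp add: norm_mult)
  then have int: "integrable (lborel \<Otimes>\<^sub>M lborel) (\<lambda>(x,\<xi>). cis (- (x \<bullet> \<xi>)) * f x * g \<xi>)"
    by (rule Bochner_Integration.integrable_bound) (auto simp: norm_mult case_prod_beta)
  have "(LINT \<xi>|lborel. ft f \<xi> * g \<xi>) = (LINT \<xi>|lborel. (LINT x|lborel. cis (- (x \<bullet> \<xi>)) * f x * g \<xi>))"
    by (simp add: ft_def integral_mult_left_zero)
  also have "\<dots> = (LINT x|lborel. (LINT \<xi>|lborel. cis (- (x \<bullet> \<xi>)) * f x * g \<xi>))"
    by (rule lborel_pair.Fubini_integral[OF int])
  also have "\<dots> = (LINT x|lborel. f x * ft g x)"
    unfolding ft_def integral_mult_right_zero[symmetric]
    by (simp add: inner_commute mult_ac)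
  finally show ?thesis .
qed

text \<open>Fourier inversion regularised by a Gaussian; both inequalities of Plancherel rest on it.\<close>

lemma ft_gauss_ft:
  fixes \<phi> :: "'a::euclidean_space \<Rightarrow> complex"
  assumes \<phi>: "integrable lborel \<phi>" and \<delta>: "\<delta> > 0"
  shows "integrable lborel (\<lambda>\<xi>. of_real (gauss \<delta> \<xi>) * ft \<phi> (- \<xi>))"
    and "ft (\<lambda>\<xi>. of_real (gauss \<delta> \<xi>) * ft \<phi> (- \<xi>)) x =
        of_real ((gauss_const TYPE('a))\<^sup>2) * (LINT y|lborel. \<phi> y * of_real (heat \<delta> (y - x)))"
proof -
  have [measurable]: "\<phi> \<in> borel_measurable borel" using \<phi> by auto
  have gi: "integrable lborel (\<lambda>\<xi>. complex_of_real (gauss \<delta> (\<xi>::'a)))" using gauss_integrable[OF \<delta>, where 'a = 'a] by simp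
  have "integrable lborel (\<lambda>\<xi>::'a. gauss \<delta> \<xi> * (LINT x|lborel. norm (\<phi> x)))" using gauss_integrable[OF \<delta>, where 'a = 'a] by simp
  then show "integrable lborel (\<lambda>\<xi>. of_real (gauss \<delta> \<xi>) * ft \<phi> (- \<xi>))"
  proof (rule Bochner_Integration.integrable_bound)
    show "AE x in lborel. norm (of_real (gauss \<delta> x) * ft \<phi> (- x)) \<le> norm (gauss \<delta> x * (LINT x|lborel. norm (\<phi> x)))"
      using ft_bound[OF \<phi>] by (intro AE_I2) (auto simp: norm_mult abs_mult intro!: mult_left_mono)
  qed simp
  let ?g = "\<lambda>\<xi>. cis (- (\<xi> \<bullet> (- x))) * complex_of_real (gauss \<delta> \<xi>)"
  have g: "integrable lborel ?g" by (rule integrable_cis_mult[OF gi])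
  have [measurable]: "?g \<in> borel_measurable borel" using g by auto
  \<comment> \<open>The Gaussian is even, so replacing \<xi> by its negative only flips the sign in
    the character. The integrand then has the form to which the multiplication formula
    applies.\<close>
  have "ft (\<lambda>\<xi>. of_real (gauss \<delta> \<xi>) * ft \<phi> (- \<xi>)) x = (LINT \<xi>|lborel. ft \<phi> (0 - \<xi>) * ?g (0 - \<xi>))"
    unfolding ft_def[of _ x] by (intro Bochner_Integration.integral_cong) (auto simp: gauss_simps)
  also have "\<dots> = (LINT \<xi>|lborel. ft \<phi> \<xi> * ?g \<xi>)"
    by (rule integral_lborel_reflect, rule borel_measurable_times) measurable
  also have "\<dots> = (LINT y|lborel. \<phi> y * ft ?g y)"
    by (rule ft_mult[OF \<phi> g])
  also have "\<dots> = (LINT y|lborel. \<phi> y * of_real ((gauss_const TYPE('a))\<^sup>2 * heat \<delta> (y - x)))"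
  proof -
    have "ft ?g y = (LINT \<xi>|lborel. cis (- (\<xi> \<bullet> (y - x))) * complex_of_real (gauss \<delta> \<xi>))" for y
      unfolding ft_def by (simp add: cis_mult mult.assoc[symmetric] inner_diff_right)
    then show ?thesis unfolding fourier_gauss(2)[OF \<delta>] by simp
  qed
  also have "\<dots> = of_real ((gauss_const TYPE('a))\<^sup>2) * (LINT y|lborel. \<phi> y * of_real (heat \<delta> (y - x)))"
    unfolding integral_mult_right_zero[symmetric] by (simp add: mult_ac)
  finally show "ft (\<lambda>\<xi>. of_real (gauss \<delta> \<xi>) * ft \<phi> (- \<xi>)) x =
        of_real ((gauss_const TYPE('a))\<^sup>2) * (LINT y|lborel. \<phi> y * of_real (heat \<delta> (y - x)))" .
qed

section \<open>Plancherel's inequalities\<close>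

lemma integral_norm_bound_nn:
  fixes f :: "'a \<Rightarrow> 'b::{banach, second_countable_topology}"
  shows "ennreal (norm (LINT x|M. f x)) \<le> (\<integral>\<^sup>+x. ennreal (norm (f x)) \<partial>M)"
  by (cases "integrable M f") (auto simp: integral_norm_bound_ennreal not_integrable_integral_eq)

text \<open>Fatou's lemma: the Gaussian weights tend to 1 pointwise. It removes the regularisation
  from bounds that are uniform in its parameter.\<close>

lemma nn_integral_gauss_limit:
  fixes F :: "'a::euclidean_space \<Rightarrow> real"
  assumes [measurable]: "F \<in> borel_measurable borel" and "\<And>x. F x \<ge> 0"
    and B: "\<And>n. (\<integral>\<^sup>+x. ennreal (gauss (1 / real (Suc n)) x * F x) \<partial>lborel) \<le> B"
  shows "(\<integral>\<^sup>+x. ennreal (F x) \<partial>lborel) \<le> B"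
proof -
  have lim: "(\<lambda>n. ennreal (gauss (1 / real (Suc n)) x * F x)) \<longlonglongrightarrow> ennreal (F x)" for x
  proof -
    have "(\<lambda>n. exp (- (inverse (real (Suc n)) / 2) * (norm x)\<^sup>2) * F x) \<longlonglongrightarrow> exp (- (0 / 2) * (norm x)\<^sup>2) * F x"
      by (intro tendsto_intros LIMSEQ_inverse_real_of_nat) auto
    then show ?thesis
      by (intro tendsto_ennrealI) (simp add: gauss_def inverse_eq_divide del: of_nat_Suc)
  qed
  have "(\<integral>\<^sup>+x. ennreal (F x) \<partial>lborel) = (\<integral>\<^sup>+x. liminf (\<lambda>n. ennreal (gauss (1 / real (Suc n)) x * F x)) \<partial>lborel)"
    by (intro nn_integral_cong lim_imp_Liminf[OF _ lim, symmetric]) simp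
  also have "\<dots> \<le> liminf (\<lambda>n. \<integral>\<^sup>+x. ennreal (gauss (1 / real (Suc n)) x * F x) \<partial>lborel)"
    by (intro nn_integral_liminf) measurable
  also have "\<dots> \<le> liminf (\<lambda>n::nat. B)"
    by (intro Liminf_mono always_eventually allI B)
  also have "\<dots> = B" by (simp add: Liminf_const)
  finally show ?thesis .
qed

text \<open>Schur's test: the product of the two values is at most half the sum of their squares,
  and the kernel has mass 1 in each variable separately.\<close>

lemma heat_schur:
  fixes f :: "'a::euclidean_space \<Rightarrow> complex"
  assumes [measurable]: "f \<in> borel_measurable borel" and \<delta>: "\<delta> > 0"
  shows "(\<integral>\<^sup>+x. \<integral>\<^sup>+y. ennreal (norm (f x) * norm (f y) * heat \<delta> (y - x)) \<partial>lborel \<partial>lborel)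
      \<le> (\<integral>\<^sup>+x. ennreal ((norm (f x))\<^sup>2) \<partial>lborel)"
proof -
  let ?S = "\<integral>\<^sup>+x. ennreal ((norm (f x))\<^sup>2) \<partial>lborel"
  let ?h = "\<lambda>x y. ennreal (heat \<delta> (y - x :: 'a))"
  let ?q = "\<lambda>x. ennreal ((norm (f x))\<^sup>2 / 2)"
  have pos: "heat \<delta> z \<ge> 0" for z :: 'a using heat_simps(1)[OF \<delta>, of z] by simp
  have gen: "ennreal (a * h + b * h) = ennreal a * ennreal h + ennreal b * ennreal h"
    if "a \<ge> 0" "b \<ge> 0" "h \<ge> 0" for a b h :: real
    using that by (simp add: ennreal_plus ennreal_mult)
  have pt: "ennreal (norm (f x) * norm (f y) * heat \<delta> (y - x)) \<le> ?q x * ?h x y + ?q y * ?h x y" for x y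
  proof -
    have "norm (f x) * norm (f y) \<le> (norm (f x))\<^sup>2 / 2 + (norm (f y))\<^sup>2 / 2"
      using sum_squares_bound[of "norm (f x)" "norm (f y)"] by simp
    then have "norm (f x) * norm (f y) * heat \<delta> (y - x) \<le> ((norm (f x))\<^sup>2 / 2 + (norm (f y))\<^sup>2 / 2) * heat \<delta> (y - x)"
      using pos by (rule mult_right_mono)
    then have "ennreal (norm (f x) * norm (f y) * heat \<delta> (y - x))
       \<le> ennreal ((norm (f x))\<^sup>2 / 2 * heat \<delta> (y - x) + (norm (f y))\<^sup>2 / 2 * heat \<delta> (y - x))"
      by (intro ennreal_leI) (simp add: algebra_simps)
    also have "\<dots> = ?q x * ?h x y + ?q y * ?h x y"
      by (rule gen) (auto simp: pos)
    finally show ?thesis .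
  qed
  have "(\<integral>\<^sup>+x. \<integral>\<^sup>+y. ennreal (norm (f x) * norm (f y) * heat \<delta> (y - x)) \<partial>lborel \<partial>lborel)
     \<le> (\<integral>\<^sup>+x. \<integral>\<^sup>+y. ?q x * ?h x y + ?q y * ?h x y \<partial>lborel \<partial>lborel)"
    by (intro nn_integral_mono pt)
  also have "\<dots> = (\<integral>\<^sup>+x. \<integral>\<^sup>+y. ?q x * ?h x y \<partial>lborel \<partial>lborel) + (\<integral>\<^sup>+x. \<integral>\<^sup>+y. ?q y * ?h x y \<partial>lborel \<partial>lborel)"
    by (simp add: nn_integral_add)
  also have "(\<integral>\<^sup>+x. \<integral>\<^sup>+y. ?q x * ?h x y \<partial>lborel \<partial>lborel) = (\<integral>\<^sup>+x. ?q x \<partial>lborel)"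
    by (simp add: nn_integral_cmult heat_shift_integral[OF \<delta>])
  also have "(\<integral>\<^sup>+x. \<integral>\<^sup>+y. ?q y * ?h x y \<partial>lborel \<partial>lborel) = (\<integral>\<^sup>+y. \<integral>\<^sup>+x. ?q y * ?h x y \<partial>lborel \<partial>lborel)"
    by (rule lborel_pair.Fubini') simp
  also have "\<dots> = (\<integral>\<^sup>+x. ?q x \<partial>lborel)"
    by (simp add: nn_integral_cmult heat_shift_integral[OF \<delta>])
  also have "(\<integral>\<^sup>+x. ?q x \<partial>lborel) + (\<integral>\<^sup>+x. ?q x \<partial>lborel) = ?S"
    by (subst nn_integral_add[symmetric]) (auto simp: ennreal_plus[symmetric] simp del: ennreal_plus)
  finally show ?thesis .
qed

text \<open>By the multiplication formula, the Gaussian-weighted squared norm of \<open>ft f\<close>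
  is a quadratic form in \<open>f\<close> with the heat kernel, which Schur's test bounds
  independently of the weight.\<close>

lemma plancherel_le:
  fixes f :: "'a::euclidean_space \<Rightarrow> complex"
  assumes f: "integrable lborel f"
  shows "(\<integral>\<^sup>+\<xi>. ennreal ((norm (ft f \<xi>))\<^sup>2) \<partial>lborel)
      \<le> ennreal ((gauss_const TYPE('a))\<^sup>2) * (\<integral>\<^sup>+x. ennreal ((norm (f x))\<^sup>2) \<partial>lborel)"
proof (rule nn_integral_gauss_limit)
  have [measurable]: "f \<in> borel_measurable borel" using f by auto
  show "(\<lambda>\<xi>. (norm (ft f \<xi>))\<^sup>2) \<in> borel_measurable borel" by simp
  fix n
  define \<delta> where "\<delta> = 1 / real (Suc n)"
  have \<delta>: "\<delta> > 0" by (simp add: \<delta>_def)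
  let ?c = "(gauss_const TYPE('a))\<^sup>2" and ?F = "\<lambda>x. cnj (f x)"
  have F: "integrable lborel ?F" using f by simp
  let ?g = "\<lambda>\<xi>. complex_of_real (gauss \<delta> \<xi>) * ft ?F (- \<xi>)"
  \<comment> \<open>Conjugation is chosen so that \<open>ft f \<xi> * ft ?F (- \<xi>)\<close>
    becomes the squared modulus of \<open>ft f \<xi>\<close>.\<close>
  have ftF: "ft ?F (- \<xi>) = cnj (ft f \<xi>)" for \<xi>
    unfolding ft_def Bochner_Integration.integral_cnj[symmetric] by (simp add: cis_cnj)
  have "integrable lborel (\<lambda>\<xi>::'a. gauss \<delta> \<xi> * (LINT x|lborel. norm (f x))\<^sup>2)"
    using gauss_integrable[OF \<delta>, where 'a = 'a] by simp
  then have int: "integrable lborel (\<lambda>\<xi>. gauss \<delta> \<xi> * (norm (ft f \<xi>))\<^sup>2)"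
    by (rule Bochner_Integration.integrable_bound)
      (auto simp: abs_mult ft_bound[OF f] intro!: AE_I2 mult_left_mono power_mono)
  have "complex_of_real (LINT \<xi>|lborel. gauss \<delta> \<xi> * (norm (ft f \<xi>))\<^sup>2) = (LINT \<xi>|lborel. ft f \<xi> * ?g \<xi>)"
    unfolding ftF integral_complex_of_real[symmetric]
    by (intro Bochner_Integration.integral_cong) (auto simp: complex_norm_square[symmetric] mult_ac)
  also have "\<dots> = (LINT x|lborel. f x * ft ?g x)"
    by (rule ft_mult[OF f ft_gauss_ft(1)[OF F \<delta>]])
  also have "\<dots> = (LINT x|lborel. of_real ?c * (f x * (LINT y|lborel. cnj (f y) * of_real (heat \<delta> (y - x)))))"
    unfolding ft_gauss_ft(2)[OF F \<delta>] by (simp add: mult_ac)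
  finally have eq: "complex_of_real (LINT \<xi>|lborel. gauss \<delta> \<xi> * (norm (ft f \<xi>))\<^sup>2) = \<dots>" .
  have "(\<integral>\<^sup>+\<xi>. ennreal (gauss \<delta> \<xi> * (norm (ft f \<xi>))\<^sup>2) \<partial>lborel) = ennreal (LINT \<xi>|lborel. gauss \<delta> \<xi> * (norm (ft f \<xi>))\<^sup>2)"
    by (intro nn_integral_eq_integral int) (auto simp: less_imp_le[OF gauss_simps(1)])
  also have "\<dots> \<le> ennreal (norm (complex_of_real (LINT \<xi>|lborel. gauss \<delta> \<xi> * (norm (ft f \<xi>))\<^sup>2)))"
    by (intro ennreal_leI) simp
  also have "\<dots> \<le> (\<integral>\<^sup>+x. ennreal (norm (of_real ?c * (f x * (LINT y|lborel. cnj (f y) * of_real (heat \<delta> (y - x)))))) \<partial>lborel)"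
    unfolding eq by (rule integral_norm_bound_nn)
  also have "\<dots> \<le> (\<integral>\<^sup>+x. \<integral>\<^sup>+y. ennreal ?c * ennreal (norm (f x) * norm (f y) * heat \<delta> (y - x)) \<partial>lborel \<partial>lborel)"
  proof (rule nn_integral_mono)
    fix x
    have "ennreal (norm (of_real ?c * (f x * (LINT y|lborel. cnj (f y) * of_real (heat \<delta> (y - x))))))
      = ennreal (?c * norm (f x)) * ennreal (norm (LINT y|lborel. cnj (f y) * of_real (heat \<delta> (y - x))))"
      by (simp add: norm_mult ennreal_mult mult.assoc norm_power)
    also have "\<dots> \<le> ennreal (?c * norm (f x)) * (\<integral>\<^sup>+y. ennreal (norm (cnj (f y) * of_real (heat \<delta> (y - x)))) \<partial>lborel)"
      by (intro mult_left_mono integral_norm_bound_nn) auto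
    also have "\<dots> = (\<integral>\<^sup>+y. ennreal ?c * ennreal (norm (f x) * norm (f y) * heat \<delta> (y - x)) \<partial>lborel)"
      by (subst nn_integral_cmult[symmetric])
        (auto intro!: nn_integral_cong simp: norm_mult ennreal_mult[symmetric] mult_ac
           abs_of_pos[OF heat_simps(1)[OF \<delta>]] less_imp_le[OF heat_simps(1)[OF \<delta>]])
    finally show "ennreal (norm (of_real ?c * (f x * (LINT y|lborel. cnj (f y) * of_real (heat \<delta> (y - x)))))) \<le> \<dots>" .
  qed
  also have "\<dots> = ennreal ?c * (\<integral>\<^sup>+x. \<integral>\<^sup>+y. ennreal (norm (f x) * norm (f y) * heat \<delta> (y - x)) \<partial>lborel \<partial>lborel)"
    by (simp add: nn_integral_cmult)
  also have "\<dots> \<le> ennreal ?c * (\<integral>\<^sup>+x. ennreal ((norm (f x))\<^sup>2) \<partial>lborel)"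
    by (intro mult_left_mono heat_schur \<delta>) auto
  finally show "(\<integral>\<^sup>+\<xi>. ennreal (gauss (1 / real (Suc n)) \<xi> * (norm (ft f \<xi>))\<^sup>2) \<partial>lborel)
      \<le> ennreal ?c * (\<integral>\<^sup>+x. ennreal ((norm (f x))\<^sup>2) \<partial>lborel)" unfolding \<delta>_def .
qed auto


text \<open>Measurability yields continuous functions converging almost everywhere; they are then
  forced to obey the size and support bounds without disturbing the limit.\<close>

lemma continuous_approximation:
  fixes F :: "'a::euclidean_space \<Rightarrow> complex"
  assumes [measurable]: "F \<in> borel_measurable borel" and F: "\<And>x. norm (F x) \<le> B" "\<And>x. norm x > R \<Longrightarrow> F x = 0"
    and B: "B > 0"
  obtains \<phi> :: "nat \<Rightarrow> 'a \<Rightarrow> complex"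
  where "\<And>n. continuous_on UNIV (\<phi> n)" "\<And>n x. norm (\<phi> n x) \<le> B" "\<And>n x. norm x > R + 1 \<Longrightarrow> \<phi> n x = 0"
    "AE x in lborel. (\<lambda>n. \<phi> n x) \<longlonglongrightarrow> F x"
proof -
  have "F measurable_on UNIV"
    by (intro lebesgue_measurable_imp_measurable_on measurable_completion) auto
  then obtain N g where N: "negligible N" and g: "\<And>n. continuous_on UNIV (g n)"
    and lim: "\<And>x. x \<notin> N \<Longrightarrow> (\<lambda>n. g n x) \<longlonglongrightarrow> F x"
    unfolding measurable_on_def by auto
  \<comment> \<open>Radial projection onto the ball of radius \<open>B\<close>; it is continuous and
    fixes the values of \<open>F\<close>.\<close>
  define cl :: "complex \<Rightarrow> complex" where "cl z = z /\<^sub>R max 1 (norm z / B)" for z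
  define cut :: "'a \<Rightarrow> real" where "cut x = max 0 (min 1 (R + 1 - norm x))" for x
  have cl_cont: "continuous_on UNIV cl"
    unfolding cl_def using B by (intro continuous_intros) auto
  have cl_bound: "norm (cl z) \<le> B" for z
  proof -
    have "norm z \<le> B * max 1 (norm z / B)" using B by (simp add: max_def field_simps)
    then show ?thesis unfolding cl_def by (simp add: divide_inverse_commute[symmetric] divide_le_eq)
  qed
  have cl_id: "cl z = z" if "norm z \<le> B" for z
    using that B unfolding cl_def by (simp add: max_def)
  show thesis
  proof (rule that[of "\<lambda>n x. cut x *\<^sub>R cl (g n x)"])
    show "continuous_on UNIV (\<lambda>x. cut x *\<^sub>R cl (g n x))" for n
      unfolding cut_def
      by (intro continuous_intros continuous_on_compose2[OF cl_cont g]) auto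
    show "norm (cut x *\<^sub>R cl (g n x)) \<le> B" for n x
    proof -
      have "norm (cut x *\<^sub>R cl (g n x)) \<le> 1 * B"
        unfolding norm_scaleR by (intro mult_mono cl_bound) (auto simp: cut_def)
      then show ?thesis by simp
    qed
    show "cut x *\<^sub>R cl (g n x) = 0" if "norm x > R + 1" for n x
      using that by (simp add: cut_def)
    have "(\<lambda>n. cut x *\<^sub>R cl (g n x)) \<longlonglongrightarrow> F x" if "x \<notin> N" for x
    proof -
      have "isCont cl (F x)" using cl_cont by (simp add: continuous_on_eq_continuous_at)
      then have "(\<lambda>n. cut x *\<^sub>R cl (g n x)) \<longlonglongrightarrow> cut x *\<^sub>R cl (F x)"
        by (intro tendsto_intros isCont_tendsto_compose[OF _ lim[OF that]])
      also have "cut x *\<^sub>R cl (F x) = F x"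
        using F[of x] by (cases "norm x > R") (auto simp: cl_id cut_def)
      finally show ?thesis .
    qed
    moreover have "AE x in lebesgue. x \<notin> N"
      using N by (intro AE_not_in) (simp add: negligible_iff_null_sets)
    ultimately have "AE x in lebesgue. (\<lambda>n. cut x *\<^sub>R cl (g n x)) \<longlonglongrightarrow> F x"
      by (auto elim!: eventually_mono)
    then show "AE x in lborel. (\<lambda>n. cut x *\<^sub>R cl (g n x)) \<longlonglongrightarrow> F x"
      by (simp add: AE_completion_iff)
  qed
qed

text \<open>Testing with truncated conjugates of \<open>f\<close> gives I \<le> A * sqrt I for the
  squared norm I of the truncation; since I is finite, division yields I \<le> A^2. Fatou's lemma
  removes the truncation. Square integrability of \<open>f\<close> is thus part of the
  conclusion.\<close>

lemma L2_duality:
  fixes f :: "'a::euclidean_space \<Rightarrow> complex"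
  assumes f: "integrable lborel f" and A: "A \<ge> 0"
    and dual: "\<And>\<phi> R. continuous_on UNIV \<phi> \<Longrightarrow> (\<And>x. norm x > R \<Longrightarrow> \<phi> x = 0) \<Longrightarrow>
      norm (LINT x|lborel. f x * \<phi> x) \<le> A * sqrt (LINT x|lborel. (norm (\<phi> x))\<^sup>2)"
  shows "(\<integral>\<^sup>+x. ennreal ((norm (f x))\<^sup>2) \<partial>lborel) \<le> ennreal (A\<^sup>2)"
proof -
  have [measurable]: "f \<in> borel_measurable borel" using f by auto
  \<comment> \<open>Truncation in space and in height keeps the squared norm finite. These functions
    are not continuous, so \<open>dual\<close> reaches them only through approximation.\<close>
  define F where "F N x = (if norm x \<le> real N \<and> norm (f x) \<le> real N then cnj (f x) else 0)" for N :: nat and x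
  have [measurable]: "(\<lambda>x. cnj (f x)) \<in> borel_measurable borel"
    by (rule borel_measurable_continuous_on[where f = cnj]) (auto intro: continuous_intros)
  have [measurable]: "F N \<in> borel_measurable borel" for N
    unfolding F_def[abs_def] by measurable
  have ind: "integrable lborel (\<lambda>x::'a. C * indicator (cball 0 R) x :: real)" for C R
    by (intro integrable_mult_right integrable_real_indicator)
      (use emeasure_lborel_cball_finite[of "0::'a" R] in auto)
  have trunc: "(\<integral>\<^sup>+x. ennreal ((norm (F N x))\<^sup>2) \<partial>lborel) \<le> ennreal (A\<^sup>2)" for N
  proof -
    define B where "B = real N + 1"
    have B: "B > 0" by (simp add: B_def)
    have FB: "norm (F N x) \<le> B" for x by (simp add: F_def B_def)
    have FR: "norm x > real N \<Longrightarrow> F N x = 0" for x by (simp add: F_def)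
    obtain \<phi> :: "nat \<Rightarrow> 'a \<Rightarrow> complex" where \<phi>: "\<And>n. continuous_on UNIV (\<phi> n)" "\<And>n x. norm (\<phi> n x) \<le> B"
      "\<And>n x. norm x > real N + 1 \<Longrightarrow> \<phi> n x = 0" and lim: "AE x in lborel. (\<lambda>n. \<phi> n x) \<longlonglongrightarrow> F N x"
      using continuous_approximation[of "F N", OF _ FB FR B] by auto
    have [measurable]: "\<phi> n \<in> borel_measurable borel" for n
      using \<phi>(1) by (rule borel_measurable_continuous_onI)
    define I where "I = (LINT x|lborel. (norm (F N x))\<^sup>2)"
    have F2: "f x * F N x = of_real ((norm (F N x))\<^sup>2)" for x
      by (simp add: F_def complex_norm_square[symmetric])
    have "(\<lambda>n. LINT x|lborel. f x * \<phi> n x) \<longlonglongrightarrow> (LINT x|lborel. f x * F N x)"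
    proof (rule integral_dominated_convergence[where w = "\<lambda>x. B * norm (f x)"])
      show "integrable lborel (\<lambda>x. B * norm (f x))" using f by simp
      show "AE x in lborel. (\<lambda>n. f x * \<phi> n x) \<longlonglongrightarrow> f x * F N x"
        using lim by eventually_elim (intro tendsto_intros)
      show "AE x in lborel. norm (f x * \<phi> n x) \<le> B * norm (f x)" for n
        using \<phi>(2) by (intro AE_I2) (simp add: norm_mult mult.commute[of B] mult_left_mono)
    qed auto
    then have 1: "(\<lambda>n. norm (LINT x|lborel. f x * \<phi> n x)) \<longlonglongrightarrow> norm (complex_of_real I)"
      unfolding F2 I_def integral_complex_of_real by (rule tendsto_norm)
    have "(\<lambda>n. LINT x|lborel. (norm (\<phi> n x))\<^sup>2) \<longlonglongrightarrow> I"
      unfolding I_def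
    proof (rule integral_dominated_convergence[where w = "\<lambda>x. B\<^sup>2 * indicator (cball 0 (real N + 1)) x"])
      show "integrable lborel (\<lambda>x::'a. B\<^sup>2 * indicator (cball 0 (real N + 1)) x :: real)" by (rule ind)
      show "AE x in lborel. (\<lambda>n. (norm (\<phi> n x))\<^sup>2) \<longlonglongrightarrow> (norm (F N x))\<^sup>2"
        using lim by eventually_elim (intro tendsto_intros)
      show "AE x in lborel. norm ((norm (\<phi> n x))\<^sup>2) \<le> B\<^sup>2 * indicator (cball 0 (real N + 1)) x" for n
      proof (intro AE_I2)
        fix x
        show "norm ((norm (\<phi> n x))\<^sup>2) \<le> B\<^sup>2 * indicator (cball 0 (real N + 1)) x"
          using \<phi>(2)[of n x] \<phi>(3)[of x n] by (cases "norm x > real N + 1") (auto intro: power_mono)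
      qed
    qed auto
    then have 2: "(\<lambda>n. A * sqrt (LINT x|lborel. (norm (\<phi> n x))\<^sup>2)) \<longlonglongrightarrow> A * sqrt I"
      by (intro tendsto_intros)
    have "norm (complex_of_real I) \<le> A * sqrt I"
      by (rule LIMSEQ_le[OF 1 2]) (use dual \<phi> in blast)
    moreover have I0: "I \<ge> 0" unfolding I_def by simp
    ultimately have "sqrt I * sqrt I \<le> A * sqrt I" by simp
    then have "sqrt I \<le> A"
      using I0 A mult_right_le_imp_le[of "sqrt I" "sqrt I" A] by (cases "I = 0") (simp_all del: real_sqrt_mult_self)
    then have "I \<le> A\<^sup>2" by (rule sqrt_le_D)
    moreover have "(\<integral>\<^sup>+x. ennreal ((norm (F N x))\<^sup>2) \<partial>lborel) = ennreal I"
      unfolding I_def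
    proof (rule nn_integral_eq_integral)
      have "integrable lborel (\<lambda>x::'a. B\<^sup>2 * indicator (cball 0 (real N)) x :: real)" by (rule ind)
      then show "integrable lborel (\<lambda>x. (norm (F N x))\<^sup>2)"
      proof (rule Bochner_Integration.integrable_bound)
        show "AE x in lborel. norm ((norm (F N x))\<^sup>2) \<le> norm (B\<^sup>2 * indicator (cball 0 (real N)) x :: real)"
        proof (intro AE_I2)
          fix x show "norm ((norm (F N x))\<^sup>2) \<le> norm (B\<^sup>2 * indicator (cball 0 (real N)) x :: real)"
            using FB[of x] FR[of x] by (cases "norm x > real N") (auto intro: power_mono)
        qed
      qed simp
    qed simp
    ultimately show ?thesis by (simp add: ennreal_leI)
  qed
  have lim: "(\<lambda>N. ennreal ((norm (F N x))\<^sup>2)) \<longlonglongrightarrow> ennreal ((norm (f x))\<^sup>2)" for x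
  proof (rule tendsto_eventually)
    have "eventually (\<lambda>N. max (norm x) (norm (f x)) \<le> real N) sequentially"
      using eventually_ge_at_top[of "nat \<lceil>max (norm x) (norm (f x))\<rceil>"]
      by eventually_elim linarith
    then show "eventually (\<lambda>N. ennreal ((norm (F N x))\<^sup>2) = ennreal ((norm (f x))\<^sup>2)) sequentially"
      by eventually_elim (simp add: F_def)
  qed
  have "(\<integral>\<^sup>+x. ennreal ((norm (f x))\<^sup>2) \<partial>lborel) = (\<integral>\<^sup>+x. liminf (\<lambda>N. ennreal ((norm (F N x))\<^sup>2)) \<partial>lborel)"
    by (intro nn_integral_cong lim_imp_Liminf[OF _ lim, symmetric]) simp
  also have "\<dots> \<le> liminf (\<lambda>N. \<integral>\<^sup>+x. ennreal ((norm (F N x))\<^sup>2) \<partial>lborel)"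
    by (intro nn_integral_liminf) measurable
  also have "\<dots> \<le> liminf (\<lambda>N::nat. ennreal (A\<^sup>2))"
    by (intro Liminf_mono always_eventually allI trunc)
  also have "\<dots> = ennreal (A\<^sup>2)" by (simp add: Liminf_const)
  finally show ?thesis .
qed

text \<open>Substituting y = x + sqrt \<delta> * z moves the parameter from the kernel into the
  argument of the function, so the fixed density \<open>heat 1\<close> serves as dominating
  weight.\<close>

lemma heat_approximation:
  fixes \<phi> :: "'a::euclidean_space \<Rightarrow> complex"
  assumes c: "continuous_on UNIV \<phi>" and B: "\<And>x. norm (\<phi> x) \<le> B"
  shows "(\<lambda>n. LINT y|lborel. \<phi> y * of_real (heat (1 / real (Suc n)) (y - x))) \<longlonglongrightarrow> \<phi> x"
proof -
  have [measurable]: "\<phi> \<in> borel_measurable borel" using c by (rule borel_measurable_continuous_onI)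
  let ?s = "\<lambda>n. sqrt (1 / real (Suc n))"
  have eq: "(LINT y|lborel. \<phi> y * of_real (heat (1 / real (Suc n)) (y - x)))
    = (LINT z|lborel. \<phi> (x + ?s n *\<^sub>R z) * of_real (heat 1 z))" for n
  proof -
    have pos: "?s n > 0" by simp
    have h: "heat (1 / real (Suc n)) (?s n *\<^sub>R z) * ?s n ^ DIM('a) = heat 1 z" for z :: 'a
      using pos by (simp add: heat_def power_mult_distrib power_divide field_simps del: of_nat_Suc)
    have "(LINT y|lborel. \<phi> y * of_real (heat (1 / real (Suc n)) (y - x)))
      = ?s n ^ DIM('a) *\<^sub>R (LINT z|lborel. \<phi> (x + ?s n *\<^sub>R z) * of_real (heat (1 / real (Suc n)) (?s n *\<^sub>R z)))"
      using integral_lborel_affine[of "\<lambda>y. \<phi> y * of_real (heat (1 / real (Suc n)) (y - x))" "?s n" x] pos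
      by (simp del: of_nat_Suc)
    also have "\<dots> = (LINT z|lborel. \<phi> (x + ?s n *\<^sub>R z) * of_real (heat (1 / real (Suc n)) (?s n *\<^sub>R z) * ?s n ^ DIM('a)))"
      unfolding integral_scaleR_right[symmetric] by (simp add: scaleR_conv_of_real mult_ac del: of_nat_Suc)
    finally show ?thesis unfolding h .
  qed
  have "(\<lambda>n. LINT z|lborel. \<phi> (x + ?s n *\<^sub>R z) * of_real (heat 1 z)) \<longlonglongrightarrow> (LINT z|lborel. \<phi> x * of_real (heat 1 (z::'a)))"
  proof (rule integral_dominated_convergence[where w = "\<lambda>z. B * heat 1 z"])
    show "integrable lborel (\<lambda>z::'a. B * heat 1 z)" using heat_integral(1)[of 1, where 'a = 'a] by simp
    show "AE z in lborel. (\<lambda>n. \<phi> (x + ?s n *\<^sub>R z) * of_real (heat 1 z)) \<longlonglongrightarrow> \<phi> x * of_real (heat 1 z)"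
    proof (intro AE_I2)
      fix z
      have "(\<lambda>n. sqrt (inverse (real (Suc n)))) \<longlonglongrightarrow> sqrt 0"
        by (intro tendsto_intros LIMSEQ_inverse_real_of_nat)
      then have "(\<lambda>n. x + ?s n *\<^sub>R z) \<longlonglongrightarrow> x + 0 *\<^sub>R z"
        by (intro tendsto_intros) (simp add: inverse_eq_divide del: of_nat_Suc)
      then have l: "(\<lambda>n. x + ?s n *\<^sub>R z) \<longlonglongrightarrow> x" by simp
      have "isCont \<phi> x" using c by (simp add: continuous_on_eq_continuous_at)
      from isCont_tendsto_compose[OF this l]
      show "(\<lambda>n. \<phi> (x + ?s n *\<^sub>R z) * of_real (heat 1 z)) \<longlonglongrightarrow> \<phi> x * of_real (heat 1 z)"
        by (intro tendsto_intros)
    qed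
    show "AE z in lborel. norm (\<phi> (x + ?s n *\<^sub>R z) * of_real (heat 1 z)) \<le> B * heat 1 z" for n
      using B heat_simps(1)[of 1, where 'a = 'a] by (intro AE_I2) (simp add: norm_mult abs_of_pos mult_right_mono less_imp_le)
  qed auto
  then show ?thesis unfolding eq using heat_integral(2)[of 1, where 'a = 'a]
    by (simp del: of_nat_Suc)
qed

text \<open>By duality it suffices to pair \<open>f\<close> with a continuous function of compact
  support. Replacing that function by its heat averages moves the pairing to the Fourier side, where
  Cauchy-Schwarz and \<open>plancherel_le\<close> for the test function apply; the averages then
  converge back. If the right-hand side is infinite there is nothing to show.\<close>

lemma plancherel_ge:
  fixes f :: "'a::euclidean_space \<Rightarrow> complex"
  assumes f: "integrable lborel f"
  shows "ennreal ((gauss_const TYPE('a))\<^sup>2) * (\<integral>\<^sup>+x. ennreal ((norm (f x))\<^sup>2) \<partial>lborel)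
    \<le> (\<integral>\<^sup>+\<xi>. ennreal ((norm (ft f \<xi>))\<^sup>2) \<partial>lborel)"
proof (cases "(\<integral>\<^sup>+\<xi>. ennreal ((norm (ft f \<xi>))\<^sup>2) \<partial>lborel)")
  case (real S)
  let ?c = "gauss_const TYPE('a)"
  have c: "?c > 0" by simp
  have [measurable]: "f \<in> borel_measurable borel" using f by auto
  \<comment> \<open>The constant arises from sqrt (S * (?c^2 * P)) divided by ?c^2, where
    \<open>P\<close> is the squared norm of the test function.\<close>
  have "(\<integral>\<^sup>+x. ennreal ((norm (f x))\<^sup>2) \<partial>lborel) \<le> ennreal ((sqrt S / ?c)\<^sup>2)"
  proof (rule L2_duality[OF f])
    show "0 \<le> sqrt S / ?c" using real by simp
    fix \<phi> :: "'a \<Rightarrow> complex" and R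
    assume \<phi>: "continuous_on UNIV \<phi>" "\<And>x. norm x > R \<Longrightarrow> \<phi> x = 0"
    have [measurable]: "\<phi> \<in> borel_measurable borel" using \<phi>(1) by (rule borel_measurable_continuous_onI)
    have i\<phi>: "integrable lborel \<phi>" by (rule integrable_lborel_continuous_compact[OF \<phi>])
    obtain B where B: "B > 0" "\<And>x. norm (\<phi> x) \<le> B" using continuous_compact_bounded[OF \<phi>] by blast
    define P where "P = (LINT x|lborel. (norm (\<phi> x))\<^sup>2)"
    have P0: "P \<ge> 0" unfolding P_def by simp
    have P: "(\<integral>\<^sup>+x. ennreal ((norm (\<phi> x))\<^sup>2) \<partial>lborel) = ennreal P"
      unfolding P_def
      by (intro nn_integral_eq_integral integrable_lborel_continuous_compact[of _ R] continuous_intros \<phi>)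
       (use \<phi>(2) in auto)
    define \<Phi> where "\<Phi> n x = (LINT y|lborel. \<phi> y * of_real (heat (1 / real (Suc n)) (y - x)))" for n x
    have est: "norm (LINT x|lborel. f x * \<Phi> n x) \<le> sqrt S / ?c * sqrt P" for n
    proof -
      define \<delta> where "\<delta> = 1 / real (Suc n)"
      have \<delta>: "\<delta> > 0" by (simp add: \<delta>_def)
      let ?g = "\<lambda>\<xi>. complex_of_real (gauss \<delta> \<xi>) * ft \<phi> (- \<xi>)"
      have "of_real (?c\<^sup>2) * (LINT x|lborel. f x * \<Phi> n x) = (LINT x|lborel. f x * ft ?g x)"
        unfolding ft_gauss_ft(2)[OF i\<phi> \<delta>] \<Phi>_def \<delta>_def[symmetric] integral_mult_right_zero[symmetric]
        by (simp only: mult.left_commute)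
      also have "\<dots> = (LINT \<xi>|lborel. ft f \<xi> * ?g \<xi>)"
        by (rule ft_mult[OF f ft_gauss_ft(1)[OF i\<phi> \<delta>], symmetric])
      finally have "ennreal (norm (of_real (?c\<^sup>2) * (LINT x|lborel. f x * \<Phi> n x)))
          \<le> (\<integral>\<^sup>+\<xi>. ennreal (norm (ft f \<xi> * ?g \<xi>)) \<partial>lborel)"
        by (simp only: integral_norm_bound_nn)
      also have "\<dots> \<le> (\<integral>\<^sup>+\<xi>. ennreal (norm (ft f \<xi>)) * ennreal (norm (ft \<phi> (- \<xi>))) \<partial>lborel)"
      proof (intro nn_integral_mono)
        fix \<xi>
        have "norm (ft f \<xi> * ?g \<xi>) = norm (ft f \<xi>) * (gauss \<delta> \<xi> * norm (ft \<phi> (- \<xi>)))"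
          by (simp add: norm_mult abs_of_pos[OF gauss_simps(1)])
        also have "\<dots> \<le> norm (ft f \<xi>) * (1 * norm (ft \<phi> (- \<xi>)))"
          by (intro mult_left_mono mult_right_mono gauss_simps(3)[OF \<delta>]) auto
        finally show "ennreal (norm (ft f \<xi> * ?g \<xi>)) \<le> ennreal (norm (ft f \<xi>)) * ennreal (norm (ft \<phi> (- \<xi>)))"
          by (simp add: ennreal_mult[symmetric] ennreal_leI)
      qed
      finally have "(ennreal (norm (of_real (?c\<^sup>2) * (LINT x|lborel. f x * \<Phi> n x))))\<^sup>2
          \<le> (\<integral>\<^sup>+\<xi>. ennreal (norm (ft f \<xi>)) * ennreal (norm (ft \<phi> (- \<xi>))) \<partial>lborel)\<^sup>2"
        by (rule power_mono) simp
      also have "\<dots> \<le> (\<integral>\<^sup>+\<xi>. (ennreal (norm (ft f \<xi>)))\<^sup>2 \<partial>lborel) * (\<integral>\<^sup>+\<xi>. (ennreal (norm (ft \<phi> (- \<xi>))))\<^sup>2 \<partial>lborel)"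
        by (rule Cauchy_Schwarz_nn_integral) auto
      also have "(\<integral>\<^sup>+\<xi>. (ennreal (norm (ft f \<xi>)))\<^sup>2 \<partial>lborel) = ennreal S"
        using real by (simp add: ennreal_power)
      also have "(\<integral>\<^sup>+\<xi>. (ennreal (norm (ft \<phi> (- \<xi>))))\<^sup>2 \<partial>lborel) = (\<integral>\<^sup>+\<xi>. ennreal ((norm (ft \<phi> \<xi>))\<^sup>2) \<partial>lborel)"
        using nn_integral_lborel_reflect[of "\<lambda>\<xi>. ennreal ((norm (ft \<phi> \<xi>))\<^sup>2)" 0] by (simp add: ennreal_power)
      also have "\<dots> \<le> ennreal (?c\<^sup>2) * ennreal P"
        using plancherel_le[OF i\<phi>] unfolding P .
      finally have "(ennreal (norm (of_real (?c\<^sup>2) * (LINT x|lborel. f x * \<Phi> n x))))\<^sup>2 \<le> ennreal S * (ennreal (?c\<^sup>2) * ennreal P)"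
        by (simp add: mult_left_mono)
      then have "ennreal ((?c\<^sup>2 * norm (LINT x|lborel. f x * \<Phi> n x))\<^sup>2) \<le> ennreal (S * (?c\<^sup>2 * P))"
        using real(1) P0 by (simp add: ennreal_power norm_mult norm_power ennreal_mult[symmetric])
      then have "(?c\<^sup>2 * norm (LINT x|lborel. f x * \<Phi> n x))\<^sup>2 \<le> S * (?c\<^sup>2 * P)"
        using real(1) P0 by (subst (asm) ennreal_le_iff) auto
      then have "sqrt ((?c\<^sup>2 * norm (LINT x|lborel. f x * \<Phi> n x))\<^sup>2) \<le> sqrt (S * (?c\<^sup>2 * P))"
        by (rule real_sqrt_le_mono)
      then have "?c\<^sup>2 * norm (LINT x|lborel. f x * \<Phi> n x) \<le> sqrt S * (?c * sqrt P)"
        using c by (simp add: real_sqrt_mult)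
      then show ?thesis using c by (simp add: field_simps power2_eq_square)
    qed
    have "(\<lambda>n. LINT x|lborel. f x * \<Phi> n x) \<longlonglongrightarrow> (LINT x|lborel. f x * \<phi> x)"
    proof (rule integral_dominated_convergence[where w = "\<lambda>x. B * norm (f x)"])
      show "integrable lborel (\<lambda>x. B * norm (f x))" using f by simp
      show "AE x in lborel. (\<lambda>n. f x * \<Phi> n x) \<longlonglongrightarrow> f x * \<phi> x"
        unfolding \<Phi>_def by (intro AE_I2 tendsto_intros heat_approximation[OF \<phi>(1) B(2)])
      show [measurable]: "(\<lambda>x. f x * \<Phi> n x) \<in> borel_measurable lborel" for n
        unfolding \<Phi>_def by measurable
      show "AE x in lborel. norm (f x * \<Phi> n x) \<le> B * norm (f x)" for n
      proof (intro AE_I2)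
        fix x
        define \<delta> where "\<delta> = 1 / real (Suc n)"
        have \<delta>: "\<delta> > 0" by (simp add: \<delta>_def)
        have "ennreal (norm (\<Phi> n x)) \<le> (\<integral>\<^sup>+y. ennreal (norm (\<phi> y * of_real (heat \<delta> (y - x)))) \<partial>lborel)"
          unfolding \<Phi>_def \<delta>_def[symmetric] by (rule integral_norm_bound_nn)
        also have "\<dots> \<le> (\<integral>\<^sup>+y. ennreal B * ennreal (heat \<delta> (y - x)) \<partial>lborel)"
          using B heat_simps(1)[OF \<delta>, where 'a = 'a]
          by (intro nn_integral_mono)
            (simp add: norm_mult ennreal_mult[symmetric] ennreal_leI abs_of_pos less_imp_le mult_right_mono)
        also have "\<dots> = ennreal B" by (simp add: nn_integral_cmult heat_shift_integral[OF \<delta>])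
        finally have "norm (\<Phi> n x) \<le> B" using B(1) by (simp add: ennreal_le_iff)
        then show "norm (f x * \<Phi> n x) \<le> B * norm (f x)"
          by (simp add: norm_mult mult.commute[of B] mult_left_mono)
      qed
    qed auto
    then have "(\<lambda>n. norm (LINT x|lborel. f x * \<Phi> n x)) \<longlonglongrightarrow> norm (LINT x|lborel. f x * \<phi> x)"
      by (rule tendsto_norm)
    then show "norm (LINT x|lborel. f x * \<phi> x) \<le> sqrt S / ?c * sqrt (LINT x|lborel. (norm (\<phi> x))\<^sup>2)"
      unfolding P_def[symmetric] by (rule LIMSEQ_le_const2) (use est in blast)
  qed
  then have "ennreal (?c\<^sup>2) * (\<integral>\<^sup>+x. ennreal ((norm (f x))\<^sup>2) \<partial>lborel) \<le> ennreal (?c\<^sup>2) * ennreal ((sqrt S / ?c)\<^sup>2)"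
    by (rule mult_left_mono) simp
  also have "\<dots> = ennreal S"
    using real(1) c by (simp add: ennreal_mult[symmetric] power_divide)
  finally show ?thesis unfolding real(2) .
qed simp

section \<open>Sobolev regularity and translations\<close>

lemma lebesgue_borel_representative:
  fixes f :: "'a::euclidean_space \<Rightarrow> complex"
  assumes "f \<in> borel_measurable lebesgue"
  obtains f' where "f' \<in> borel_measurable borel" "AE x in lborel. f x = f' x"
proof -
  have "(\<lambda>x. Re (f x)) \<in> borel_measurable lebesgue" "(\<lambda>x. Im (f x)) \<in> borel_measurable lebesgue"
    using assms by simp_all
  from this[THEN completion_ex_borel_measurable_real] obtain r i where
    ri: "r \<in> borel_measurable lborel" "i \<in> borel_measurable lborel"
      "AE x in lborel. Re (f x) = r x" "AE x in lborel. Im (f x) = i x"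
    by blast
  show thesis
  proof (rule that[of "\<lambda>x. Complex (r x) (i x)"])
    have [measurable]: "r \<in> borel_measurable borel" "i \<in> borel_measurable borel" using ri by auto
    show "(\<lambda>x. Complex (r x) (i x)) \<in> borel_measurable borel" unfolding Complex_eq by measurable
    show "AE x in lborel. f x = Complex (r x) (i x)"
      using ri(3,4) by eventually_elim (simp add: complex_eq_iff)
  qed
qed

text \<open>The definitions integrate over \<open>lebesgue\<close>, whereas Fubini and affine
  substitution are run over \<open>lborel\<close> with Borel functions; this carries integrals and
  integrability across.\<close>

lemma integral_lebesgue_AE_eq:
  fixes f :: "'a::euclidean_space \<Rightarrow> 'b::{banach, second_countable_topology}"
  assumes [measurable]: "g \<in> borel_measurable borel" and ae: "AE x in lborel. f x = g x"
    and [measurable]: "f \<in> borel_measurable lebesgue"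
  shows "integral\<^sup>L lebesgue f = integral\<^sup>L lborel g" "integrable lebesgue f \<longleftrightarrow> integrable lborel g"
proof -
  have ae': "AE x in lebesgue. f x = g x" using ae by (rule AE_completion)
  have g: "g \<in> borel_measurable lebesgue" by (intro measurable_completion) simp
  have "integral\<^sup>L lebesgue f = integral\<^sup>L lebesgue g"
    using ae' g by (intro integral_cong_AE) auto
  also have "\<dots> = integral\<^sup>L lborel g" by (rule integral_completion) simp
  finally show "integral\<^sup>L lebesgue f = integral\<^sup>L lborel g" .
  have "integrable lebesgue f \<longleftrightarrow> integrable lebesgue g"
    using ae' g by (intro integrable_cong_AE) auto
  also have "\<dots> \<longleftrightarrow> integrable lborel g" by (rule integrable_completion) simp
  finally show "integrable lebesgue f \<longleftrightarrow> integrable lborel g" .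
qed

text \<open>The modulated Gaussians are the only test functions needed in the Schwartz duality: their Fourier
  transforms are explicit, and pairing with them evaluates the transform of \<open>gauss \<delta> * g\<close> pointwise.\<close>

definition wave :: "real^'n::finite \<Rightarrow> real \<Rightarrow> real^'n \<Rightarrow> complex" where
  "wave a \<delta> \<xi> = cis (- (\<xi> \<bullet> a)) * of_real (gauss \<delta> \<xi>)"

lemma wave_schwartz: "\<delta> > 0 \<Longrightarrow> wave a \<delta> \<in> schwartz"
  using modulated_gaussian_schwartz[of "\<delta> / 2" a]
  unfolding wave_def[abs_def] gauss_def by (simp add: inner_commute)

lemma wave_integrable: "\<delta> > 0 \<Longrightarrow> integrable lborel (wave a \<delta>)"
  unfolding wave_def[abs_def] by (rule fourier_gauss)

lemma wave_measurable [measurable]: "wave a \<delta> \<in> borel_measurable borel"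
  unfolding wave_def[abs_def]
  by (intro borel_measurable_times borel_measurable_continuous_onI[of "\<lambda>\<xi>. cis (- (\<xi> \<bullet> a))"] continuous_intros) measurable

lemma fourier_eq_ft:
  assumes [measurable]: "f \<in> borel_measurable borel"
  shows "fourier f = ft f"
proof
  fix \<xi>
  have "(\<lambda>x. cis (- (x \<bullet> \<xi>)) * f x) \<in> borel_measurable borel"
    by (intro borel_measurable_times borel_measurable_continuous_onI[of "\<lambda>x. cis (- (x \<bullet> \<xi>))"] continuous_intros) measurable
  then show "fourier f \<xi> = ft f \<xi>"
    unfolding fourier_def ft_def by (intro integral_completion) simp
qed

lemma fourier_wave:
  fixes a :: "real^'n::finite"
  assumes "\<delta> > 0"
  shows "fourier (wave a \<delta>) x = of_real ((gauss_const TYPE(real^'n))\<^sup>2 * heat \<delta> (x + a))"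
proof -
  have "fourier (wave a \<delta>) x = (LINT \<xi>|lborel. cis (- (\<xi> \<bullet> (x + a))) * of_real (gauss \<delta> \<xi>))"
    unfolding fourier_eq_ft[OF wave_measurable] ft_def wave_def
    by (simp add: mult.assoc[symmetric] cis_mult inner_add_right)
  then show ?thesis unfolding fourier_gauss(2)[OF assms] .
qed

text \<open>The product with a Gaussian is integrable, hence measurable, and the Gaussian has no
  zeros, so it can be divided out.\<close>

lemma has_fourier_measurable:
  fixes f g :: "real^'n::finite \<Rightarrow> complex"
  assumes "has_fourier f g"
  shows "g \<in> borel_measurable lebesgue"
proof -
  have "integrable lebesgue (\<lambda>\<xi>. g \<xi> * wave 0 1 \<xi>)"
    using assms wave_schwartz[of 1 "0::real^'n"] unfolding has_fourier_def by simp
  then have [measurable]: "(\<lambda>\<xi>. g \<xi> * wave 0 1 \<xi>) \<in> borel_measurable lebesgue" by simp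
  have [measurable]: "wave 0 1 \<in> borel_measurable lebesgue" by (intro measurable_completion) simp
  have "(\<lambda>\<xi>. (g \<xi> * wave 0 1 \<xi>) / wave 0 1 \<xi>) \<in> borel_measurable lebesgue" by measurable
  moreover have "wave 0 1 \<xi> \<noteq> 0" for \<xi> :: "real^'n"
    using gauss_simps(1)[of 1 \<xi>] by (simp add: wave_def)
  ultimately show ?thesis by simp
qed

lemma has_fourier_ft:
  fixes f g :: "real^'n::finite \<Rightarrow> complex"
  assumes fg: "has_fourier f g"
    and g': "g' \<in> borel_measurable borel" "AE \<xi> in lborel. g \<xi> = g' \<xi>"
    and \<delta>: "\<delta> > 0"
  shows "integrable lborel (\<lambda>\<xi>. of_real (gauss \<delta> \<xi>) * g' \<xi>)"
    and "ft (\<lambda>\<xi>. of_real (gauss \<delta> \<xi>) * g' \<xi>) a = (LINT x|lebesgue. f x * of_real ((gauss_const TYPE(real^'n))\<^sup>2 * heat \<delta> (x + a)))"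
proof -
  note [measurable] = g'(1)
  have gm [measurable]: "g \<in> borel_measurable lebesgue" using fg by (rule has_fourier_measurable)
  have [measurable]: "wave a \<delta> \<in> borel_measurable lebesgue" for a by (intro measurable_completion) simp
  have gw: "(\<lambda>\<xi>. g' \<xi> * wave a \<delta> \<xi>) \<in> borel_measurable borel" for a by simp
  have ae: "AE \<xi> in lborel. g \<xi> * wave a \<delta> \<xi> = g' \<xi> * wave a \<delta> \<xi>" for a using g'(2) by eventually_elim simp
  have m: "(\<lambda>\<xi>. g \<xi> * wave a \<delta> \<xi>) \<in> borel_measurable lebesgue" for a by measurable
  note eq = integral_lebesgue_AE_eq[OF gw ae m]
  have "integrable lborel (\<lambda>\<xi>. g' \<xi> * wave 0 \<delta> \<xi>)"
    using fg wave_schwartz[OF \<delta>, of "0::real^'n"] eq(2)[of 0] unfolding has_fourier_def by blast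
  then show "integrable lborel (\<lambda>\<xi>. of_real (gauss \<delta> \<xi>) * g' \<xi>)"
    by (simp add: wave_def mult.commute)
  have "ft (\<lambda>\<xi>. of_real (gauss \<delta> \<xi>) * g' \<xi>) a = (LINT \<xi>|lborel. g' \<xi> * wave a \<delta> \<xi>)"
    unfolding ft_def wave_def by (simp add: mult_ac)
  also have "\<dots> = (LINT \<xi>|lebesgue. g \<xi> * wave a \<delta> \<xi>)" using eq(1)[of a] by simp
  also have "\<dots> = (LINT x|lebesgue. f x * fourier (wave a \<delta>) x)"
    using fg wave_schwartz[OF \<delta>, of a] unfolding has_fourier_def by simp
  finally show "ft (\<lambda>\<xi>. of_real (gauss \<delta> \<xi>) * g' \<xi>) a = (LINT x|lebesgue. f x * of_real ((gauss_const TYPE(real^'n))\<^sup>2 * heat \<delta> (x + a)))"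
    unfolding fourier_wave[OF \<delta>] .
qed

text \<open>Averaging against a probability density does not increase the L2 norm: Cauchy-Schwarz
  with square roots of the density, then Fubini.\<close>

lemma heat_jensen:
  fixes h :: "'a::euclidean_space \<Rightarrow> complex"
  assumes [measurable]: "h \<in> borel_measurable borel" and \<delta>: "\<delta> > 0"
  shows "(\<integral>\<^sup>+a. ennreal ((norm (LINT x|lborel. h x * of_real (heat \<delta> (x + a))))\<^sup>2) \<partial>lborel)
     \<le> (\<integral>\<^sup>+x. ennreal ((norm (h x))\<^sup>2) \<partial>lborel)"
proof -
  have pos: "heat \<delta> z \<ge> 0" for z :: 'a using heat_simps(1)[OF \<delta>, of z] by simp
  have "ennreal ((norm (LINT x|lborel. h x * of_real (heat \<delta> (x + a))))\<^sup>2)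
     \<le> (\<integral>\<^sup>+x. ennreal ((norm (h x))\<^sup>2) * ennreal (heat \<delta> (x + a)) \<partial>lborel)" for a
  proof -
    have "ennreal (norm (LINT x|lborel. h x * of_real (heat \<delta> (x + a))))
       \<le> (\<integral>\<^sup>+x. ennreal (norm (h x * of_real (heat \<delta> (x + a)))) \<partial>lborel)"
      by (rule integral_norm_bound_nn)
    also have "\<dots> = (\<integral>\<^sup>+x. ennreal (norm (h x) * sqrt (heat \<delta> (x + a))) * ennreal (sqrt (heat \<delta> (x + a))) \<partial>lborel)"
      using pos by (intro nn_integral_cong) (simp add: norm_mult ennreal_mult[symmetric] mult.assoc)
    finally have "(ennreal (norm (LINT x|lborel. h x * of_real (heat \<delta> (x + a)))))\<^sup>2 \<le> \<dots>\<^sup>2"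
      by (rule power_mono) simp
    also have "\<dots> \<le> (\<integral>\<^sup>+x. (ennreal (norm (h x) * sqrt (heat \<delta> (x + a))))\<^sup>2 \<partial>lborel) *
        (\<integral>\<^sup>+x. (ennreal (sqrt (heat \<delta> (x + a))))\<^sup>2 \<partial>lborel)"
      by (rule Cauchy_Schwarz_nn_integral) auto
    also have "(\<integral>\<^sup>+x. (ennreal (sqrt (heat \<delta> (x + a))))\<^sup>2 \<partial>lborel) = 1"
      using pos heat_shift_integral(3)[OF \<delta>, of a] by (simp add: ennreal_power)
    also have "(\<integral>\<^sup>+x. (ennreal (norm (h x) * sqrt (heat \<delta> (x + a))))\<^sup>2 \<partial>lborel)
      = (\<integral>\<^sup>+x. ennreal ((norm (h x))\<^sup>2) * ennreal (heat \<delta> (x + a)) \<partial>lborel)"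
      using pos by (intro nn_integral_cong) (simp add: ennreal_power power_mult_distrib ennreal_mult)
    finally show ?thesis by (simp add: ennreal_power)
  qed
  then have "(\<integral>\<^sup>+a. ennreal ((norm (LINT x|lborel. h x * of_real (heat \<delta> (x + a))))\<^sup>2) \<partial>lborel)
     \<le> (\<integral>\<^sup>+a. \<integral>\<^sup>+x. ennreal ((norm (h x))\<^sup>2) * ennreal (heat \<delta> (x + a)) \<partial>lborel \<partial>lborel)"
    by (rule nn_integral_mono)
  also have "\<dots> = (\<integral>\<^sup>+x. \<integral>\<^sup>+a. ennreal ((norm (h x))\<^sup>2) * ennreal (heat \<delta> (x + a)) \<partial>lborel \<partial>lborel)"
    by (rule lborel_pair.Fubini') simp
  also have "\<dots> = (\<integral>\<^sup>+x. ennreal ((norm (h x))\<^sup>2) \<partial>lborel)"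
    using heat_shift_integral(3)[OF \<delta>, where 'a = 'a] by (simp add: nn_integral_cmult add.commute)
  finally show ?thesis .
qed

lemma gauss_square: "(gauss (\<delta> / 2) \<xi>)\<^sup>2 = gauss \<delta> \<xi>"
  unfolding gauss_def by (simp add: exp_double[symmetric])

text \<open>\<open>h\<close> is only square integrable, so its transform is reached through
  \<open>k\<close>: damped by a Gaussian, \<open>k\<close> becomes integrable, and the transform of
  the damped function is a heat average of \<open>h\<close>, controlled by
  \<open>heat_jensen\<close>. \<open>plancherel_ge\<close> returns to \<open>k\<close>.\<close>

lemma has_fourier_L2:
  fixes h k :: "real^'n::finite \<Rightarrow> complex"
  assumes hk: "has_fourier h k" and h: "L2_on UNIV h"
    and k': "k' \<in> borel_measurable borel" "AE \<xi> in lborel. k \<xi> = k' \<xi>"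
  shows "(\<integral>\<^sup>+\<xi>. ennreal ((norm (k' \<xi>))\<^sup>2) \<partial>lborel) < \<infinity>"
proof -
  let ?c = "gauss_const TYPE(real^'n)"
  note [measurable] = k'(1)
  have hm: "h \<in> borel_measurable lebesgue"
    using h unfolding L2_on_def set_borel_measurable_def by simp
  then obtain h' where h'[measurable]: "h' \<in> borel_measurable borel" and hh': "AE x in lborel. h x = h' x"
    using lebesgue_borel_representative by blast
  define H where "H = (\<integral>\<^sup>+x. ennreal ((norm (h' x))\<^sup>2) \<partial>lborel)"
  have "(\<integral>\<^sup>+x. ennreal (norm ((norm (h x))\<^sup>2)) \<partial>lebesgue) < \<infinity>"
    using h unfolding L2_on_def set_integrable_def integrable_iff_bounded by simp
  also have "(\<integral>\<^sup>+x. ennreal (norm ((norm (h x))\<^sup>2)) \<partial>lebesgue) = H"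
    unfolding H_def nn_integral_completion
    by (rule nn_integral_cong_AE) (use hh' in eventually_elim, simp)
  finally have Hfin: "H < \<infinity>" .
  have "(\<integral>\<^sup>+\<xi>. ennreal ((norm (k' \<xi>))\<^sup>2) \<partial>lborel) \<le> ennreal (?c\<^sup>2) * H"
  proof (rule nn_integral_gauss_limit)
    fix n
    \<comment> \<open>The extra half makes the square of \<open>gauss \<delta>\<close> equal to the
      weight that occurs in \<open>nn_integral_gauss_limit\<close>.\<close>
    define \<delta> where "\<delta> = 1 / real (Suc n) / 2"
    have \<delta>: "\<delta> > 0" by (simp add: \<delta>_def)
    let ?p = "\<lambda>\<xi>. of_real (gauss \<delta> \<xi>) * k' \<xi>"
    note p = has_fourier_ft[OF hk k' \<delta>]
    have ftp: "ft ?p a = of_real (?c\<^sup>2) * (LINT x|lborel. h' x * of_real (heat \<delta> (x + a)))" for a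
    proof -
      have "(LINT x|lebesgue. h x * of_real (?c\<^sup>2 * heat \<delta> (x + a))) = (LINT x|lborel. h' x * of_real (?c\<^sup>2 * heat \<delta> (x + a)))"
      proof (rule integral_lebesgue_AE_eq)
        show "AE x in lborel. h x * of_real (?c\<^sup>2 * heat \<delta> (x + a)) = h' x * of_real (?c\<^sup>2 * heat \<delta> (x + a))"
          using hh' by eventually_elim simp
        show "(\<lambda>x. h x * of_real (?c\<^sup>2 * heat \<delta> (x + a))) \<in> borel_measurable lebesgue"
          by (intro borel_measurable_times hm measurable_completion) simp
      qed simp
      also have "\<dots> = of_real (?c\<^sup>2) * (LINT x|lborel. h' x * of_real (heat \<delta> (x + a)))"
        unfolding integral_mult_right_zero[symmetric] by (simp only: of_real_mult mult.left_commute)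
      finally show ?thesis unfolding p(2) .
    qed
    have "ennreal (?c\<^sup>2) * (\<integral>\<^sup>+\<xi>. ennreal (gauss (1 / real (Suc n)) \<xi> * (norm (k' \<xi>))\<^sup>2) \<partial>lborel)
       = ennreal (?c\<^sup>2) * (\<integral>\<^sup>+\<xi>. ennreal ((norm (?p \<xi>))\<^sup>2) \<partial>lborel)"
      by (simp only: norm_mult power_mult_distrib norm_of_real power2_abs gauss_square \<delta>_def)
    also have "\<dots> \<le> (\<integral>\<^sup>+a. ennreal ((norm (ft ?p a))\<^sup>2) \<partial>lborel)"
      by (rule plancherel_ge[OF p(1)])
    also have "\<dots> = (\<integral>\<^sup>+a. ennreal ((?c\<^sup>2)\<^sup>2) * ennreal ((norm (LINT x|lborel. h' x * of_real (heat \<delta> (x + a))))\<^sup>2) \<partial>lborel)"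
      unfolding ftp by (simp add: norm_mult power_mult_distrib norm_power ennreal_mult)
    also have "\<dots> = ennreal ((?c\<^sup>2)\<^sup>2) * (\<integral>\<^sup>+a. ennreal ((norm (LINT x|lborel. h' x * of_real (heat \<delta> (x + a))))\<^sup>2) \<partial>lborel)"
      by (rule nn_integral_cmult) simp
    also have "\<dots> \<le> ennreal ((?c\<^sup>2)\<^sup>2) * H"
      unfolding H_def by (intro mult_left_mono heat_jensen \<delta>) auto
    also have "\<dots> = ennreal (?c\<^sup>2) * (ennreal (?c\<^sup>2) * H)"
      unfolding power2_eq_square[of "?c\<^sup>2"] by (subst ennreal_mult) (auto simp: mult.assoc)
    finally show "(\<integral>\<^sup>+\<xi>. ennreal (gauss (1 / real (Suc n)) \<xi> * (norm (k' \<xi>))\<^sup>2) \<partial>lborel) \<le> ennreal (?c\<^sup>2) * H"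
      by (subst (asm) ennreal_mult_le_mult_iff) auto
  qed auto
  also have "\<dots> < \<infinity>" using Hfin by (simp add: ennreal_mult_less_top)
  finally show ?thesis .
qed

text \<open>The Gaussian-damped difference of the two candidates is integrable with vanishing
  transform, so \<open>plancherel_ge\<close> makes its L2 norm zero; the Gaussian factor can then be
  cancelled.\<close>

lemma has_fourier_unique:
  fixes f g :: "real^'n::finite \<Rightarrow> complex"
  assumes fg: "has_fourier f g" and f': "integrable lborel f'" "AE x in lborel. f x = f' x"
    and fm: "f \<in> borel_measurable lebesgue"
  shows "AE \<xi> in lborel. g \<xi> = ft f' \<xi>"
proof -
  let ?c = "gauss_const TYPE(real^'n)"
  have [measurable]: "f' \<in> borel_measurable borel" using f' by auto
  obtain g' where g'[measurable]: "g' \<in> borel_measurable borel" and gg': "AE x in lborel. g x = g' x"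
    using lebesgue_borel_representative has_fourier_measurable[OF fg] by blast
  note g = has_fourier_ft[OF fg g' gg' zero_less_one]
  let ?q = "\<lambda>\<xi>. of_real (gauss 1 \<xi>) * ft f' \<xi>"
  let ?p = "\<lambda>\<xi>. of_real (gauss 1 \<xi>) * g' \<xi> - ?q \<xi>"
  have "integrable lborel (\<lambda>\<xi>::real^'n. gauss 1 \<xi> * (LINT x|lborel. norm (f' x)))"
    using gauss_integrable[OF zero_less_one, where 'a = "real^'n"] by simp
  then have q: "integrable lborel ?q"
    by (rule Bochner_Integration.integrable_bound)
      (auto simp: norm_mult abs_mult intro!: AE_I2 mult_left_mono ft_bound f')
  have "ft ?p a = 0" for a
  proof -
    have "ft ?q a = (LINT \<xi>|lborel. ft f' \<xi> * wave a 1 \<xi>)"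
      unfolding ft_def[of ?q] wave_def by (simp add: mult_ac)
    also have "\<dots> = (LINT x|lborel. f' x * ft (wave a 1) x)"
      by (rule ft_mult[OF f'(1) wave_integrable]) simp
    also have "\<dots> = (LINT x|lborel. f' x * of_real (?c\<^sup>2 * heat 1 (x + a)))"
      by (simp only: fourier_eq_ft[OF wave_measurable, symmetric] fourier_wave[OF zero_less_one])
    also have "\<dots> = (LINT x|lebesgue. f x * of_real (?c\<^sup>2 * heat 1 (x + a)))"
    proof (rule integral_lebesgue_AE_eq(1)[symmetric])
      show "AE x in lborel. f x * of_real (?c\<^sup>2 * heat 1 (x + a)) = f' x * of_real (?c\<^sup>2 * heat 1 (x + a))"
        using f'(2) by eventually_elim simp
      show "(\<lambda>x. f x * of_real (?c\<^sup>2 * heat 1 (x + a))) \<in> borel_measurable lebesgue"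
        by (intro borel_measurable_times fm measurable_completion) simp
    qed simp
    finally have "ft ?q a = ft (\<lambda>\<xi>. of_real (gauss 1 \<xi>) * g' \<xi>) a" unfolding g(2) .
    moreover have "ft ?p a = ft (\<lambda>\<xi>. of_real (gauss 1 \<xi>) * g' \<xi>) a - ft ?q a"
      unfolding ft_def[of _ a] right_diff_distrib
      by (rule Bochner_Integration.integral_diff) (rule integrable_cis_mult[OF g(1)], rule integrable_cis_mult[OF q])
    ultimately show ?thesis by simp
  qed
  then have "ennreal (?c\<^sup>2) * (\<integral>\<^sup>+\<xi>. ennreal ((norm (?p \<xi>))\<^sup>2) \<partial>lborel) \<le> 0"
    using plancherel_ge[of ?p] g(1) q by simp
  then have "(\<integral>\<^sup>+\<xi>. ennreal ((norm (?p \<xi>))\<^sup>2) \<partial>lborel) = 0" by simp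
  then have "AE \<xi> in lborel. ennreal ((norm (?p \<xi>))\<^sup>2) = 0"
    by (subst (asm) nn_integral_0_iff_AE) auto
  with gg' show ?thesis
  proof eventually_elim
    case (elim \<xi>)
    then have "?p \<xi> = 0" by simp
    then have "of_real (gauss 1 \<xi>) * (g' \<xi> - ft f' \<xi>) = 0" by (simp add: algebra_simps)
    with elim gauss_simps(1)[of 1 \<xi>] show ?case by simp
  qed
qed

text \<open>Uniqueness identifies the transform of \<open>f\<close> with \<open>ft f'\<close>, and
  the L2 bound for \<open>h\<close> becomes a weighted integral of this concrete function.\<close>

lemma sobolev_H_ft:
  fixes f :: "real^'n::finite \<Rightarrow> complex"
  assumes f: "f \<in> sobolev_H \<sigma>" and f': "integrable lborel f'" "AE x in lborel. f x = f' x"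
    and fm: "f \<in> borel_measurable lebesgue"
  shows "(\<integral>\<^sup>+\<xi>. ennreal (((norm \<xi>)\<^sup>2 + 1) powr \<sigma> * (norm (ft f' \<xi>))\<^sup>2) \<partial>lborel) < \<infinity>"
proof -
  have [measurable]: "f' \<in> borel_measurable borel" using f' by auto
  obtain g h where fg: "has_fourier f g" and L: "L2_on UNIV h"
    and hk: "has_fourier h (\<lambda>\<xi>. ((norm \<xi>)\<^sup>2 + 1) powr (\<sigma> / 2) *\<^sub>R g \<xi>)"
    using f unfolding sobolev_H_def by blast
  have "(\<integral>\<^sup>+\<xi>. ennreal ((norm (((norm \<xi>)\<^sup>2 + 1) powr (\<sigma> / 2) *\<^sub>R ft f' \<xi>))\<^sup>2) \<partial>lborel) < \<infinity>"
  proof (rule has_fourier_L2[OF hk L])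
    show "AE \<xi> in lborel. ((norm \<xi>)\<^sup>2 + 1) powr (\<sigma> / 2) *\<^sub>R g \<xi> = ((norm \<xi>)\<^sup>2 + 1) powr (\<sigma> / 2) *\<^sub>R ft f' \<xi>"
      using has_fourier_unique[OF fg f' fm] by eventually_elim simp
  qed simp
  moreover have "(((norm \<xi>)\<^sup>2 + 1) powr (\<sigma> / 2))\<^sup>2 = ((norm \<xi>)\<^sup>2 + 1) powr \<sigma>" for \<xi> :: "real^'n"
    by (simp add: power2_eq_square powr_add[symmetric])
  ultimately show ?thesis by (simp add: power_mult_distrib)
qed


text \<open>Trigonometric functions are not compactly supported. They are reached through dilated
  bumps, whose derivatives carry the factor \<open>t n\<close> and disappear in the limit.\<close>

lemma weak_partial_trig:
  fixes v g :: "real^'n::finite \<Rightarrow> real"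
  assumes v: "integrable lborel v" and g: "integrable lborel g"
    and weak: "\<And>\<phi>. \<phi> \<in> test_functions UNIV \<Longrightarrow>
      (LINT x|lborel. v x * partial_deriv j \<phi> x) = - (LINT x|lborel. g x * \<phi> x)"
  shows "(LINT x|lborel. v x * ((b * \<xi> $ j) * cos (x \<bullet> \<xi>) + (- a * \<xi> $ j) * sin (x \<bullet> \<xi>)))
     = - (LINT x|lborel. g x * (a * cos (x \<bullet> \<xi>) + b * sin (x \<bullet> \<xi>)))"
proof -
  have [measurable]: "v \<in> borel_measurable borel" "g \<in> borel_measurable borel" using v g by auto
  define \<tau> \<tau>' where "\<tau> = (\<lambda>x. a * cos (x \<bullet> \<xi>) + b * sin (x \<bullet> \<xi>))"
    and "\<tau>' = (\<lambda>x. (b * \<xi> $ j) * cos (x \<bullet> \<xi>) + (- a * \<xi> $ j) * sin (x \<bullet> \<xi>))"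
  define b' where "b' = partial_deriv j (bump :: real^'n \<Rightarrow> real)"
  have k: "kernel 1 (bump :: real^'n \<Rightarrow> real)"
    unfolding kernel_def using bump_smooth by (auto intro: bump_simps(4))
  have k': "kernel 1 b'" unfolding b'_def by (rule kernel_partial_deriv[OF k])
  obtain B where B: "B > 0" "\<And>x. norm (b' x) \<le> B" using kernel_bounded[OF k'] by blast
  define t where "t n = inverse (real (Suc n))" for n
  have t0: "t \<longlonglongrightarrow> 0" unfolding t_def by (rule LIMSEQ_inverse_real_of_nat)
  have t1: "0 < t n" "t n \<le> 1" for n unfolding t_def by (auto simp: inverse_eq_divide)
  \<comment> \<open>The factor \<open>exp 1\<close> compensates \<open>bump 0 = exp (- 1)\<close>,
    so that the cutoffs tend to 1.\<close>
  define \<phi> where "\<phi> n x = (exp 1 * bump (t n *\<^sub>R x)) * \<tau> x" for n x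
  have cutoff: "has_partials (\<lambda>x::real^'n. exp 1 * bump (t n *\<^sub>R x)) (\<lambda>i x. exp 1 * (t n * partial_deriv i bump (t n *\<^sub>R x)))" for n
    using has_partials_scaleR[OF has_partials_affine[OF kernel_has_partials[OF k], of 0 "t n"], of "exp 1"] by simp
  have \<phi>': "partial_deriv j (\<phi> n) x = exp 1 * (t n * b' (t n *\<^sub>R x)) * \<tau> x + exp 1 * bump (t n *\<^sub>R x) * \<tau>' x" for n x
    using has_partials_partial_deriv[OF has_partials_mult[OF cutoff[of n] trig_has_partials[of a \<xi> b]], of j]
    unfolding \<phi>_def \<tau>_def \<tau>'_def b'_def by (simp only:)
  have "\<phi> n \<in> test_functions UNIV" for n
  proof -
    have "smooth (\<lambda>x::real^'n. exp 1 * bump (t n *\<^sub>R x))"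
      using smooth_affine[OF bump_smooth, of "exp 1" 0 "t n"] by simp
    from smooth_mult[OF this smooth_trig] have "smooth (\<phi> n)"
      unfolding \<phi>_def[abs_def] \<tau>_def .
    moreover have "{x. \<phi> n x \<noteq> 0} \<subseteq> cball 0 (1 / t n)"
    proof
      fix x assume "x \<in> {x. \<phi> n x \<noteq> 0}"
      then have "norm (t n *\<^sub>R x) < 1" unfolding \<phi>_def using bump_simps(4)[of "t n *\<^sub>R x"] by force
      then show "x \<in> cball 0 (1 / t n)" using t1[of n] by (simp add: field_simps)
    qed
    then have "bounded {x. \<phi> n x \<noteq> 0}" using bounded_cball bounded_subset by blast
    ultimately show ?thesis unfolding test_functions_def by simp
  qed
  then have eq: "(LINT x|lborel. v x * partial_deriv j (\<phi> n) x) = - (LINT x|lborel. g x * \<phi> n x)" for n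
    by (rule weak)
  have [measurable]: "\<tau> \<in> borel_measurable borel" "\<tau>' \<in> borel_measurable borel"
    unfolding \<tau>_def \<tau>'_def by (intro borel_measurable_continuous_onI continuous_intros)+
  have [measurable]: "(bump :: real^'n \<Rightarrow> real) \<in> borel_measurable borel" "b' \<in> borel_measurable borel"
    by (rule kernel_measurable[OF k], rule kernel_measurable[OF k'])
  define T where "T = \<bar>a\<bar> + \<bar>b\<bar> + \<bar>b * \<xi> $ j\<bar> + \<bar>a * \<xi> $ j\<bar>"
  have trig: "\<bar>p * cos y + q * sin y\<bar> \<le> \<bar>p\<bar> + \<bar>q\<bar>" for p q y :: real
  proof -
    have "\<bar>p * cos y + q * sin y\<bar> \<le> \<bar>p * cos y\<bar> + \<bar>q * sin y\<bar>" by (rule abs_triangle_ineq)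
    also have "\<dots> \<le> \<bar>p\<bar> * 1 + \<bar>q\<bar> * 1"
      unfolding abs_mult by (intro add_mono mult_left_mono) auto
    finally show ?thesis by simp
  qed
  have \<tau>: "\<bar>\<tau> x\<bar> \<le> T" for x using trig[of a "x \<bullet> \<xi>" b] unfolding \<tau>_def T_def by simp
  have \<tau>': "\<bar>\<tau>' x\<bar> \<le> T" for x using trig[of "b * \<xi> $ j" "x \<bullet> \<xi>" "- a * \<xi> $ j"] unfolding \<tau>'_def T_def by simp
  have T0: "T \<ge> 0" unfolding T_def by simp
  have bl: "(\<lambda>n. exp 1 * bump (t n *\<^sub>R x)) \<longlonglongrightarrow> 1" for x :: "real^'n"
  proof -
    have "(\<lambda>n. t n *\<^sub>R x) \<longlonglongrightarrow> 0 *\<^sub>R x" by (intro tendsto_intros t0)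
    then have l: "(\<lambda>n. t n *\<^sub>R x) \<longlonglongrightarrow> 0" by simp
    have "isCont (bump :: real^'n \<Rightarrow> real) 0"
      using kernel_continuous[OF k] by (simp add: continuous_on_eq_continuous_at)
    from isCont_tendsto_compose[OF this l]
    have "(\<lambda>n. exp 1 * bump (t n *\<^sub>R x)) \<longlonglongrightarrow> exp 1 * bump (0::real^'n)" by (intro tendsto_intros)
    then show ?thesis by (simp add: bump_simps(3) exp_minus)
  qed
  have "(\<lambda>n. LINT x|lborel. g x * \<phi> n x) \<longlonglongrightarrow> (LINT x|lborel. g x * \<tau> x)"
  proof (rule integral_dominated_convergence[where w = "\<lambda>x. exp 1 * T * norm (g x)"])
    show "integrable lborel (\<lambda>x. exp 1 * T * norm (g x))" using g by simp
    show "AE x in lborel. (\<lambda>n. g x * \<phi> n x) \<longlonglongrightarrow> g x * \<tau> x"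
    proof (intro AE_I2)
      fix x
      have "(\<lambda>n. g x * (exp 1 * bump (t n *\<^sub>R x) * \<tau> x)) \<longlonglongrightarrow> g x * (1 * \<tau> x)"
        by (intro tendsto_intros bl)
      then show "(\<lambda>n. g x * \<phi> n x) \<longlonglongrightarrow> g x * \<tau> x" unfolding \<phi>_def by simp
    qed
    show "AE x in lborel. norm (g x * \<phi> n x) \<le> exp 1 * T * norm (g x)" for n
    proof (intro AE_I2)
      fix x
      have "\<bar>exp 1 * bump (t n *\<^sub>R x) * \<tau> x\<bar> \<le> exp 1 * 1 * T"
        unfolding abs_mult using bump_simps(1,2)[of "t n *\<^sub>R x"] \<tau> by (intro mult_mono) auto
      from mult_left_mono[OF this, of "\<bar>g x\<bar>"]
      show "norm (g x * \<phi> n x) \<le> exp 1 * T * norm (g x)"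
        unfolding \<phi>_def by (simp add: abs_mult mult_ac)
    qed
  qed (auto simp: \<phi>_def[abs_def])
  then have 1: "(\<lambda>n. LINT x|lborel. v x * partial_deriv j (\<phi> n) x) \<longlonglongrightarrow> - (LINT x|lborel. g x * \<tau> x)"
    unfolding eq by (rule tendsto_minus)
  have "(\<lambda>n. LINT x|lborel. v x * partial_deriv j (\<phi> n) x) \<longlonglongrightarrow> (LINT x|lborel. v x * \<tau>' x)"
    unfolding \<phi>'
  proof (rule integral_dominated_convergence[where w = "\<lambda>x. (exp 1 * B * T + exp 1 * T) * norm (v x)"])
    show "integrable lborel (\<lambda>x. (exp 1 * B * T + exp 1 * T) * norm (v x))" using v by simp
    show "AE x in lborel. (\<lambda>n. v x * (exp 1 * (t n * b' (t n *\<^sub>R x)) * \<tau> x + exp 1 * bump (t n *\<^sub>R x) * \<tau>' x)) \<longlonglongrightarrow> v x * \<tau>' x"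
    proof (intro AE_I2)
      fix x
      have "(\<lambda>n. t n * b' (t n *\<^sub>R x)) \<longlonglongrightarrow> 0"
      proof (rule Lim_null_comparison)
        show "eventually (\<lambda>n. norm (t n * b' (t n *\<^sub>R x)) \<le> t n * B) sequentially"
          using t1 B by (intro always_eventually) (simp add: abs_mult abs_of_pos mult_left_mono less_imp_le)
        show "(\<lambda>n. t n * B) \<longlonglongrightarrow> 0" using tendsto_mult_left_zero[OF t0] .
      qed
      then have "(\<lambda>n. v x * (exp 1 * (t n * b' (t n *\<^sub>R x)) * \<tau> x + exp 1 * bump (t n *\<^sub>R x) * \<tau>' x))
          \<longlonglongrightarrow> v x * (exp 1 * 0 * \<tau> x + 1 * \<tau>' x)"
        by (intro tendsto_intros bl)
      then show "(\<lambda>n. v x * (exp 1 * (t n * b' (t n *\<^sub>R x)) * \<tau> x + exp 1 * bump (t n *\<^sub>R x) * \<tau>' x)) \<longlonglongrightarrow> v x * \<tau>' x"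
        by simp
    qed
    show "AE x in lborel. norm (v x * (exp 1 * (t n * b' (t n *\<^sub>R x)) * \<tau> x + exp 1 * bump (t n *\<^sub>R x) * \<tau>' x))
        \<le> (exp 1 * B * T + exp 1 * T) * norm (v x)" for n
    proof (intro AE_I2)
      fix x
      have "\<bar>exp 1 * (t n * b' (t n *\<^sub>R x)) * \<tau> x\<bar> \<le> exp 1 * (1 * B) * T"
        unfolding abs_mult using t1[of n] B \<tau> by (intro mult_mono) auto
      moreover have "\<bar>exp 1 * bump (t n *\<^sub>R x) * \<tau>' x\<bar> \<le> exp 1 * 1 * T"
        unfolding abs_mult using bump_simps(1,2)[of "t n *\<^sub>R x"] \<tau>' by (intro mult_mono) auto
      ultimately have "\<bar>exp 1 * (t n * b' (t n *\<^sub>R x)) * \<tau> x + exp 1 * bump (t n *\<^sub>R x) * \<tau>' x\<bar> \<le> exp 1 * B * T + exp 1 * T"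
        using abs_triangle_ineq[of "exp 1 * (t n * b' (t n *\<^sub>R x)) * \<tau> x" "exp 1 * bump (t n *\<^sub>R x) * \<tau>' x"] by simp
      from mult_left_mono[OF this, of "\<bar>v x\<bar>"]
      show "norm (v x * (exp 1 * (t n * b' (t n *\<^sub>R x)) * \<tau> x + exp 1 * bump (t n *\<^sub>R x) * \<tau>' x))
        \<le> (exp 1 * B * T + exp 1 * T) * norm (v x)"
        by (simp only: real_norm_def abs_mult mult.commute)
    qed
  qed auto
  from LIMSEQ_unique[OF this 1] show ?thesis unfolding \<tau>_def \<tau>'_def .
qed

lemma ft_of_real:
  assumes f: "integrable lborel f"
  shows "ft (\<lambda>x. of_real (f x)) \<xi> = of_real (LINT x|lborel. f x * cos (x \<bullet> \<xi>)) - \<i> * of_real (LINT x|lborel. f x * sin (x \<bullet> \<xi>))"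
proof -
  have i: "integrable lborel (\<lambda>x. cis (- (x \<bullet> \<xi>)) * complex_of_real (f x))"
    using f by (intro integrable_cis_mult) simp
  have "Re (ft (\<lambda>x. of_real (f x)) \<xi>) = (LINT x|lborel. f x * cos (x \<bullet> \<xi>))"
    unfolding ft_def integral_Re[OF i, symmetric] by (simp add: mult.commute)
  moreover have "Im (ft (\<lambda>x. of_real (f x)) \<xi>) = (LINT x|lborel. - (f x * sin (x \<bullet> \<xi>)))"
    unfolding ft_def integral_Im[OF i, symmetric] by (simp add: mult.commute)
  ultimately show ?thesis by (simp add: complex_eq_iff)
qed

text \<open>Cosine and sine are tested separately, and recombining real and imaginary parts gives
  the usual multiplier.\<close>

lemma ft_weak_partial:
  fixes v g :: "real^'n::finite \<Rightarrow> real"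
  assumes v: "integrable lborel v" and g: "integrable lborel g"
    and weak: "\<And>\<phi>. \<phi> \<in> test_functions UNIV \<Longrightarrow>
      (LINT x|lborel. v x * partial_deriv j \<phi> x) = - (LINT x|lborel. g x * \<phi> x)"
  shows "ft (\<lambda>x. of_real (g x)) \<xi> = \<i> * of_real (\<xi> $ j) * ft (\<lambda>x. of_real (v x)) \<xi>"
proof -
  note w = weak_partial_trig[OF v g weak]
  have "(LINT x|lborel. v x * (- (\<xi> $ j) * sin (x \<bullet> \<xi>))) = - (LINT x|lborel. g x * cos (x \<bullet> \<xi>))"
    using w[of 0 \<xi> 1] by simp
  then have 1: "(LINT x|lborel. g x * cos (x \<bullet> \<xi>)) = \<xi> $ j * (LINT x|lborel. v x * sin (x \<bullet> \<xi>))"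
    unfolding integral_mult_right_zero[symmetric] by (simp add: mult_ac)
  have "(LINT x|lborel. v x * ((\<xi> $ j) * cos (x \<bullet> \<xi>))) = - (LINT x|lborel. g x * sin (x \<bullet> \<xi>))"
    using w[of 1 \<xi> 0] by simp
  then have 2: "(LINT x|lborel. g x * sin (x \<bullet> \<xi>)) = - (\<xi> $ j * (LINT x|lborel. v x * cos (x \<bullet> \<xi>)))"
    unfolding integral_mult_right_zero[symmetric] by (simp add: mult_ac)
  show ?thesis unfolding ft_of_real[OF v] ft_of_real[OF g] 1 2
    by (simp add: complex_eq_iff)
qed

text \<open>Interpolates between the bounds |t| near 0 and 2 for large t, using |t| \<le> |t| powr r
  when |t| \<le> 1 and r \<le> 1.\<close>

lemma norm_cis_diff_1:
  assumes "0 < r" "r \<le> 1"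
  shows "norm (cis t - 1) \<le> 2 * \<bar>t\<bar> powr r"
proof (cases "\<bar>t\<bar> \<le> 1")
  case True
  have "norm (cis t - 1) \<le> \<bar>t\<bar>"
    using iexp_approx1[of t 0] by (simp add: cis_conv_exp)
  also have "\<bar>t\<bar> \<le> \<bar>t\<bar> powr r"
    using powr_mono'[of r 1 "\<bar>t\<bar>"] assms True by (cases "t = 0") auto
  finally show ?thesis using powr_ge_zero[of "\<bar>t\<bar>" r] by linarith
next
  case False
  have "norm (cis t - 1) \<le> norm (cis t) + norm (1::complex)" by (rule norm_triangle_ineq4)
  also have "\<dots> = 2 * 1" by simp
  also have "\<dots> \<le> 2 * \<bar>t\<bar> powr r"
    using False assms ge_one_powr_ge_zero[of "\<bar>t\<bar>" r] by simp
  finally show ?thesis .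
qed

text \<open>After transforming, the shift contributes a character minus 1, of size at most 2 (|y|
  |\<xi>|) powr r, and the derivative contributes \<xi>_j. Their squares are absorbed by the Sobolev
  weight since r \<le> s, and \<open>plancherel_ge\<close> brings the estimate back.\<close>

lemma sobolev_gradient_shift:
  fixes v g :: "real^'n::finite \<Rightarrow> real"
  assumes v: "integrable lborel v" and g: "integrable lborel g"
    and weak: "\<And>\<phi>. \<phi> \<in> test_functions UNIV \<Longrightarrow>
      (LINT x|lborel. v x * partial_deriv j \<phi> x) = - (LINT x|lborel. g x * \<phi> x)"
    and sob: "(\<integral>\<^sup>+\<xi>. ennreal (((norm \<xi>)\<^sup>2 + 1) powr (1 + s) * (norm (ft (\<lambda>x. of_real (v x)) \<xi>))\<^sup>2) \<partial>lborel) < \<infinity>"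
    and r: "0 < r" "r \<le> 1" "r \<le> s"
  obtains C where "C \<ge> 0" "\<And>y. (\<integral>\<^sup>+x. ennreal ((g (x - y) - g x)\<^sup>2) \<partial>lborel) \<le> ennreal (C * norm y powr (2 * r))"
proof -
  let ?c = "gauss_const TYPE(real^'n)" and ?V = "ft (\<lambda>x. of_real (v x))"
  have [measurable]: "v \<in> borel_measurable borel" "g \<in> borel_measurable borel" using v g by auto
  obtain W where W: "W \<ge> 0" "(\<integral>\<^sup>+\<xi>. ennreal (((norm \<xi>)\<^sup>2 + 1) powr (1 + s) * (norm (?V \<xi>))\<^sup>2) \<partial>lborel) = ennreal W"
    using sob by (cases "\<integral>\<^sup>+\<xi>. ennreal (((norm \<xi>)\<^sup>2 + 1) powr (1 + s) * (norm (?V \<xi>))\<^sup>2) \<partial>lborel") auto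
  \<comment> \<open>The 4 is the square of the constant in \<open>norm_cis_diff_1\<close>,
    \<open>W\<close> is the squared Sobolev norm up to normalisation, and the denominator is
    Plancherel's constant.\<close>
  have "(\<integral>\<^sup>+x. ennreal ((g (x - y) - g x)\<^sup>2) \<partial>lborel) \<le> ennreal (4 * W / ?c\<^sup>2 * norm y powr (2 * r))" for y
  proof -
    let ?f = "\<lambda>x. complex_of_real (g (x - y)) - of_real (g x)"
    have gy: "integrable lborel (\<lambda>x. complex_of_real (g (x - y)))"
      using integrable_lborel_affine[OF g, of 1 "- y"] by simp
    have g': "integrable lborel (\<lambda>x. complex_of_real (g x))" using g by simp
    have f: "integrable lborel ?f" using gy g' by simp
    have "ft ?f \<xi> = (cis (- (y \<bullet> \<xi>)) - 1) * (\<i> * of_real (\<xi> $ j) * ?V \<xi>)" for \<xi>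
    proof -
      have "ft ?f \<xi> = ft (\<lambda>x. of_real (g (x - y))) \<xi> - ft (\<lambda>x. of_real (g x)) \<xi>"
        unfolding ft_def right_diff_distrib
        by (rule Bochner_Integration.integral_diff) (rule integrable_cis_mult[OF gy], rule integrable_cis_mult[OF g'])
      also have "ft (\<lambda>x. of_real (g (x - y))) \<xi> = (LINT x|lborel. cis (- ((y + x) \<bullet> \<xi>)) * of_real (g x))"
      proof -
        have m: "(\<lambda>x. cis (- (x \<bullet> \<xi>)) * complex_of_real (g (x - y))) \<in> borel_measurable borel"
          using integrable_cis_mult[OF gy, of \<xi>] by (auto dest: borel_measurable_integrable)
        show ?thesis
          using integral_lborel_translate[OF m, of y] unfolding ft_def by simp
      qed
      also have "\<dots> = (LINT x|lborel. cis (- (y \<bullet> \<xi>)) * (cis (- (x \<bullet> \<xi>)) * of_real (g x)))"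
        by (simp add: inner_add_left cis_mult mult.assoc[symmetric])
      also have "\<dots> = cis (- (y \<bullet> \<xi>)) * ft (\<lambda>x. of_real (g x)) \<xi>"
        unfolding ft_def by (rule integral_mult_right_zero)
      finally have "ft ?f \<xi> = (cis (- (y \<bullet> \<xi>)) - 1) * ft (\<lambda>x. of_real (g x)) \<xi>"
        by (simp only: left_diff_distrib mult_1_left)
      then show ?thesis by (simp only: ft_weak_partial[OF v g weak])
    qed
    note ftf = this
    have pt: "(norm (ft ?f \<xi>))\<^sup>2 \<le> (4 * norm y powr (2 * r)) * (((norm \<xi>)\<^sup>2 + 1) powr (1 + s) * (norm (?V \<xi>))\<^sup>2)" for \<xi>
    proof -
      have "norm (cis (- (y \<bullet> \<xi>)) - 1) \<le> 2 * \<bar>- (y \<bullet> \<xi>)\<bar> powr r" by (rule norm_cis_diff_1[OF r(1,2)])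
      also have "\<dots> \<le> 2 * (norm y * norm \<xi>) powr r"
        using Cauchy_Schwarz_ineq2[of y \<xi>] r(1) by (intro mult_left_mono powr_mono2) auto
      finally have "(norm (cis (- (y \<bullet> \<xi>)) - 1))\<^sup>2 \<le> (2 * (norm y * norm \<xi>) powr r)\<^sup>2"
        by (rule power_mono) simp
      also have "\<dots> = 4 * norm y powr (2 * r) * norm \<xi> powr (2 * r)"
      proof -
        have "a powr (2 * r) = a powr r * a powr r" for a :: real by (simp add: powr_add[symmetric])
        then show ?thesis by (simp add: powr_mult power2_eq_square)
      qed
      finally have 1: "(norm (cis (- (y \<bullet> \<xi>)) - 1))\<^sup>2 \<le> 4 * norm y powr (2 * r) * norm \<xi> powr (2 * r)" .
      have "norm \<xi> powr (2 * r) = ((norm \<xi>)\<^sup>2) powr r"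
        by (simp add: powr_powr[symmetric] powr_numeral)
      also have "\<dots> \<le> ((norm \<xi>)\<^sup>2 + 1) powr r" using r by (intro powr_mono2) auto
      also have "\<dots> \<le> ((norm \<xi>)\<^sup>2 + 1) powr s" using r by (intro powr_mono) auto
      finally have 2: "norm \<xi> powr (2 * r) \<le> ((norm \<xi>)\<^sup>2 + 1) powr s" .
      have "(\<xi> $ j)\<^sup>2 \<le> (norm \<xi>)\<^sup>2" using component_le_norm_cart[of \<xi> j] by (simp add: abs_le_square_iff[symmetric])
      then have 3: "(\<xi> $ j)\<^sup>2 \<le> (norm \<xi>)\<^sup>2 + 1" by simp
      have "norm \<xi> powr (2 * r) * (\<xi> $ j)\<^sup>2 \<le> ((norm \<xi>)\<^sup>2 + 1) powr s * ((norm \<xi>)\<^sup>2 + 1)"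
        by (intro mult_mono 2 3) auto
      also have "\<dots> = ((norm \<xi>)\<^sup>2 + 1) powr (1 + s)"
      proof -
        have "(norm \<xi>)\<^sup>2 + 1 > 0" by (simp add: add_nonneg_pos)
        then show ?thesis by (simp add: powr_add mult.commute)
      qed
      finally have 4: "norm \<xi> powr (2 * r) * (\<xi> $ j)\<^sup>2 \<le> ((norm \<xi>)\<^sup>2 + 1) powr (1 + s)" .
      have "(norm (ft ?f \<xi>))\<^sup>2 = (norm (cis (- (y \<bullet> \<xi>)) - 1))\<^sup>2 * ((\<xi> $ j)\<^sup>2 * (norm (?V \<xi>))\<^sup>2)"
        unfolding ftf by (simp add: norm_mult power_mult_distrib)
      also have "\<dots> \<le> (4 * norm y powr (2 * r) * norm \<xi> powr (2 * r)) * ((\<xi> $ j)\<^sup>2 * (norm (?V \<xi>))\<^sup>2)"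
        by (intro mult_right_mono 1) auto
      also have "\<dots> = (4 * norm y powr (2 * r)) * ((norm \<xi> powr (2 * r) * (\<xi> $ j)\<^sup>2) * (norm (?V \<xi>))\<^sup>2)"
        by (simp only: mult_ac)
      also have "\<dots> \<le> (4 * norm y powr (2 * r)) * (((norm \<xi>)\<^sup>2 + 1) powr (1 + s) * (norm (?V \<xi>))\<^sup>2)"
        by (intro mult_left_mono mult_right_mono 4) auto
      finally show ?thesis .
    qed
    have "ennreal (?c\<^sup>2) * (\<integral>\<^sup>+x. ennreal ((norm (?f x))\<^sup>2) \<partial>lborel) \<le> (\<integral>\<^sup>+\<xi>. ennreal ((norm (ft ?f \<xi>))\<^sup>2) \<partial>lborel)"
      by (rule plancherel_ge[OF f])
    also have "\<dots> \<le> (\<integral>\<^sup>+\<xi>. ennreal (4 * norm y powr (2 * r)) * ennreal (((norm \<xi>)\<^sup>2 + 1) powr (1 + s) * (norm (?V \<xi>))\<^sup>2) \<partial>lborel)"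
      by (intro nn_integral_mono) (subst ennreal_mult[symmetric], use pt in \<open>auto intro: ennreal_leI\<close>)
    also have "\<dots> = ennreal (4 * norm y powr (2 * r)) * ennreal W"
      unfolding W(2)[symmetric] by (rule nn_integral_cmult) simp
    also have "\<dots> = ennreal (?c\<^sup>2) * ennreal (4 * W / ?c\<^sup>2 * norm y powr (2 * r))"
      using W(1) by (simp add: ennreal_mult[symmetric] mult_ac)
    finally have "(\<integral>\<^sup>+x. ennreal ((norm (?f x))\<^sup>2) \<partial>lborel) \<le> ennreal (4 * W / ?c\<^sup>2 * norm y powr (2 * r))"
      by (subst (asm) ennreal_mult_le_mult_iff) auto
    moreover have "(norm (?f x))\<^sup>2 = (g (x - y) - g x)\<^sup>2" for x
      by (simp only: of_real_diff[symmetric] norm_of_real power2_abs)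
    ultimately show ?thesis by simp
  qed
  then show thesis using that[of "4 * W / ?c\<^sup>2"] W(1) by simp
qed

section \<open>Thin layers around the boundary\<close>

text \<open>A Lipschitz gradient is bounded on bounded sets, so the mean value inequality applies on
  a ball. The projection along \<open>e\<close> at most doubles distances, which accounts for the
  factors 2.\<close>

lemma C11_graph_lipschitz:
  fixes \<gamma> :: "real^'n::finite \<Rightarrow> real"
  assumes \<gamma>: "C11_function \<gamma>" and e: "norm e = 1"
  defines "g \<equiv> \<lambda>x. x \<bullet> e - \<gamma> (x - (x \<bullet> e) *\<^sub>R e)"
  obtains \<Lambda> where "\<Lambda> > 0" "\<And>x y. x \<in> ball p r \<Longrightarrow> y \<in> ball p r \<Longrightarrow> \<bar>g x - g y\<bar> \<le> \<Lambda> * norm (x - y)"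
proof -
  obtain D L where D: "\<And>x. GDERIV \<gamma> x :> D x" and L: "L-lipschitz_on UNIV D"
    using \<gamma> unfolding C11_function_def by blast
  define P where "P x = x - (x \<bullet> e) *\<^sub>R e" for x
  have P: "norm (P x - P y) \<le> 2 * norm (x - y)" for x y
  proof -
    have "P x - P y = (x - y) - ((x - y) \<bullet> e) *\<^sub>R e" unfolding P_def by (simp add: algebra_simps inner_diff_left)
    also have "norm \<dots> \<le> norm (x - y) + norm (((x - y) \<bullet> e) *\<^sub>R e)" by (rule norm_triangle_ineq4)
    also have "\<dots> \<le> 2 * norm (x - y)" using Cauchy_Schwarz_ineq2[of "x - y" e] e by simp
    finally show ?thesis .
  qed
  \<comment> \<open>Bounds the gradient on a ball that contains the projection of
    \<open>ball p r\<close>: its value at the centre plus its oscillation over the radius.\<close>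
  define B where "B = norm (D (P p)) + L * (2 * \<bar>r\<bar>)"
  have L0: "L \<ge> 0" using L by (rule lipschitz_on_nonneg)
  have B0: "B \<ge> 0" unfolding B_def using L0 by simp
  have DB: "norm (D z) \<le> B" if "z \<in> cball (P p) (2 * \<bar>r\<bar>)" for z
  proof -
    have "dist (D z) (D (P p)) \<le> L * dist z (P p)" using L by (simp add: lipschitz_on_def)
    also have "\<dots> \<le> L * (2 * \<bar>r\<bar>)" using that L0 by (intro mult_left_mono) (auto simp: dist_commute)
    finally show ?thesis unfolding B_def dist_norm using norm_triangle_ineq2[of "D z" "D (P p)"] by simp
  qed
  have \<gamma>B: "\<bar>\<gamma> z - \<gamma> w\<bar> \<le> B * norm (z - w)" if "z \<in> cball (P p) (2 * \<bar>r\<bar>)" "w \<in> cball (P p) (2 * \<bar>r\<bar>)" for z w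
  proof -
    have "norm (\<gamma> z - \<gamma> w) \<le> B * norm (z - w)"
    proof (rule differentiable_bound[OF convex_cball _ _ that])
      show "(\<gamma> has_derivative (\<lambda>h. h \<bullet> D x)) (at x within cball (P p) (2 * \<bar>r\<bar>))" for x
        using D[of x] unfolding gderiv_def by (rule has_derivative_at_withinI)
      show "onorm (\<lambda>h. h \<bullet> D x) \<le> B" if "x \<in> cball (P p) (2 * \<bar>r\<bar>)" for x
      proof (rule onorm_le)
        fix h
        have "norm (h \<bullet> D x) \<le> norm h * norm (D x)" using Cauchy_Schwarz_ineq2[of h "D x"] by simp
        also have "\<dots> \<le> norm h * B" by (intro mult_left_mono DB that) simp
        finally show "norm (h \<bullet> D x) \<le> B * norm h" by (simp only: mult.commute)
      qed
    qed
    then show ?thesis by simp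
  qed
  show thesis
  proof (rule that[of "1 + B * 2"])
    show "1 + B * 2 > 0" using B0 by simp
    fix x y assume xy: "x \<in> ball p r" "y \<in> ball p r"
    have in_cball: "P w \<in> cball (P p) (2 * \<bar>r\<bar>)" if "w \<in> ball p r" for w
      using P[of p w] that by (simp add: dist_norm)
    have "\<bar>\<gamma> (P x) - \<gamma> (P y)\<bar> \<le> B * norm (P x - P y)"
      by (intro \<gamma>B in_cball xy)
    also have "\<dots> \<le> B * (2 * norm (x - y))" by (intro mult_left_mono P B0)
    finally have 1: "\<bar>\<gamma> (P x) - \<gamma> (P y)\<bar> \<le> B * (2 * norm (x - y))" .
    have 2: "\<bar>x \<bullet> e - y \<bullet> e\<bar> \<le> norm (x - y)"
      using Cauchy_Schwarz_ineq2[of "x - y" e] e by (simp add: inner_diff_left)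
    have "g x - g y = (x \<bullet> e - y \<bullet> e) - (\<gamma> (P x) - \<gamma> (P y))" unfolding g_def P_def by simp
    then have "\<bar>g x - g y\<bar> \<le> norm (x - y) + B * (2 * norm (x - y))" using 1 2 by linarith
    then show "\<bar>g x - g y\<bar> \<le> (1 + B * 2) * norm (x - y)" by (simp add: algebra_simps)
  qed
qed

text \<open>No change of variables is needed: translates of the layer in direction \<open>e\<close> by multiples of
  \<open>3 * \<eta>\<close> are disjoint, and about \<open>1 / \<eta>\<close> of them fit into a fixed ball.\<close>

lemma emeasure_level_layer:
  fixes g :: "'a::euclidean_space \<Rightarrow> real"
  assumes g: "continuous_on UNIV g" and e: "norm e = 1" and ge: "\<And>x t. g (x + t *\<^sub>R e) = g x + t"
    and \<eta>: "0 < \<eta>" "\<eta> \<le> 1/2"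
  shows "emeasure lborel {x\<in>ball p r. \<bar>g x\<bar> \<le> \<eta>} \<le> ennreal (2 * measure lborel (ball p (r + 3)) * \<eta>)"
proof -
  let ?T = "{x\<in>ball p r. \<bar>g x\<bar> \<le> \<eta>}" and ?V = "measure lborel (ball p (r + 3))"
  have [measurable]: "g \<in> borel_measurable borel" using g by (rule borel_measurable_continuous_onI)
  have T [measurable]: "?T \<in> sets borel" by measurable
  \<comment> \<open>The upper bound 1/\<eta> keeps all translations within distance 3; the lower
    bound 1 / (2 * \<eta>), valid because \<eta> \<le> 1/2, produces the factor 2 in the
    estimate.\<close>
  define N where "N = nat \<lfloor>1 / \<eta>\<rfloor>"
  have inv: "1 / \<eta> \<ge> 2" using \<eta> by (simp add: field_simps)
  have N: "real N \<le> 1 / \<eta>" "1 / (2 * \<eta>) \<le> real N"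
  proof -
    have "0 \<le> \<lfloor>1 / \<eta>\<rfloor>" using \<eta> by simp
    then have "real N = of_int \<lfloor>1 / \<eta>\<rfloor>" unfolding N_def by (rule of_nat_nat)
    moreover have "1 / (2 * \<eta>) = (1 / \<eta>) / 2" by simp
    ultimately show "real N \<le> 1 / \<eta>" "1 / (2 * \<eta>) \<le> real N"
      using inv by linarith+
  qed
  define S where "S k = (\<lambda>x. x - (3 * \<eta> * real k) *\<^sub>R e) -` ?T" for k :: nat
  have S: "S k \<in> sets borel" for k
    unfolding S_def by (rule measurable_sets_borel[OF _ T]) measurable
  have emS: "emeasure lborel (S k) = emeasure lborel ?T" for k
  proof -
    have "emeasure lborel (S k) = (\<integral>\<^sup>+x. indicator (S k) x \<partial>lborel)"
      using S[of k] by (subst nn_integral_indicator) auto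
    also have "\<dots> = (\<integral>\<^sup>+x. indicator ?T (- ((3 * \<eta> * real k) *\<^sub>R e) + x) \<partial>lborel)"
      unfolding S_def by (intro nn_integral_cong) (simp add: indicator_def)
    also have "\<dots> = emeasure lborel ?T"
      by (subst nn_integral_lborel_translate) auto
    finally show ?thesis .
  qed
  have gS: "\<bar>g x - 3 * \<eta> * real k\<bar> \<le> \<eta>" if "x \<in> S k" for x k
    using that ge[of x "- (3 * \<eta> * real k)"] unfolding S_def by simp
  \<comment> \<open>On \<open>S k\<close> the value of \<open>g\<close> is within \<eta> of
    \<open>3 * \<eta> * k\<close>; these windows have width 2 * \<eta> while their centres are at
    least 3 * \<eta> apart.\<close>
  have disj: "disjoint_family_on S {..<N}"
    unfolding disjoint_family_on_def
  proof (intro ballI impI)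
    fix k l :: nat assume "k \<noteq> l"
    have False if "x \<in> S k" "x \<in> S l" for x
    proof -
      have "\<bar>3 * \<eta> * real k - 3 * \<eta> * real l\<bar> \<le> 2 * \<eta>" using gS[OF that(1)] gS[OF that(2)] by linarith
      then have "(3 * \<eta>) * \<bar>real k - real l\<bar> \<le> 2 * \<eta>"
        using \<eta> by (simp add: right_diff_distrib[symmetric] abs_mult)
      moreover have "\<bar>real k - real l\<bar> \<ge> 1" using \<open>k \<noteq> l\<close> by linarith
      then have "(3 * \<eta>) * \<bar>real k - real l\<bar> \<ge> (3 * \<eta>) * 1" using \<eta> by (intro mult_left_mono) auto
      ultimately show False using \<eta> by linarith
    qed
    then show "S k \<inter> S l = {}" by blast
  qed
  have sub: "(\<Union>k<N. S k) \<subseteq> ball p (r + 3)"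
  proof
    fix x assume "x \<in> (\<Union>k<N. S k)"
    then obtain k where k: "k < N" "x \<in> S k" by blast
    have "3 * \<eta> * real k \<le> 3 * \<eta> * (1 / \<eta>)" using k N \<eta> by (intro mult_left_mono) auto
    then have k3: "3 * \<eta> * real k \<le> 3" using \<eta> by simp
    have "dist p x \<le> dist p (x - (3 * \<eta> * real k) *\<^sub>R e) + dist (x - (3 * \<eta> * real k) *\<^sub>R e) x"
      by (rule dist_triangle)
    also have "dist p (x - (3 * \<eta> * real k) *\<^sub>R e) < r" using k unfolding S_def by simp
    also have "dist (x - (3 * \<eta> * real k) *\<^sub>R e) x = 3 * \<eta> * real k" using e \<eta> by (simp add: dist_norm)
    finally show "x \<in> ball p (r + 3)" using k3 by simp
  qed
  have fin: "emeasure lborel ?T \<noteq> \<infinity>"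
  proof -
    have "bounded ?T" by (rule bounded_subset[OF bounded_ball, of _ p r]) auto
    from emeasure_bounded_finite[OF this] show ?thesis by simp
  qed
  have "of_nat N * emeasure lborel ?T = (\<Sum>k<N. emeasure lborel (S k))" by (simp add: emS)
  also have "\<dots> = emeasure lborel (\<Union>k<N. S k)"
    using S disj by (intro sum_emeasure) auto
  also have "\<dots> \<le> emeasure lborel (ball p (r + 3))" using sub by (intro emeasure_mono) auto
  also have "\<dots> = ennreal ?V"
    using emeasure_bounded_finite[OF bounded_ball, of p "r + 3"] by (intro emeasure_eq_ennreal_measure) auto
  finally have "ennreal (real N * measure lborel ?T) \<le> ennreal ?V"
    using fin by (simp add: emeasure_eq_ennreal_measure ennreal_mult ennreal_of_nat_eq_real_of_nat)
  then have "real N * measure lborel ?T \<le> ?V" by (simp add: ennreal_le_iff)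
  moreover have "1 / (2 * \<eta>) * measure lborel ?T \<le> real N * measure lborel ?T"
    using N by (intro mult_right_mono) auto
  ultimately have "1 / (2 * \<eta>) * measure lborel ?T \<le> ?V" by linarith
  then have "measure lborel ?T \<le> 2 * ?V * \<eta>" using \<eta>(1) by (simp add: field_simps)
  then show ?thesis using fin by (simp add: emeasure_eq_ennreal_measure ennreal_leI)
qed

text \<open>The volume bound is stated for a Borel superset, since the neighbourhood of \<open>F\<close> need not be measurable
  for arbitrary \<open>F\<close>. The second part provides exterior points at distance comparable to \<open>\<epsilon>\<close>.\<close>

definition thin_layer :: "'a::euclidean_space set \<Rightarrow> 'a set \<Rightarrow> real \<Rightarrow> real \<Rightarrow> real \<Rightarrow> bool" where
  "thin_layer \<Omega> F A L \<epsilon> \<longleftrightarrow>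
     (\<exists>T\<in>sets borel. {x. \<exists>q\<in>F. dist x q \<le> \<epsilon>} \<subseteq> T \<and> emeasure lborel T \<le> ennreal (A * \<epsilon>)) \<and>
     (\<forall>q\<in>F. \<exists>z. dist z q \<le> L * \<epsilon> \<and> cball z \<epsilon> \<inter> closure \<Omega> = {})"

definition thin_at :: "'a::euclidean_space set \<Rightarrow> 'a set \<Rightarrow> bool" where
  "thin_at \<Omega> F \<longleftrightarrow> (\<exists>A\<ge>0. \<exists>L\<ge>0. \<exists>\<epsilon>\<^sub>1>0. \<forall>\<epsilon>. 0 < \<epsilon> \<longrightarrow> \<epsilon> < \<epsilon>\<^sub>1 \<longrightarrow> thin_layer \<Omega> F A L \<epsilon>)"

text \<open>Lets compactness assemble the boundary from local pieces. Sums of the constants serve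
  both parts: subadditivity for the volume, monotonicity for the distance.\<close>

lemma thin_layer_Un:
  assumes F: "thin_layer \<Omega> F A L \<epsilon>" and G: "thin_layer \<Omega> G B K \<epsilon>"
    and nonneg: "A \<ge> 0" "B \<ge> 0" "L \<ge> 0" "K \<ge> 0" "\<epsilon> > 0"
  shows "thin_layer \<Omega> (F \<union> G) (A + B) (L + K) \<epsilon>"
  unfolding thin_layer_def
proof (intro conjI ballI)
  obtain S where S: "S \<in> sets borel" "{x. \<exists>q\<in>F. dist x q \<le> \<epsilon>} \<subseteq> S" "emeasure lborel S \<le> ennreal (A * \<epsilon>)"
    using F unfolding thin_layer_def by blast
  obtain T where T: "T \<in> sets borel" "{x. \<exists>q\<in>G. dist x q \<le> \<epsilon>} \<subseteq> T" "emeasure lborel T \<le> ennreal (B * \<epsilon>)"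
    using G unfolding thin_layer_def by blast
  have "emeasure lborel (S \<union> T) \<le> emeasure lborel S + emeasure lborel T"
    using S(1) T(1) by (intro emeasure_subadditive) auto
  also have "\<dots> \<le> ennreal (A * \<epsilon>) + ennreal (B * \<epsilon>)" by (rule add_mono[OF S(3) T(3)])
  also have "\<dots> = ennreal ((A + B) * \<epsilon>)"
    using nonneg by (simp add: ennreal_plus[symmetric] distrib_right del: ennreal_plus)
  finally have "emeasure lborel (S \<union> T) \<le> ennreal ((A + B) * \<epsilon>)" .
  moreover have "{x. \<exists>q\<in>F \<union> G. dist x q \<le> \<epsilon>} \<subseteq> S \<union> T" using S(2) T(2) by blast
  moreover have "S \<union> T \<in> sets borel" using S(1) T(1) by (rule sets.Un)
  ultimately show "\<exists>T\<in>sets borel. {x. \<exists>q\<in>F \<union> G. dist x q \<le> \<epsilon>} \<subseteq> T \<and> emeasure lborel T \<le> ennreal ((A + B) * \<epsilon>)"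
    by (intro bexI[of _ "S \<union> T"] conjI)
  fix q assume q: "q \<in> F \<union> G"
  have "L * \<epsilon> \<le> (L + K) * \<epsilon>" "K * \<epsilon> \<le> (L + K) * \<epsilon>"
    using nonneg by (auto intro!: mult_right_mono)
  moreover have "\<exists>z. (dist z q \<le> L * \<epsilon> \<or> dist z q \<le> K * \<epsilon>) \<and> cball z \<epsilon> \<inter> closure \<Omega> = {}"
    using F G q unfolding thin_layer_def by blast
  ultimately show "\<exists>z. dist z q \<le> (L + K) * \<epsilon> \<and> cball z \<epsilon> \<inter> closure \<Omega> = {}"
    by (meson order_trans)
qed

lemma thin_at_Un:
  assumes "thin_at \<Omega> F" "thin_at \<Omega> G"
  shows "thin_at \<Omega> (F \<union> G)"
proof -
  obtain A L a where F: "A \<ge> 0" "L \<ge> 0" "a > 0" "\<And>\<epsilon>. 0 < \<epsilon> \<Longrightarrow> \<epsilon> < a \<Longrightarrow> thin_layer \<Omega> F A L \<epsilon>"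
    using assms(1) unfolding thin_at_def by blast
  obtain B K b where G: "B \<ge> 0" "K \<ge> 0" "b > 0" "\<And>\<epsilon>. 0 < \<epsilon> \<Longrightarrow> \<epsilon> < b \<Longrightarrow> thin_layer \<Omega> G B K \<epsilon>"
    using assms(2) unfolding thin_at_def by blast
  have "thin_layer \<Omega> (F \<union> G) (A + B) (L + K) \<epsilon>" if "0 < \<epsilon>" "\<epsilon> < min a b" for \<epsilon>
    using that F G by (intro thin_layer_Un) auto
  moreover have "A + B \<ge> 0" "L + K \<ge> 0" "min a b > 0" using F G by auto
  ultimately show ?thesis unfolding thin_at_def by blast
qed

lemma thin_at_empty: "thin_at \<Omega> {}"
proof -
  have "thin_layer \<Omega> {} 0 0 \<epsilon>" for \<epsilon>
    unfolding thin_layer_def by (intro conjI bexI[of _ "{}"]) auto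
  then show ?thesis
    unfolding thin_at_def using zero_less_one order_refl by blast
qed

lemma thin_at_UNION:
  "finite I \<Longrightarrow> (\<And>i. i \<in> I \<Longrightarrow> thin_at \<Omega> (F i)) \<Longrightarrow> thin_at \<Omega> (\<Union>i\<in>I. F i)"
  by (induction I rule: finite_induct) (auto simp: thin_at_empty intro: thin_at_Un)

text \<open>\<open>g\<close> is the signed height over the graph: zero on the frontier, Lipschitz
  near \<open>p\<close>, of unit speed along \<open>e\<close>. The \<epsilon>-neighbourhood of the
  frontier therefore lies in a level layer of \<open>g\<close>, and going down along
  \<open>e\<close> leads to exterior points.\<close>

lemma thin_at_local:
  fixes \<Omega> :: "(real^'n::finite) set"
  assumes \<Omega>: "open \<Omega>" and r: "r > 0" and e: "norm e = 1" and \<gamma>: "C11_function \<gamma>"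
    and graph: "\<Omega> \<inter> ball p r = {x\<in>ball p r. \<gamma> (x - (x \<bullet> e) *\<^sub>R e) < x \<bullet> e}"
  shows "thin_at \<Omega> (frontier \<Omega> \<inter> ball p (r / 2))"
proof -
  define g where "g x = x \<bullet> e - \<gamma> (x - (x \<bullet> e) *\<^sub>R e)" for x
  obtain \<Lambda> where \<Lambda>: "\<Lambda> > 0" "\<And>x y. x \<in> ball p r \<Longrightarrow> y \<in> ball p r \<Longrightarrow> \<bar>g x - g y\<bar> \<le> \<Lambda> * norm (x - y)"
    using C11_graph_lipschitz[OF \<gamma> e, of p r] unfolding g_def by blast
  obtain D where "\<And>x. GDERIV \<gamma> x :> D x" using \<gamma> unfolding C11_function_def by blast
  then have "isCont \<gamma> x" for x unfolding gderiv_def using has_derivative_continuous by blast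
  then have "continuous_on UNIV \<gamma>" by (simp add: continuous_at_imp_continuous_on)
  then have "continuous_on UNIV (\<lambda>x. \<gamma> (x - (x \<bullet> e) *\<^sub>R e))"
    by (rule continuous_on_compose2) (auto intro!: continuous_intros)
  then have gc: "continuous_on UNIV g"
    unfolding g_def by (intro continuous_on_diff continuous_intros)
  have "e \<bullet> e = 1" using e by (simp add: norm_eq_sqrt_inner)
  then have ge: "g (x + t *\<^sub>R e) = g x + t" for x t
    unfolding g_def
    by (simp add: inner_add_left inner_diff_left scaleR_add_left)
  have in_\<Omega>: "x \<in> \<Omega> \<longleftrightarrow> g x > 0" if "x \<in> ball p r" for x
  proof -
    have "x \<in> \<Omega> \<longleftrightarrow> x \<in> \<Omega> \<inter> ball p r" using that by blast
    also have "\<dots> \<longleftrightarrow> g x > 0" unfolding graph g_def using that by simp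
    finally show ?thesis .
  qed
  have g0: "g q = 0" if q: "q \<in> frontier \<Omega>" "q \<in> ball p r" for q
  proof (rule antisym)
    have "q \<notin> \<Omega>" using q(1) \<Omega> by (simp add: frontier_def interior_open)
    then show "g q \<le> 0" using in_\<Omega>[OF q(2)] by simp
    show "0 \<le> g q"
    proof (rule ccontr)
      assume "\<not> 0 \<le> g q"
      define W where "W = ball p r \<inter> {x. g x < 0}"
      have "open {x. g x < 0}" using gc continuous_on_const by (rule open_Collect_less)
      then have "open W" unfolding W_def using open_ball by blast
      moreover have "q \<in> W" using q \<open>\<not> 0 \<le> g q\<close> by (simp add: W_def)
      moreover have "W \<inter> \<Omega> = {}" unfolding W_def using in_\<Omega> by force
      ultimately have "q \<notin> closure \<Omega>" using open_Int_closure_eq_empty by blast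
      then show False using q(1) by (simp add: frontier_def)
    qed
  qed
  let ?V = "measure lborel (ball p (r + 3))"
  \<comment> \<open>The first term gives \<open>\<Lambda> * \<epsilon> \<le> 1/2\<close>, as the
    layer estimate needs; the second keeps points within distance (2 * \<Lambda> + 3) * \<epsilon>
    of \<open>q\<close> inside \<open>ball p r\<close>.\<close>
  define \<epsilon>\<^sub>1 where "\<epsilon>\<^sub>1 = min (1 / (2 * \<Lambda>)) (r / (2 * (2 * \<Lambda> + 3)))"
  have \<epsilon>1: "\<epsilon>\<^sub>1 > 0" unfolding \<epsilon>\<^sub>1_def using \<Lambda>(1) r by simp
  have layer: "thin_layer \<Omega> (frontier \<Omega> \<inter> ball p (r / 2)) (2 * ?V * \<Lambda>) (2 * \<Lambda> + 1) \<epsilon>"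
    if "0 < \<epsilon>" "\<epsilon> < \<epsilon>\<^sub>1" for \<epsilon>
    unfolding thin_layer_def
  proof (intro conjI ballI)
    have \<epsilon>: "0 < \<epsilon> \<and> \<epsilon> < \<epsilon>\<^sub>1" using that by simp
    have \<Lambda>\<epsilon>: "\<Lambda> * \<epsilon> \<le> 1/2" using \<epsilon> \<Lambda>(1) unfolding \<epsilon>\<^sub>1_def by (simp add: field_simps)
    have r2: "(2 * \<Lambda> + 3) * \<epsilon> < r / 2" using \<epsilon> \<Lambda>(1) unfolding \<epsilon>\<^sub>1_def by (simp add: field_simps)
    have \<epsilon>r: "\<epsilon> < r / 2" using r2 \<epsilon> \<Lambda>(1) by (smt (verit) mult_less_cancel_right2)
    have in_ball: "x \<in> ball p r" if "dist x q < r / 2" "q \<in> ball p (r / 2)" for x q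
      using dist_triangle[of p x q] that by (simp add: dist_commute)
    have "{x. \<exists>q\<in>frontier \<Omega> \<inter> ball p (r / 2). dist x q \<le> \<epsilon>} \<subseteq> {x\<in>ball p r. \<bar>g x\<bar> \<le> \<Lambda> * \<epsilon>}"
    proof clarify
      fix x q assume q: "q \<in> frontier \<Omega>" "q \<in> ball p (r / 2)" and xq: "dist x q \<le> \<epsilon>"
      have x: "x \<in> ball p r" using in_ball[OF _ q(2)] xq \<epsilon>r by simp
      have qr: "q \<in> ball p r" using q r by simp
      have "\<bar>g x - g q\<bar> \<le> \<Lambda> * norm (x - q)" by (rule \<Lambda>(2)[OF x qr])
      also have "\<dots> \<le> \<Lambda> * \<epsilon>" using xq \<Lambda>(1) by (intro mult_left_mono) (auto simp: dist_norm)
      finally show "x \<in> ball p r \<and> \<bar>g x\<bar> \<le> \<Lambda> * \<epsilon>" using x g0[OF q(1) qr] by simp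
    qed
    moreover have "emeasure lborel {x\<in>ball p r. \<bar>g x\<bar> \<le> \<Lambda> * \<epsilon>} \<le> ennreal (2 * ?V * (\<Lambda> * \<epsilon>))"
      by (rule emeasure_level_layer[OF gc e ge]) (use \<epsilon> \<Lambda>(1) \<Lambda>\<epsilon> in auto)
    moreover have [measurable]: "g \<in> borel_measurable borel" using gc by (rule borel_measurable_continuous_onI)
    have "{x\<in>ball p r. \<bar>g x\<bar> \<le> \<Lambda> * \<epsilon>} \<in> sets borel" by measurable
    ultimately show "\<exists>T\<in>sets borel. {x. \<exists>q\<in>frontier \<Omega> \<inter> ball p (r / 2). dist x q \<le> \<epsilon>} \<subseteq> T
        \<and> emeasure lborel T \<le> ennreal (2 * ?V * \<Lambda> * \<epsilon>)"
      unfolding mult.assoc by blast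
    fix q assume q: "q \<in> frontier \<Omega> \<inter> ball p (r / 2)"
    \<comment> \<open>On a ball of radius 2 * \<epsilon> the height changes by at most 2 * \<Lambda>
      * \<epsilon>, so starting from - (2 * \<Lambda> + 1) * \<epsilon> it stays below -
      \<epsilon>.\<close>
    define z where "z = q - ((2 * \<Lambda> + 1) * \<epsilon>) *\<^sub>R e"
    have zq: "dist z q = (2 * \<Lambda> + 1) * \<epsilon>" unfolding z_def using e \<epsilon> \<Lambda>(1) by (simp add: dist_norm)
    have qr: "q \<in> ball p r" using q r by simp
    have gz: "g z = - ((2 * \<Lambda> + 1) * \<epsilon>)"
      using ge[of q "- ((2 * \<Lambda> + 1) * \<epsilon>)"] g0[of q] q qr unfolding z_def by simp
    have zr: "z \<in> ball p r"
    proof (rule in_ball)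
      have "(2 * \<Lambda> + 1) * \<epsilon> \<le> (2 * \<Lambda> + 3) * \<epsilon>" using \<epsilon> by (intro mult_right_mono) auto
      then show "dist z q < r / 2" unfolding zq using r2 by linarith
    qed (use q in simp)
    \<comment> \<open>An open ball is used because an open set disjoint from \<Omega> is disjoint
      from its closure; the closed ball of radius \<epsilon> sits inside it.\<close>
    have "ball z (2 * \<epsilon>) \<inter> \<Omega> = {}"
    proof -
      have "y \<notin> \<Omega>" if y: "y \<in> ball z (2 * \<epsilon>)" for y
      proof -
        have yz: "norm (y - z) < 2 * \<epsilon>" using y by (simp add: dist_norm norm_minus_commute)
        have "dist y q \<le> dist y z + dist z q" by (rule dist_triangle)
        also have "\<dots> < 2 * \<epsilon> + (2 * \<Lambda> + 1) * \<epsilon>" using yz zq by (simp add: dist_norm)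
        also have "\<dots> = (2 * \<Lambda> + 3) * \<epsilon>" by (simp add: algebra_simps)
        finally have yr: "y \<in> ball p r" using r2 q by (intro in_ball[of y q]) auto
        have "\<bar>g y - g z\<bar> \<le> \<Lambda> * norm (y - z)" by (rule \<Lambda>(2)[OF yr zr])
        also have "\<dots> \<le> \<Lambda> * (2 * \<epsilon>)" using yz \<Lambda>(1) by (intro mult_left_mono) auto
        finally have "g y \<le> - \<epsilon>" unfolding gz by (simp add: algebra_simps abs_le_iff)
        then show ?thesis using in_\<Omega>[OF yr] \<epsilon> by simp
      qed
      then show ?thesis by blast
    qed
    then have "ball z (2 * \<epsilon>) \<inter> closure \<Omega> = {}" by (simp add: open_Int_closure_eq_empty)
    moreover have "cball z \<epsilon> \<subseteq> ball z (2 * \<epsilon>)" using \<epsilon> by auto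
    ultimately have "cball z \<epsilon> \<inter> closure \<Omega> = {}" by blast
    then show "\<exists>z. dist z q \<le> (2 * \<Lambda> + 1) * \<epsilon> \<and> cball z \<epsilon> \<inter> closure \<Omega> = {}" using zq by force
  qed
  have "2 * ?V * \<Lambda> \<ge> 0" "2 * \<Lambda> + 1 \<ge> 0" using \<Lambda>(1) by auto
  with \<epsilon>1 layer show ?thesis unfolding thin_at_def by blast
qed

text \<open>The frontier is compact, so finitely many graph patches cover it and their constants can
  be added.\<close>

lemma C11_boundary_thin:
  fixes \<Omega> :: "(real^'n::finite) set"
  assumes \<Omega>: "open \<Omega>" "bounded \<Omega>" "C11_boundary \<Omega>"
  shows "thin_at \<Omega> (frontier \<Omega>)"
proof -
  have "\<forall>p\<in>frontier \<Omega>. \<exists>r>0. thin_at \<Omega> (frontier \<Omega> \<inter> ball p r)"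
  proof
    fix p assume "p \<in> frontier \<Omega>"
    then obtain r e \<gamma> where "r > 0" "norm e = 1" "C11_function \<gamma>"
      "\<Omega> \<inter> ball p r = {x\<in>ball p r. \<gamma> (x - (x \<bullet> e) *\<^sub>R e) < x \<bullet> e}"
      using \<Omega>(3) unfolding C11_boundary_def by blast
    from thin_at_local[OF \<Omega>(1) this] \<open>r > 0\<close> show "\<exists>r>0. thin_at \<Omega> (frontier \<Omega> \<inter> ball p r)"
      using half_gt_zero by blast
  qed
  then obtain r where r: "\<And>p. p \<in> frontier \<Omega> \<Longrightarrow> r p > 0 \<and> thin_at \<Omega> (frontier \<Omega> \<inter> ball p (r p))"
    by metis
  have "compact (frontier \<Omega>)" using \<Omega>(2) by (rule compact_frontier_bounded)
  moreover have "frontier \<Omega> \<subseteq> (\<Union>p\<in>frontier \<Omega>. ball p (r p))" using r by force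
  ultimately obtain I where I: "I \<subseteq> frontier \<Omega>" "finite I" "frontier \<Omega> \<subseteq> (\<Union>p\<in>I. ball p (r p))"
    using compactE_image[of "frontier \<Omega>" "frontier \<Omega>" "\<lambda>p. ball p (r p)"] by auto
  have "thin_at \<Omega> (\<Union>p\<in>I. frontier \<Omega> \<inter> ball p (r p))"
    using I(1) r by (intro thin_at_UNION I(2)) auto
  moreover have "(\<Union>p\<in>I. frontier \<Omega> \<inter> ball p (r p)) = frontier \<Omega>" using I(3) by blast
  ultimately show ?thesis by simp
qed

section \<open>Mollified and truncated competitors\<close>

text \<open>With integral zero the nonnegative bump would vanish almost everywhere, yet it is
  positive on the unit ball, which is not negligible.\<close>

lemma bump_integral_pos: "(LINT x|lborel. bump (x::real^'n::finite)) > 0"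
proof -
  have k: "kernel 1 (bump :: real^'n \<Rightarrow> real)"
    unfolding kernel_def using bump_smooth by (auto intro: bump_simps(4))
  note i = kernel_integrable[OF k]
  have "(LINT x|lborel. bump (x::real^'n)) \<noteq> 0"
  proof
    assume "(LINT x|lborel. bump (x::real^'n)) = 0"
    then have "AE x in lborel. bump (x::real^'n) = 0"
      using integral_nonneg_eq_0_iff_AE[OF i AE_I2[OF bump_simps(1)]] by simp
    then have "AE x in lborel. x \<notin> ball (0::real^'n) 1"
      by eventually_elim (use bump_simps(5) in force)
    then have "emeasure lborel (ball (0::real^'n) 1) = 0"
      by (subst (asm) AE_iff_measurable[of "ball (0::real^'n) 1"]) auto
    then have "ball (0::real^'n) 1 \<in> null_sets lebesgue" by (intro null_sets_completionI null_setsI) auto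
    then have "negligible (ball (0::real^'n) 1)" by (simp add: negligible_iff_null_sets)
    then show False using open_not_negligible[of "ball (0::real^'n) 1"] by simp
  qed
  moreover have "(LINT x|lborel. bump (x::real^'n)) \<ge> 0" by (intro integral_nonneg_AE AE_I2 bump_simps(1))
  ultimately show ?thesis by simp
qed

text \<open>Dilating the bump by \<epsilon> costs a factor 1/\<epsilon> in L1 per derivative.
  Summing the L1 norms of all first and second derivatives gives one constant for all indices and
  scales.\<close>

lemma mollifier:
  obtains K where "K \<ge> 0" "\<And>\<epsilon>. \<epsilon> > 0 \<Longrightarrow> \<exists>\<rho> :: real^'n::finite \<Rightarrow> real. kernel \<epsilon> \<rho> \<and> (\<forall>x. \<rho> x \<ge> 0) \<and>
     (LINT x|lborel. \<rho> x) = 1 \<and> (\<forall>i. (LINT x|lborel. \<bar>partial_deriv i \<rho> x\<bar>) \<le> K / \<epsilon>) \<and>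
     (\<forall>i j. (LINT x|lborel. \<bar>partial_deriv j (partial_deriv i \<rho>) x\<bar>) \<le> K / \<epsilon>\<^sup>2)"
proof -
  let ?b = "bump :: real^'n \<Rightarrow> real"
  have k: "kernel 1 ?b"
    unfolding kernel_def using bump_smooth by (auto intro: bump_simps(4))
  define Z where "Z = (LINT x|lborel. ?b x)"
  have Z: "Z > 0" unfolding Z_def by (rule bump_integral_pos)
  define K where "K = ((\<Sum>i\<in>UNIV. LINT x|lborel. \<bar>partial_deriv i ?b x\<bar>) +
     (\<Sum>i\<in>UNIV. \<Sum>j\<in>UNIV. LINT x|lborel. \<bar>partial_deriv j (partial_deriv i ?b) x\<bar>)) / Z"
  have nn: "(\<Sum>i\<in>UNIV. LINT x|lborel. \<bar>partial_deriv i ?b x\<bar>) \<ge> 0"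
    "(\<Sum>i\<in>UNIV. \<Sum>j\<in>UNIV. LINT x|lborel. \<bar>partial_deriv j (partial_deriv i ?b) x\<bar>) \<ge> 0"
    by (auto intro!: sum_nonneg)
  have K1: "(LINT x|lborel. \<bar>partial_deriv i ?b x\<bar>) / Z \<le> K" for i
  proof -
    have "(LINT x|lborel. \<bar>partial_deriv i ?b x\<bar>) \<le> (\<Sum>i\<in>UNIV. LINT x|lborel. \<bar>partial_deriv i ?b x\<bar>)"
      by (rule member_le_sum) auto
    then show ?thesis unfolding K_def using nn Z by (intro divide_right_mono) auto
  qed
  have K2: "(LINT x|lborel. \<bar>partial_deriv j (partial_deriv i ?b) x\<bar>) / Z \<le> K" for i j
  proof -
    have "(LINT x|lborel. \<bar>partial_deriv j (partial_deriv i ?b) x\<bar>)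
        \<le> (\<Sum>j\<in>UNIV. LINT x|lborel. \<bar>partial_deriv j (partial_deriv i ?b) x\<bar>)"
      by (rule member_le_sum) auto
    also have "\<dots> \<le> (\<Sum>i\<in>UNIV. \<Sum>j\<in>UNIV. LINT x|lborel. \<bar>partial_deriv j (partial_deriv i ?b) x\<bar>)"
      by (rule member_le_sum[of i UNIV "\<lambda>i. \<Sum>j\<in>UNIV. LINT x|lborel. \<bar>partial_deriv j (partial_deriv i ?b) x\<bar>"])
        (auto intro: sum_nonneg)
    finally show ?thesis unfolding K_def using nn Z by (intro divide_right_mono) auto
  qed
  show thesis
  proof (rule that[of K])
    show "K \<ge> 0" unfolding K_def using nn Z by simp
    fix \<epsilon> :: real assume \<epsilon>: "\<epsilon> > 0"
    \<comment> \<open>Dilation multiplies the integral by \<open>\<epsilon> ^ CARD('n)\<close>, and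
      \<open>Z\<close> is the mass of the bump; \<open>c\<close> undoes both.\<close>
    define c where "c = 1 / (\<epsilon> ^ CARD('n) * Z)"
    have c: "c > 0" using \<epsilon> Z by (simp add: c_def)
    have scale: "(LINT x|lborel. h ((1 / \<epsilon>) *\<^sub>R x)) = \<epsilon> ^ CARD('n) * (LINT x|lborel. h x)"
      if "h \<in> borel_measurable borel" for h :: "real^'n \<Rightarrow> real"
      using integral_lborel_affine[OF that, of "1 / \<epsilon>" 0] \<epsilon> by (simp add: power_one_over field_simps)
    define \<rho> where "\<rho> x = c * ?b ((1 / \<epsilon>) *\<^sub>R x)" for x
    define d where "d i = partial_deriv i ?b" for i
    define dd where "dd i j = partial_deriv j (d i)" for i j
    have kd: "kernel 1 (d i)" "kernel 1 (dd i j)" for i j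
      unfolding dd_def d_def by (intro kernel_partial_deriv k)+
    have \<rho>1: "partial_deriv i \<rho> x = c * (d i ((1 / \<epsilon>) *\<^sub>R x) / \<epsilon>)" for i x
      using has_partials_partial_deriv[OF has_partials_scaleR[OF has_partials_affine[OF kernel_has_partials[OF k], of 0 "1 / \<epsilon>"], of c]]
      unfolding \<rho>_def[abs_def] d_def by simp
    have \<rho>2: "partial_deriv j (partial_deriv i \<rho>) x = c * (dd i j ((1 / \<epsilon>) *\<^sub>R x) / \<epsilon>\<^sup>2)" for i j x
      using has_partials_partial_deriv[OF has_partials_scaleR[OF has_partials_affine[OF kernel_has_partials[OF kd(1)[of i]], of 0 "1 / \<epsilon>"], of "c / \<epsilon>"]]
      unfolding \<rho>1[abs_def] dd_def by (simp add: power2_eq_square)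
    have "kernel \<epsilon> \<rho>"
      unfolding kernel_def
    proof (intro conjI allI impI)
      show "smooth \<rho>"
        using smooth_affine[OF bump_smooth, of c 0 "1 / \<epsilon>"] unfolding \<rho>_def[abs_def] by simp
      show "\<rho> x = 0" if "norm x > \<epsilon>" for x
        using that \<epsilon> unfolding \<rho>_def by (simp add: bump_simps(4))
    qed
    moreover have "\<rho> x \<ge> 0" for x unfolding \<rho>_def using c by (intro mult_nonneg_nonneg bump_simps(1)) simp
    moreover have "(LINT x|lborel. \<rho> x) = 1"
      unfolding \<rho>_def using scale[OF kernel_measurable[OF k]] \<epsilon> Z by (simp add: c_def Z_def)
    moreover have "(LINT x|lborel. \<bar>partial_deriv i \<rho> x\<bar>) \<le> K / \<epsilon>" for i
    proof -
      have "(LINT x|lborel. \<bar>partial_deriv i \<rho> x\<bar>) = (c / \<epsilon>) * (LINT x|lborel. \<bar>d i ((1 / \<epsilon>) *\<^sub>R x)\<bar>)"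
        unfolding \<rho>1 integral_mult_right_zero[symmetric] using c \<epsilon> by (simp add: abs_mult)
      also have "\<dots> = (LINT x|lborel. \<bar>d i x\<bar>) / Z / \<epsilon>"
        using scale[of "\<lambda>x. \<bar>d i x\<bar>"] kernel_measurable[OF kd(1)[of i]] \<epsilon> by (simp add: c_def)
      also have "\<dots> \<le> K / \<epsilon>" using K1[of i] \<epsilon> unfolding d_def by (intro divide_right_mono) auto
      finally show ?thesis .
    qed
    moreover have "(LINT x|lborel. \<bar>partial_deriv j (partial_deriv i \<rho>) x\<bar>) \<le> K / \<epsilon>\<^sup>2" for i j
    proof -
      have "(LINT x|lborel. \<bar>partial_deriv j (partial_deriv i \<rho>) x\<bar>) = (c / \<epsilon>\<^sup>2) * (LINT x|lborel. \<bar>dd i j ((1 / \<epsilon>) *\<^sub>R x)\<bar>)"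
        unfolding \<rho>2 integral_mult_right_zero[symmetric] using c \<epsilon> by (simp add: abs_mult)
      also have "\<dots> = (LINT x|lborel. \<bar>dd i j x\<bar>) / Z / \<epsilon>\<^sup>2"
        using scale[of "\<lambda>x. \<bar>dd i j x\<bar>"] kernel_measurable[OF kd(2)[of i j]] \<epsilon> by (simp add: c_def)
      also have "\<dots> \<le> K / \<epsilon>\<^sup>2" using K2[of j i] \<epsilon> unfolding d_def dd_def by (intro divide_right_mono) auto
      finally show ?thesis .
    qed
    ultimately show "\<exists>\<rho> :: real^'n \<Rightarrow> real. kernel \<epsilon> \<rho> \<and> (\<forall>x. \<rho> x \<ge> 0) \<and>
     (LINT x|lborel. \<rho> x) = 1 \<and> (\<forall>i. (LINT x|lborel. \<bar>partial_deriv i \<rho> x\<bar>) \<le> K / \<epsilon>) \<and>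
     (\<forall>i j. (LINT x|lborel. \<bar>partial_deriv j (partial_deriv i \<rho>) x\<bar>) \<le> K / \<epsilon>\<^sup>2)" by blast
  qed
qed

text \<open>The kernel sees only the ball of radius \<open>R\<close> around \<open>x\<close>.
  Applied to the cutoff with \<open>c = 1\<close> and a kernel of mean zero, it shows that
  derivatives of the cutoff vanish deep inside.\<close>

lemma conv_locally_const:
  assumes \<rho>: "kernel R \<rho>" and f: "\<And>y. dist x y \<le> R \<Longrightarrow> f y = c"
  shows "conv f \<rho> x = c * (LINT y|lborel. \<rho> y)"
proof -
  have eq: "f y * \<rho> (x - y) = c * \<rho> (x - y)" for y
    using \<rho> f[of y] unfolding kernel_def dist_norm by (cases "norm (x - y) \<le> R") auto
  then show ?thesis
    unfolding conv_def eq using integral_lborel_reflect[OF kernel_measurable[OF \<rho>], of x] by simp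
qed

lemma kernel_integral_partial:
  assumes "kernel R \<rho>"
  shows "(LINT x|lborel. partial_deriv i \<rho> x) = 0"
  by (rule integral_partial_eq_0[OF kernel_has_partials[OF assms] kernel_continuous[OF kernel_partial_deriv[OF assms]]])
    (use assms in \<open>auto simp: kernel_def\<close>)

text \<open>The integrand is compared with a Borel majorant: the square of the crude bound on the
  layer, whose volume is small, plus the square of \<open>h\<close>, which is integrated over the
  whole space.\<close>

lemma nn_integral_layer_split:
  fixes f h :: "'a::euclidean_space \<Rightarrow> real"
  assumes T: "T \<in> sets borel" "emeasure lborel T \<le> ennreal a" and a: "a \<ge> 0"
    and [measurable]: "h \<in> borel_measurable borel"
    and f: "\<And>x. x \<in> \<Omega> \<Longrightarrow> x \<in> T \<and> \<bar>f x\<bar> \<le> D \<or> f x = h x"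
    and h: "(\<integral>\<^sup>+x. ennreal ((h x)\<^sup>2) \<partial>lborel) \<le> ennreal b" and b: "b \<ge> 0"
  shows "(\<integral>\<^sup>+x\<in>\<Omega>. ennreal ((f x)\<^sup>2) \<partial>lborel) \<le> ennreal (D\<^sup>2 * a + b)"
proof -
  have "(\<integral>\<^sup>+x\<in>\<Omega>. ennreal ((f x)\<^sup>2) \<partial>lborel) \<le> (\<integral>\<^sup>+x. ennreal (D\<^sup>2) * indicator T x + ennreal ((h x)\<^sup>2) \<partial>lborel)"
  proof (intro nn_integral_mono)
    fix x
    have "(f x)\<^sup>2 \<le> D\<^sup>2" if "\<bar>f x\<bar> \<le> D" using that by (simp add: abs_le_square_iff[symmetric])
    then show "ennreal ((f x)\<^sup>2) * indicator \<Omega> x \<le> ennreal (D\<^sup>2) * indicator T x + ennreal ((h x)\<^sup>2)"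
      using f[of x] by (cases "x \<in> \<Omega>") (auto simp: add_increasing2 add_increasing ennreal_leI)
  qed
  also have "\<dots> = ennreal (D\<^sup>2) * emeasure lborel T + (\<integral>\<^sup>+x. ennreal ((h x)\<^sup>2) \<partial>lborel)"
    using T(1) by (subst nn_integral_add) (auto simp: nn_integral_cmult_indicator)
  also have "\<dots> \<le> ennreal (D\<^sup>2) * ennreal a + ennreal b"
    by (intro add_mono mult_left_mono T h) auto
  also have "\<dots> = ennreal (D\<^sup>2 * a + b)" using a b by (simp add: ennreal_mult ennreal_plus)
  finally show ?thesis .
qed

text \<open>One component of the competitor: the mollified \<open>v\<close> times a mollified
  indicator. Farther than 3 * \<epsilon> from the frontier the cutoff is 1 and
  \<open>conv_L2_modulus\<close> controls both errors; closer to it, pointwise bounds are multiplied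
  by the layer volume. \<open>Q\<close> is built from constants fixed before \<epsilon>.\<close>

lemma scalar_competitor:
  fixes \<Omega> :: "(real^'n::finite) set" and v :: "real^'n \<Rightarrow> real" and g :: "'n \<Rightarrow> real^'n \<Rightarrow> real"
  assumes \<Omega>: "open \<Omega>" "bounded \<Omega>" and thin: "thin_at \<Omega> (frontier \<Omega>)"
    and v: "integrable lborel v" "\<And>x. x \<notin> closure \<Omega> \<Longrightarrow> v x = 0"
    and g: "\<And>j. integrable lborel (g j)" "\<And>j x. \<bar>g j x\<bar> \<le> B"
    and weak: "\<And>j \<phi>. \<phi> \<in> test_functions UNIV \<Longrightarrow>
      (LINT x|lborel. v x * partial_deriv j \<phi> x) = - (LINT x|lborel. g j x * \<phi> x)"
    and shift: "\<And>j y. (\<integral>\<^sup>+x. ennreal ((g j (x - y) - g j x)\<^sup>2) \<partial>lborel) \<le> ennreal (C * norm y powr (2 * r))"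
    and C: "C \<ge> 0" and r: "0 < r" "r \<le> 1/2"
  obtains Q \<epsilon>\<^sub>2 where "Q \<ge> 0" "\<epsilon>\<^sub>2 > 0" "\<And>\<epsilon>. 0 < \<epsilon> \<Longrightarrow> \<epsilon> < \<epsilon>\<^sub>2 \<Longrightarrow> \<exists>w w' w''.
      has_partials w w' \<and> (\<forall>j. has_partials (w' j) (w'' j)) \<and> (\<forall>j k. continuous_on UNIV (w'' j k)) \<and>
      (\<forall>j x. x \<notin> \<Omega> \<longrightarrow> w' j x = 0) \<and>
      (\<forall>j. (\<integral>\<^sup>+x\<in>\<Omega>. ennreal ((w' j x - g j x)\<^sup>2) \<partial>lborel) \<le> ennreal (Q * \<epsilon> powr (2 * r))) \<and>
      (\<forall>j k. ennreal (\<epsilon>\<^sup>2) * (\<integral>\<^sup>+x\<in>\<Omega>. ennreal ((w'' j k x)\<^sup>2) \<partial>lborel) \<le> ennreal (Q * \<epsilon> powr (2 * r)))"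
proof -
  obtain K where K: "K \<ge> 0" and moll: "\<And>\<epsilon>. \<epsilon> > 0 \<Longrightarrow> \<exists>\<rho> :: real^'n \<Rightarrow> real. kernel \<epsilon> \<rho> \<and> (\<forall>x. \<rho> x \<ge> 0) \<and>
     (LINT x|lborel. \<rho> x) = 1 \<and> (\<forall>i. (LINT x|lborel. \<bar>partial_deriv i \<rho> x\<bar>) \<le> K / \<epsilon>) \<and>
     (\<forall>i j. (LINT x|lborel. \<bar>partial_deriv j (partial_deriv i \<rho>) x\<bar>) \<le> K / \<epsilon>\<^sup>2)"
    using mollifier by blast
  obtain A L \<epsilon>\<^sub>1 where A: "A \<ge> 0" and L: "L \<ge> 0" and \<epsilon>1: "\<epsilon>\<^sub>1 > 0"
    and layer: "\<And>\<epsilon>. 0 < \<epsilon> \<Longrightarrow> \<epsilon> < \<epsilon>\<^sub>1 \<Longrightarrow> thin_layer \<Omega> (frontier \<Omega>) A L \<epsilon>"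
    using thin unfolding thin_at_def by blast
  have [measurable]: "g j \<in> borel_measurable borel" for j using g(1)[of j] by auto
  have B: "B \<ge> 0" by (rule order_trans[OF abs_ge_zero g(2)])
  \<comment> \<open>Makes the distance to the complement attained at a point; \<open>infdist\<close>
    to the empty set would be 0 by convention.\<close>
  have ne: "- \<Omega> \<noteq> {}" using \<Omega>(2) not_bounded_UNIV by (metis Compl_empty_eq double_complement)
  \<comment> \<open>Lipschitz constant of the mollified \<open>v\<close> times the factor 3 + 3 * L:
    a point of the layer lies within (3 + 3 * L) * \<epsilon> of an exterior point where the
    mollified \<open>v\<close> is zero.\<close>
  define V where "V = CARD('n) * B * (3 + 3 * L)"
  \<comment> \<open>Bound for \<open>w' - g\<close> in the layer: (K / \<epsilon>) * (V *
    \<epsilon>) from the derivative of the cutoff, \<open>B\<close> from the mollified gradient and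
    \<open>B\<close> from \<open>g\<close>.\<close>
  define D1 where "D1 = K * V + B + B"
  \<comment> \<open>All four products in \<open>w''\<close> are of order 1/\<epsilon>: one is (K /
    \<epsilon>^2) * (V * \<epsilon>), the other three are K * B / \<epsilon>.\<close>
  define D2 where "D2 = K * V + 3 * K * B"
  have V: "V \<ge> 0" unfolding V_def using B L by simp
  define Q where "Q = D1\<^sup>2 * (3 * A) + C + (D2\<^sup>2 * (3 * A) + K\<^sup>2 * C)"
  have Q1: "D1\<^sup>2 * (3 * A) + C \<le> Q" "D2\<^sup>2 * (3 * A) + K\<^sup>2 * C \<le> Q" "Q \<ge> 0"
    unfolding Q_def using A C by auto
  show thesis
  \<comment> \<open>The layer is used at width 3 * \<epsilon>, hence the third; \<epsilon> < 1 is
    needed to compare \<epsilon> with its power.\<close>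
  proof (rule that[of Q "min 1 (\<epsilon>\<^sub>1 / 3)"])
    show "Q \<ge> 0" by (rule Q1)
    show "min 1 (\<epsilon>\<^sub>1 / 3) > 0" using \<epsilon>1 by simp
    fix \<epsilon> assume \<epsilon>0: "0 < \<epsilon>" and \<epsilon>2: "\<epsilon> < min 1 (\<epsilon>\<^sub>1 / 3)"
    have thin3: "thin_layer \<Omega> (frontier \<Omega>) A L (3 * \<epsilon>)" using \<epsilon>0 \<epsilon>2 by (intro layer) auto
    obtain T where T: "T \<in> sets borel" "{x. \<exists>q\<in>frontier \<Omega>. dist x q \<le> 3 * \<epsilon>} \<subseteq> T" "emeasure lborel T \<le> ennreal (A * (3 * \<epsilon>))"
      using thin3 unfolding thin_layer_def by blast
    obtain \<rho> :: "real^'n \<Rightarrow> real" where \<rho>: "kernel \<epsilon> \<rho>" "\<And>x. \<rho> x \<ge> 0" "(LINT x|lborel. \<rho> x) = 1"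
      "\<And>i. (LINT x|lborel. \<bar>partial_deriv i \<rho> x\<bar>) \<le> K / \<epsilon>"
      "\<And>i j. (LINT x|lborel. \<bar>partial_deriv j (partial_deriv i \<rho>) x\<bar>) \<le> K / \<epsilon>\<^sup>2"
      using moll[OF \<epsilon>0] by blast
    let ?d = "\<lambda>i. partial_deriv i \<rho>" and ?dd = "\<lambda>i j. partial_deriv j (partial_deriv i \<rho>)"
    have kd: "kernel \<epsilon> (?d i)" "kernel \<epsilon> (?dd i j)" for i j by (intro kernel_partial_deriv \<rho>(1))+
    have abs\<rho>: "(LINT x|lborel. \<bar>\<rho> x\<bar>) = 1" using \<rho>(2,3) by simp
    \<comment> \<open>At depth 2 * \<epsilon>, mollification at scale \<epsilon> still vanishes
      outside \<Omega> and already equals 1 where the frontier is more than 3 * \<epsilon>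
      away.\<close>
    define S where "S = {x. infdist x (- \<Omega>) > 2 * \<epsilon>}"
    define f :: "real^'n \<Rightarrow> real" where "f = indicator S"
    have [measurable]: "(\<lambda>x. infdist x (- \<Omega>)) \<in> borel_measurable borel"
      by (intro borel_measurable_continuous_onI continuous_on_infdist continuous_on_id)
    have "S \<in> sets borel" unfolding S_def by measurable
    have S\<Omega>: "S \<subseteq> \<Omega>"
    proof
      fix x assume "x \<in> S"
      then have "infdist x (- \<Omega>) \<noteq> 0" unfolding S_def using \<epsilon>0 by auto
      then show "x \<in> \<Omega>" using infdist_zero[of x "- \<Omega>"] by blast
    qed
    have fi: "integrable lborel f"
    proof -
      have "bounded S" using S\<Omega> \<Omega>(2) bounded_subset by blast
      from emeasure_bounded_finite[OF this] show ?thesis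
        unfolding f_def using \<open>S \<in> sets borel\<close> by (intro integrable_real_indicator) auto
    qed
    have f1: "\<bar>f x\<bar> \<le> 1" for x unfolding f_def by (simp add: indicator_def)
    define ve where "ve = conv v \<rho>"
    define ge where "ge j = conv (g j) \<rho>" for j
    define gd where "gd j k = conv (g j) (?d k)" for j k
    define z where "z = conv f \<rho>"
    define z1 where "z1 j = conv f (?d j)" for j
    define z2 where "z2 j k = conv f (?dd j k)" for j k
    \<comment> \<open>The derivative moves from the kernel onto \<open>v\<close>: the partials of
      the mollified \<open>v\<close> are mollified \<open>g\<close>, so they inherit the bound
      \<open>B\<close>.\<close>
    have p_ve: "has_partials ve ge"
      using conv_has_partials[OF v(1) \<rho>(1)] conv_weak_partial[OF weak \<rho>(1)] unfolding ve_def ge_def by simp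
    have p_ge: "has_partials (ge j) (gd j)" for j
      using conv_has_partials[OF g(1) \<rho>(1)] unfolding ge_def gd_def .
    have p_z: "has_partials z z1" using conv_has_partials[OF fi \<rho>(1)] unfolding z_def z1_def .
    have p_z1: "has_partials (z1 j) (z2 j)" for j using conv_has_partials[OF fi kd(1)] unfolding z1_def z2_def .
    define w where "w x = z x * ve x" for x
    define w' where "w' j x = z1 j x * ve x + z x * ge j x" for j x
    define w'' where "w'' j k x = (z2 j k x * ve x + z1 j x * ge k x) + (z1 k x * ge j x + z x * gd j k x)" for j k x
    have "has_partials w w'"
      using has_partials_mult[OF p_z p_ve] unfolding w_def[abs_def] w'_def[abs_def] .
    moreover have "has_partials (w' j) (w'' j)" for j
      using has_partials_add[OF has_partials_mult[OF p_z1 p_ve] has_partials_mult[OF p_z p_ge]]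
      unfolding w'_def[abs_def] w''_def[abs_def] .
    moreover have "continuous_on UNIV (w'' j k)" for j k
    proof -
      have "continuous_on UNIV (z2 j k)" "continuous_on UNIV (gd j k)"
        unfolding z2_def gd_def
        by (rule has_partials_continuous[OF conv_has_partials[OF fi kd(2)]],
            rule has_partials_continuous[OF conv_has_partials[OF g(1) kd(1)]])
      then show ?thesis
        unfolding w''_def[abs_def]
        using has_partials_continuous[OF p_ve] has_partials_continuous[OF p_ge]
          has_partials_continuous[OF p_z] has_partials_continuous[OF p_z1]
        by (intro continuous_on_add continuous_on_mult) auto
    qed
    moreover have vanish: "w' j x = 0" if "x \<notin> \<Omega>" for j x
    proof -
      have "f y = 0" if "dist x y \<le> \<epsilon>" for y
      proof -
        have "infdist y (- \<Omega>) \<le> dist y x" using \<open>x \<notin> \<Omega>\<close> by (intro infdist_le) auto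
        then show ?thesis using that \<epsilon>0 unfolding f_def S_def by (simp add: dist_commute)
      qed
      then have "z1 j x = 0" "z x = 0" for j
        unfolding z1_def z_def using conv_locally_const[OF kd(1), of x f 0] conv_locally_const[OF \<rho>(1), of x f 0] by auto
      then show ?thesis unfolding w'_def by simp
    qed
    have deep: "w' j x = ge j x \<and> w'' j k x = gd j k x"
      if x: "x \<in> \<Omega>" "\<not> (\<exists>q\<in>frontier \<Omega>. dist x q \<le> 3 * \<epsilon>)" for j k x
    proof -
      \<comment> \<open>A ball is connected: meeting \<Omega> without being contained in it, it
        would meet the frontier.\<close>
      have cb: "cball x (3 * \<epsilon>) \<subseteq> \<Omega>"
      proof (rule ccontr)
        assume "\<not> cball x (3 * \<epsilon>) \<subseteq> \<Omega>"
        moreover have "x \<in> cball x (3 * \<epsilon>)" using \<epsilon>0 by simp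
        then have "cball x (3 * \<epsilon>) \<inter> \<Omega> \<noteq> {}" using x(1) by blast
        moreover have "connected (cball x (3 * \<epsilon>))" by (intro convex_connected convex_cball)
        ultimately have "cball x (3 * \<epsilon>) \<inter> frontier \<Omega> \<noteq> {}"
          using \<open>cball x (3 * \<epsilon>) \<inter> \<Omega> \<noteq> {}\<close> by (intro connected_Int_frontier) auto
        then show False using x by auto
      qed
      have "f y = 1" if y: "dist x y \<le> \<epsilon>" for y
      proof -
        have "closed (- \<Omega>)" using \<Omega>(1) by (simp add: closed_Compl)
        from infdist_attains_inf[OF this ne, of y] obtain q where q: "q \<in> - \<Omega>" "infdist y (- \<Omega>) = dist y q" by blast
        have "dist x q > 3 * \<epsilon>" using q cb by force
        then have "dist y q > 2 * \<epsilon>" using y dist_triangle[of x q y] by linarith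
        then show ?thesis unfolding f_def S_def using q by simp
      qed
      then have "z x = 1" "z1 j x = 0" "z2 j k x = 0" for j k
        unfolding z1_def z_def z2_def
        using conv_locally_const[OF \<rho>(1), of x f 1] conv_locally_const[OF kd(1), of x f 1]
          conv_locally_const[OF kd(2), of x f 1] \<rho>(3) kernel_integral_partial[OF \<rho>(1)] kernel_integral_partial[OF kd(1)]
        by auto
      then show ?thesis unfolding w'_def w''_def by simp
    qed
    have near: "\<bar>ve x\<bar> \<le> V * \<epsilon>" if x: "\<exists>q\<in>frontier \<Omega>. dist x q \<le> 3 * \<epsilon>" for x
    proof -
      obtain q where q: "q \<in> frontier \<Omega>" "dist x q \<le> 3 * \<epsilon>" using x by blast
      then obtain y where y: "dist y q \<le> L * (3 * \<epsilon>)" "cball y (3 * \<epsilon>) \<inter> closure \<Omega> = {}"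
        using thin3 unfolding thin_layer_def by blast
      \<comment> \<open>The exterior ball has radius 3 * \<epsilon>, the kernel only radius
        \<epsilon>, so the mollified \<open>v\<close> vanishes at the centre
        \<open>y\<close>.\<close>
      have "v t = 0" if "dist y t \<le> \<epsilon>" for t
      proof (rule v(2))
        have "t \<in> cball y (3 * \<epsilon>)" using that \<epsilon>0 by simp
        then show "t \<notin> closure \<Omega>" using y(2) by blast
      qed
      then have "ve y = 0" unfolding ve_def using conv_locally_const[OF \<rho>(1), of y v 0] by simp
      moreover have "\<bar>ve (y + (x - y)) - ve y\<bar> \<le> CARD('n) * B * norm (x - y)"
      proof (rule has_partials_lipschitz[OF p_ve])
        show "\<bar>ge i x\<bar> \<le> B" for i x
          using conv_bound[OF g(2) g(1) \<rho>(1)] unfolding ge_def abs\<rho> by simp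
      qed
      moreover have "norm (x - y) \<le> (3 + 3 * L) * \<epsilon>"
        using dist_triangle[of x y q] q(2) y(1) by (simp add: dist_norm norm_minus_commute algebra_simps)
      then have "CARD('n) * B * norm (x - y) \<le> CARD('n) * B * ((3 + 3 * L) * \<epsilon>)"
        by (rule mult_left_mono) (use B in simp)
      ultimately have "\<bar>ve x\<bar> \<le> CARD('n) * B * ((3 + 3 * L) * \<epsilon>)"
        by (simp only: add_diff_cancel_left' diff_add_cancel add.commute[of y] diff_zero)
      then show ?thesis unfolding V_def by (simp only: mult.assoc)
    qed
    have ge_b: "\<bar>ge j x\<bar> \<le> B" for j x
      using conv_bound[OF g(2) g(1) \<rho>(1)] unfolding ge_def abs\<rho> by simp
    have gd_b: "\<bar>gd j k x\<bar> \<le> B * (K / \<epsilon>)" for j k x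
      using conv_bound[OF g(2) g(1) kd(1)] mult_left_mono[OF \<rho>(4) B] unfolding gd_def by (rule order_trans)
    have z_b: "\<bar>z x\<bar> \<le> 1" for x
      using conv_bound[OF f1 fi \<rho>(1)] unfolding z_def abs\<rho> by simp
    have z1_b: "\<bar>z1 j x\<bar> \<le> K / \<epsilon>" for j x
      using order_trans[OF conv_bound[OF f1 fi kd(1)[of j], of x]] \<rho>(4)[of j] unfolding z1_def by simp
    have z2_b: "\<bar>z2 j k x\<bar> \<le> K / \<epsilon>\<^sup>2" for j k x
      using order_trans[OF conv_bound[OF f1 fi kd(2)[of k j], of x]] \<rho>(5)[of k j] unfolding z2_def by simp
    have K\<epsilon>: "K / \<epsilon> \<ge> 0" "K / \<epsilon>\<^sup>2 \<ge> 0" using K \<epsilon>0 by auto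
    have shell: "\<bar>w' j x - g j x\<bar> \<le> D1" "\<bar>w'' j k x\<bar> \<le> D2 / \<epsilon>" if x: "\<exists>q\<in>frontier \<Omega>. dist x q \<le> 3 * \<epsilon>" for j k x
    proof -
      note ve = near[OF x]
      have 1: "\<bar>z1 j x * ve x\<bar> \<le> (K / \<epsilon>) * (V * \<epsilon>)" unfolding abs_mult by (intro mult_mono z1_b ve K\<epsilon>) auto
      have 2: "\<bar>z x * ge j x\<bar> \<le> 1 * B" unfolding abs_mult by (intro mult_mono z_b ge_b) auto
      have "\<bar>w' j x - g j x\<bar> \<le> (K / \<epsilon>) * (V * \<epsilon>) + 1 * B + B"
        using 1 2 g(2)[of j x] unfolding w'_def by linarith
      then show "\<bar>w' j x - g j x\<bar> \<le> D1" unfolding D1_def using \<epsilon>0 by simp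
      have 3: "\<bar>z2 j k x * ve x\<bar> \<le> (K / \<epsilon>\<^sup>2) * (V * \<epsilon>)" unfolding abs_mult by (intro mult_mono z2_b ve K\<epsilon>) auto
      have 4: "\<bar>z1 j x * ge k x\<bar> \<le> (K / \<epsilon>) * B" unfolding abs_mult by (intro mult_mono z1_b ge_b K\<epsilon>) auto
      have 5: "\<bar>z1 k x * ge j x\<bar> \<le> (K / \<epsilon>) * B" unfolding abs_mult by (intro mult_mono z1_b ge_b K\<epsilon>) auto
      have 6: "\<bar>z x * gd j k x\<bar> \<le> 1 * (B * (K / \<epsilon>))" unfolding abs_mult by (intro mult_mono z_b gd_b) auto
      have "\<bar>w'' j k x\<bar> \<le> (K / \<epsilon>\<^sup>2) * (V * \<epsilon>) + (K / \<epsilon>) * B + (K / \<epsilon>) * B + 1 * (B * (K / \<epsilon>))"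
        using 3 4 5 6 unfolding w''_def by linarith
      also have "\<dots> = D2 / \<epsilon>" unfolding D2_def using \<epsilon>0 by (simp add: field_simps power2_eq_square)
      finally show "\<bar>w'' j k x\<bar> \<le> D2 / \<epsilon>" .
    qed
    \<comment> \<open>The condition r \<le> 1/2 enters here: it lets the layer volume, of order
      \<epsilon>, be absorbed into the target rate.\<close>
    have \<epsilon>r: "\<epsilon> \<le> \<epsilon> powr (2 * r)"
      using powr_mono'[of "2 * r" 1 \<epsilon>] r \<epsilon>0 \<epsilon>2 by simp
    have shift': "(\<integral>\<^sup>+x. ennreal ((g j (x - y) - g j x)\<^sup>2) \<partial>lborel) \<le> ennreal (C * \<epsilon> powr (2 * r))" if "norm y \<le> \<epsilon>" for j y
      using shift[of j y] that r C
      by (elim order_trans) (intro ennreal_leI mult_left_mono powr_mono2, auto)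
    have ge_m [measurable]: "ge j \<in> borel_measurable borel" "gd j k \<in> borel_measurable borel" for j k
      using has_partials_continuous[OF p_ge[of j]] has_partials_continuous[OF conv_has_partials[OF g(1) kd(1)]]
      unfolding gd_def by (auto intro: borel_measurable_continuous_onI)
    have split: "x \<in> T \<and> \<bar>w' j x - g j x\<bar> \<le> D1 \<or> w' j x - g j x = ge j x - g j x"
      "x \<in> T \<and> \<bar>w'' j k x\<bar> \<le> D2 / \<epsilon> \<or> w'' j k x = gd j k x" if "x \<in> \<Omega>" for j k x
    proof (atomize (full), cases "\<exists>q\<in>frontier \<Omega>. dist x q \<le> 3 * \<epsilon>")
      case True
      then have "x \<in> T" using T(2) by blast
      then show "(x \<in> T \<and> \<bar>w' j x - g j x\<bar> \<le> D1 \<or> w' j x - g j x = ge j x - g j x) \<and>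
        (x \<in> T \<and> \<bar>w'' j k x\<bar> \<le> D2 / \<epsilon> \<or> w'' j k x = gd j k x)"
        using shell[OF True] by blast
    next
      case False
      then show "(x \<in> T \<and> \<bar>w' j x - g j x\<bar> \<le> D1 \<or> w' j x - g j x = ge j x - g j x) \<and>
        (x \<in> T \<and> \<bar>w'' j k x\<bar> \<le> D2 / \<epsilon> \<or> w'' j k x = gd j k x)"
        using deep[OF that False] by simp
    qed
    note vanish
    moreover have "(\<integral>\<^sup>+x\<in>\<Omega>. ennreal ((w' j x - g j x)\<^sup>2) \<partial>lborel) \<le> ennreal (Q * \<epsilon> powr (2 * r))" for j
    proof -
      have "(\<integral>\<^sup>+x\<in>\<Omega>. ennreal ((w' j x - g j x)\<^sup>2) \<partial>lborel) \<le> ennreal (D1\<^sup>2 * (A * (3 * \<epsilon>)) + C * \<epsilon> powr (2 * r))"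
      proof (rule nn_integral_layer_split[where h = "\<lambda>x. ge j x - g j x", OF T(1,3) _ _ split(1)])
        show "(\<integral>\<^sup>+x. ennreal ((ge j x - g j x)\<^sup>2) \<partial>lborel) \<le> ennreal (C * \<epsilon> powr (2 * r))"
          using conv_L2_modulus[OF g(1)[of j] \<rho>(1) shift'] unfolding \<rho>(3) abs\<rho> ge_def by simp
      qed (use A C \<epsilon>0 in auto)
      also have "\<dots> \<le> ennreal (Q * \<epsilon> powr (2 * r))"
      proof (rule ennreal_leI)
        have "D1\<^sup>2 * (A * (3 * \<epsilon>)) = D1\<^sup>2 * (3 * A) * \<epsilon>" by simp
        also have "\<dots> \<le> D1\<^sup>2 * (3 * A) * \<epsilon> powr (2 * r)" using A by (intro mult_left_mono \<epsilon>r) auto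
        finally have "D1\<^sup>2 * (A * (3 * \<epsilon>)) + C * \<epsilon> powr (2 * r) \<le> (D1\<^sup>2 * (3 * A) + C) * \<epsilon> powr (2 * r)"
          by (simp only: distrib_right add_right_mono)
        also have "\<dots> \<le> Q * \<epsilon> powr (2 * r)" by (intro mult_right_mono Q1) auto
        finally show "D1\<^sup>2 * (A * (3 * \<epsilon>)) + C * \<epsilon> powr (2 * r) \<le> Q * \<epsilon> powr (2 * r)" .
      qed
      finally show ?thesis .
    qed
    moreover have "ennreal (\<epsilon>\<^sup>2) * (\<integral>\<^sup>+x\<in>\<Omega>. ennreal ((w'' j k x)\<^sup>2) \<partial>lborel) \<le> ennreal (Q * \<epsilon> powr (2 * r))" for j k
    proof -
      have "(\<integral>\<^sup>+x\<in>\<Omega>. ennreal ((w'' j k x)\<^sup>2) \<partial>lborel)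
          \<le> ennreal ((D2 / \<epsilon>)\<^sup>2 * (A * (3 * \<epsilon>)) + (K / \<epsilon>)\<^sup>2 * (C * \<epsilon> powr (2 * r)))"
      proof (rule nn_integral_layer_split[where h = "gd j k", OF T(1,3) _ _ split(2)])
        \<comment> \<open>The kernel is now a derivative of the mollifier with mean zero, so the
          term subtracted in \<open>conv_L2_modulus\<close> disappears and \<open>gd\<close> itself
          is estimated.\<close>
        have "(\<integral>\<^sup>+x. ennreal ((gd j k x)\<^sup>2) \<partial>lborel)
            \<le> ennreal ((LINT y|lborel. \<bar>?d k y\<bar>)\<^sup>2) * ennreal (C * \<epsilon> powr (2 * r))"
          using conv_L2_modulus[OF g(1)[of j] kd(1) shift']
          unfolding kernel_integral_partial[OF \<rho>(1)] gd_def by simp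
        also have "\<dots> \<le> ennreal ((K / \<epsilon>)\<^sup>2) * ennreal (C * \<epsilon> powr (2 * r))"
          by (intro mult_right_mono ennreal_leI power_mono \<rho>(4)) auto
        finally show "(\<integral>\<^sup>+x. ennreal ((gd j k x)\<^sup>2) \<partial>lborel) \<le> ennreal ((K / \<epsilon>)\<^sup>2 * (C * \<epsilon> powr (2 * r)))"
          using C by (simp add: ennreal_mult)
      qed (use A C \<epsilon>0 in auto)
      then have "ennreal (\<epsilon>\<^sup>2) * (\<integral>\<^sup>+x\<in>\<Omega>. ennreal ((w'' j k x)\<^sup>2) \<partial>lborel)
          \<le> ennreal (\<epsilon>\<^sup>2) * ennreal ((D2 / \<epsilon>)\<^sup>2 * (A * (3 * \<epsilon>)) + (K / \<epsilon>)\<^sup>2 * (C * \<epsilon> powr (2 * r)))"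
        by (rule mult_left_mono) simp
      also have "\<dots> = ennreal (\<epsilon>\<^sup>2 * ((D2 / \<epsilon>)\<^sup>2 * (A * (3 * \<epsilon>)) + (K / \<epsilon>)\<^sup>2 * (C * \<epsilon> powr (2 * r))))"
        using A C \<epsilon>0 by (intro ennreal_mult[symmetric]) auto
      also have "\<dots> \<le> ennreal (Q * \<epsilon> powr (2 * r))"
      proof (rule ennreal_leI)
        have "\<epsilon>\<^sup>2 * ((D2 / \<epsilon>)\<^sup>2 * (A * (3 * \<epsilon>)) + (K / \<epsilon>)\<^sup>2 * (C * \<epsilon> powr (2 * r)))
          = D2\<^sup>2 * (3 * A) * \<epsilon> + K\<^sup>2 * C * \<epsilon> powr (2 * r)"
          using \<epsilon>0 by (simp add: power_divide distrib_left)
        also have "\<dots> \<le> D2\<^sup>2 * (3 * A) * \<epsilon> powr (2 * r) + K\<^sup>2 * C * \<epsilon> powr (2 * r)"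
          using A by (intro add_right_mono mult_left_mono \<epsilon>r) auto
        also have "\<dots> = (D2\<^sup>2 * (3 * A) + K\<^sup>2 * C) * \<epsilon> powr (2 * r)" by (simp only: distrib_right)
        also have "\<dots> \<le> Q * \<epsilon> powr (2 * r)" by (intro mult_right_mono Q1) auto
        finally show "\<epsilon>\<^sup>2 * ((D2 / \<epsilon>)\<^sup>2 * (A * (3 * \<epsilon>)) + (K / \<epsilon>)\<^sup>2 * (C * \<epsilon> powr (2 * r))) \<le> Q * \<epsilon> powr (2 * r)" .
      qed
      finally show ?thesis .
    qed
    ultimately show "\<exists>w w' w''.
      has_partials w w' \<and> (\<forall>j. has_partials (w' j) (w'' j)) \<and> (\<forall>j k. continuous_on UNIV (w'' j k)) \<and>
      (\<forall>j x. x \<notin> \<Omega> \<longrightarrow> w' j x = 0) \<and>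
      (\<forall>j. (\<integral>\<^sup>+x\<in>\<Omega>. ennreal ((w' j x - g j x)\<^sup>2) \<partial>lborel) \<le> ennreal (Q * \<epsilon> powr (2 * r))) \<and>
      (\<forall>j k. ennreal (\<epsilon>\<^sup>2) * (\<integral>\<^sup>+x\<in>\<Omega>. ennreal ((w'' j k x)\<^sup>2) \<partial>lborel) \<le> ennreal (Q * \<epsilon> powr (2 * r)))"
      by (intro exI[of _ w] exI[of _ w'] exI[of _ w''] conjI allI impI) blast+
  qed
qed

section \<open>Weak derivatives and representatives\<close>

text \<open>The rows of an orthogonal matrix are unit vectors.\<close>

lemma bounded_SO: "bounded (SO :: (real^'n::finite^'n) set)"
proof -
  have "norm Q \<le> CARD('n)" if "Q \<in> SO" for Q :: "real^'n^'n"
  proof -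
    have "orthogonal_matrix Q" using that unfolding SO_def rotation_matrix_def by simp
    then have "norm (row i Q) = 1" for i by (simp add: orthogonal_matrix_orthonormal_rows)
    then have row: "norm (Q $ i) = 1" for i by (simp add: row_def)
    have "norm Q \<le> (\<Sum>i\<in>UNIV. norm (Q $ i))"
      unfolding norm_vec_def[of Q] by (rule L2_set_le_sum) simp
    then show ?thesis by (simp add: row)
  qed
  then show ?thesis unfolding bounded_iff by blast
qed

text \<open>Turns the inclusion \<open>G x \<in> K\<close> into a uniform bound on the gradient.
  Each well is the image of a bounded set under a linear map, and there are finitely many.\<close>

lemma bounded_energy_wells: "bounded (energy_wells \<alpha> \<theta>\<^sub>c m U \<theta>)"
proof -
  have "bounded_linear (\<lambda>Q::real^'n^'n. Q ** A)" for A :: "real^'n^'n"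
    by (intro linear_conv_bounded_linear[THEN iffD1] linearI)
      (simp_all add: matrix_matrix_mult_def vec_eq_iff sum.distrib distrib_right sum_distrib_left mult.assoc)
  then have "bounded ((\<lambda>Q::real^'n^'n. Q ** A) ` SO)" for A :: "real^'n^'n"
    using bounded_linear_image[OF bounded_SO] by blast
  then show ?thesis
    unfolding energy_wells_def
    using bounded_linear_image[OF bounded_SO bounded_linear_scaleR_right, of "\<alpha> \<theta>"] by auto
qed

section \<open>Local integrability and classical weak derivatives\<close>

lemma locally_integrable_measurable:
  assumes "locally_integrable UNIV f"
  shows "f \<in> borel_measurable lebesgue"
proof (rule borel_measurable_LIMSEQ_real)
  show "(\<lambda>n. indicator (cball 0 (real n)) x * f x) \<longlonglongrightarrow> f x" for x
  proof (rule tendsto_eventually)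
    show "eventually (\<lambda>n. indicator (cball 0 (real n)) x * f x = f x) sequentially"
      using eventually_ge_at_top[of "nat \<lceil>norm x\<rceil>"]
    proof eventually_elim
      case (elim n)
      then have "norm x \<le> real n" by linarith
      then show ?case by simp
    qed
  qed
  show "(\<lambda>x. indicator (cball 0 (real n)) x * f x) \<in> borel_measurable lebesgue" for n
    using assms unfolding locally_integrable_def set_integrable_def by (auto dest!: spec[of _ "cball 0 (real n)"])
qed

lemma locally_integrable_mult_kernel:
  assumes f: "locally_integrable UNIV f" and k: "kernel R \<kappa>"
  shows "integrable lebesgue (\<lambda>x. f x * \<kappa> x)"
proof -
  obtain B where B: "B > 0" "\<And>x. norm (\<kappa> x) \<le> B" using kernel_bounded[OF k] by blast
  have [measurable]: "\<kappa> \<in> borel_measurable lebesgue" "f \<in> borel_measurable lebesgue"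
    using kernel_measurable[OF k] locally_integrable_measurable[OF f] by (auto intro: measurable_completion)
  have "integrable lebesgue (\<lambda>x. B * (indicator (cball 0 R) x *\<^sub>R f x))"
    using f unfolding locally_integrable_def set_integrable_def by (intro integrable_mult_right) auto
  then show ?thesis
  proof (rule Bochner_Integration.integrable_bound)
    show "AE x in lebesgue. norm (f x * \<kappa> x) \<le> norm (B * (indicator (cball 0 R) x *\<^sub>R f x))"
    proof (intro AE_I2)
      fix x show "norm (f x * \<kappa> x) \<le> norm (B * (indicator (cball 0 R) x *\<^sub>R f x))"
        using B k mult_left_mono[OF B(2)[of x], of "\<bar>f x\<bar>"]
        by (cases "norm x > R") (auto simp: kernel_def abs_mult mult.commute indicator_def)
    qed
  qed simp
qed

lemma continuous_measurable_lebesgue: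
  fixes f :: "'a::euclidean_space \<Rightarrow> 'b::euclidean_space"
  assumes "continuous_on UNIV f"
  shows "f \<in> borel_measurable lebesgue"
  using borel_measurable_continuous_onI[OF assms] by (intro measurable_completion) simp

lemma continuous_locally_integrable:
  assumes "continuous_on UNIV f"
  shows "locally_integrable S f"
  unfolding locally_integrable_def set_integrable_def
proof (intro allI impI)
  fix C assume "compact C \<and> C \<subseteq> S"
  then have i: "integrable lborel (\<lambda>x. indicator C x *\<^sub>R f x)"
    using assms continuous_on_subset by (intro borel_integrable_compact) auto
  then show "integrable lebesgue (\<lambda>x. indicator C x *\<^sub>R f x)"
    by (subst integrable_completion) (auto dest: borel_measurable_integrable)
qed

lemma continuous_L2_on:
  fixes f :: "real^'n::finite \<Rightarrow> 'b::euclidean_space"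
  assumes f: "continuous_on UNIV f" and S: "bounded S" "S \<in> sets lebesgue"
  shows "L2_on S f"
proof -
  have [measurable]: "f \<in> borel_measurable lebesgue" by (rule continuous_measurable_lebesgue[OF f])
  have n: "continuous_on UNIV (\<lambda>x. (norm (f x))\<^sup>2)" by (intro continuous_intros f)
  have [measurable]: "(\<lambda>x. (norm (f x))\<^sup>2) \<in> borel_measurable lebesgue" by (rule continuous_measurable_lebesgue[OF n])
  note [measurable] = S(2)
  obtain R where "\<And>x. x \<in> S \<Longrightarrow> norm x \<le> R" using S(1) unfolding bounded_iff by blast
  then have R: "S \<subseteq> cball 0 R" by auto
  have "integrable lebesgue (\<lambda>x. indicator (cball 0 R) x *\<^sub>R (norm (f x))\<^sup>2)"
    using continuous_locally_integrable[OF n, of UNIV] unfolding locally_integrable_def set_integrable_def by auto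
  then have "integrable lebesgue (\<lambda>x. indicator S x *\<^sub>R (norm (f x))\<^sup>2)"
    by (rule Bochner_Integration.integrable_bound) (use R in \<open>auto simp: indicator_def intro!: AE_I2\<close>)
  then show ?thesis
    unfolding L2_on_def set_integrable_def set_borel_measurable_def by simp
qed

lemma continuous_L2_loc:
  fixes f :: "real^'n::finite \<Rightarrow> 'b::euclidean_space"
  assumes "continuous_on UNIV f"
  shows "L2_loc f"
  unfolding L2_loc_def using continuous_L2_on[OF assms] compact_imp_bounded
  by (meson fmeasurableD lmeasurable_compact)

text \<open>A test function and its derivatives vanish outside a support contained in
  \<open>S\<close>, so integrals over \<open>S\<close> are integrals over the whole space and
  integration by parts applies.\<close>

lemma C1_has_weak_partial:
  fixes f :: "real^'n::finite \<Rightarrow> real"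
  assumes f: "has_partials f f'" and c: "continuous_on UNIV (f' j)"
  shows "has_weak_partial S j f (f' j)"
  unfolding has_weak_partial_def
proof (intro conjI ballI)
  have cf: "continuous_on UNIV f" using f by (rule has_partials_continuous)
  show "locally_integrable S f" "locally_integrable S (f' j)"
    by (rule continuous_locally_integrable[OF cf], rule continuous_locally_integrable[OF c])
  fix \<phi> assume \<phi>: "\<phi> \<in> test_functions S"
  obtain R where k: "kernel R \<phi>" using test_function_kernel[OF \<phi>] by blast
  note [measurable] = borel_measurable_continuous_onI[OF cf] borel_measurable_continuous_onI[OF c]
    kernel_measurable[OF k] kernel_measurable[OF kernel_partial_deriv[OF k, of j]]
  let ?C = "closure {x. \<phi> x \<noteq> 0}"
  have C: "?C \<subseteq> S" using \<phi> unfolding test_functions_def by blast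
  have 0: "\<phi> x = 0" if "x \<notin> ?C" for x using that closure_subset[of "{x. \<phi> x \<noteq> 0}"] by blast
  have 1: "partial_deriv j \<phi> x = 0" if "x \<notin> ?C" for x
    by (rule has_partials_vanish[OF kernel_has_partials[OF k] closed_closure 0 that])
  have ind0: "indicator S x *\<^sub>R (f' j x * \<phi> x) = f' j x * \<phi> x" for x
    using C 0[of x] by (cases "x \<in> S") auto
  have ind1: "indicator S x *\<^sub>R (f x * partial_deriv j \<phi> x) = f x * partial_deriv j \<phi> x" for x
    using C 1[of x] by (cases "x \<in> S") auto
  have "(LINT x:S|lebesgue. f x * partial_deriv j \<phi> x) = (LINT x|lebesgue. f x * partial_deriv j \<phi> x)"
    unfolding set_lebesgue_integral_def ind1 ..
  also have "\<dots> = (LINT x|lborel. f x * partial_deriv j \<phi> x)"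
    by (rule integral_completion) measurable
  also have "\<dots> = - (LINT x|lborel. f' j x * \<phi> x)" by (rule integration_by_parts[OF f c k])
  also have "(LINT x|lborel. f' j x * \<phi> x) = (LINT x|lebesgue. f' j x * \<phi> x)"
    by (rule integral_completion[symmetric]) measurable
  also have "\<dots> = (LINT x:S|lebesgue. f' j x * \<phi> x)"
    unfolding set_lebesgue_integral_def ind0 ..
  finally show "(LINT x:S|lebesgue. f x * partial_deriv j \<phi> x) = - (LINT x:S|lebesgue. f' j x * \<phi> x)" .
qed

text \<open>The complement of the support is a union of possibly uncountably many sets on which
  \<open>f\<close> vanishes almost everywhere; the Lindelof property reduces it to a countable
  one.\<close>

lemma ess_support_AE:
  fixes f :: "real^'n::finite \<Rightarrow> 'b::zero"
  shows "AE x in lebesgue. x \<notin> ess_support f \<longrightarrow> f x = 0"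
proof -
  let ?F = "{V. open V \<and> (AE x\<in>V in lebesgue. f x = 0)}"
  obtain F' where F': "F' \<subseteq> ?F" "countable F'" "\<Union>F' = \<Union>?F"
    using Lindelof[of ?F] by auto
  have "AE x in lebesgue. \<forall>V\<in>F'. x \<in> V \<longrightarrow> f x = 0"
    using F' by (subst AE_ball_countable) auto
  then show ?thesis
  proof eventually_elim
    case (elim x)
    then show ?case using F'(3) unfolding ess_support_def by blast
  qed
qed

text \<open>\<open>F\<close> is contained in each of its neighbourhoods, and their volumes tend to 0
  with \<epsilon>.\<close>

lemma thin_at_null:
  assumes thin: "thin_at \<Omega> F" and F: "F \<in> sets borel"
  shows "AE x in lborel. x \<notin> F"
proof -
  obtain A L \<epsilon>\<^sub>1 where A: "A \<ge> 0" "\<epsilon>\<^sub>1 > 0" and layer: "\<And>\<epsilon>. 0 < \<epsilon> \<Longrightarrow> \<epsilon> < \<epsilon>\<^sub>1 \<Longrightarrow> thin_layer \<Omega> F A L \<epsilon>"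
    using thin unfolding thin_at_def by blast
  have "emeasure lborel F \<le> ennreal (A * \<epsilon>)" if \<epsilon>: "0 < \<epsilon>" "\<epsilon> < \<epsilon>\<^sub>1" for \<epsilon>
  proof -
    obtain T where T: "T \<in> sets borel" "{x. \<exists>q\<in>F. dist x q \<le> \<epsilon>} \<subseteq> T" "emeasure lborel T \<le> ennreal (A * \<epsilon>)"
      using layer[OF \<epsilon>] unfolding thin_layer_def by blast
    have "F \<subseteq> T" using T(2) \<epsilon>(1) by (force simp: subset_iff)
    then have "emeasure lborel F \<le> emeasure lborel T" using T(1) by (intro emeasure_mono) auto
    then show ?thesis using T(3) by (rule order_trans)
  qed
  note bound = this
  have "emeasure lborel F = 0"
  proof (rule ccontr)
    assume ne: "emeasure lborel F \<noteq> 0"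
    have fin: "emeasure lborel F \<noteq> \<infinity>" using bound[of "\<epsilon>\<^sub>1 / 2"] A by (auto simp: top_unique)
    define m where "m = measure lborel F"
    have m: "emeasure lborel F = ennreal m" "m > 0"
      using ne fin unfolding m_def by (auto simp: emeasure_eq_ennreal_measure zero_less_measure_iff)
    \<comment> \<open>The factor 2 produces the contradiction m \<le> m / 2; \<open>A + 1\<close>
      avoids a division by zero when \<open>A = 0\<close>.\<close>
    define \<epsilon> where "\<epsilon> = min (\<epsilon>\<^sub>1 / 2) (m / (2 * (A + 1)))"
    have \<epsilon>: "0 < \<epsilon>" "\<epsilon> < \<epsilon>\<^sub>1" "\<epsilon> \<le> m / (2 * (A + 1))" unfolding \<epsilon>_def using A m by auto
    have "m \<le> A * \<epsilon>" using bound[OF \<epsilon>(1,2)] A \<epsilon> unfolding m(1) by (simp add: ennreal_le_iff)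
    also have "\<dots> \<le> (A + 1) * (m / (2 * (A + 1)))" using A \<epsilon> by (intro mult_mono) auto
    also have "\<dots> = m / 2" using A by (simp add: field_simps)
    finally show False using m by simp
  qed
  then show ?thesis using F by (intro AE_not_in null_setsI) auto
qed

lemma affine_has_partials:
  fixes M :: "real^'n::finite^'m::finite"
  shows "has_partials (\<lambda>x. (M *v x + b) $ i) (\<lambda>j x. M $ i $ j)"
  unfolding has_partials_def
proof
  fix x
  have eq: "(M *v x + b) $ i = M $ i \<bullet> x + b $ i" for x
    by (simp add: matrix_vector_mult_def inner_vec_def)
  have "((\<lambda>x. M $ i \<bullet> x + b $ i) has_derivative (\<lambda>h. M $ i \<bullet> h)) (at x)"
    by (auto intro!: derivative_eq_intros)
  then show "((\<lambda>x. (M *v x + b) $ i) has_derivative (\<lambda>h. \<Sum>j\<in>UNIV. h $ j *\<^sub>R M $ i $ j)) (at x)"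
    unfolding eq by (rule has_derivative_eq_rhs) (simp add: inner_vec_def mult.commute)
qed

text \<open>Passes from \<open>u\<close> and its gradient to the difference with an affine map. That
  map need not be integrable on the whole space, so the integrals are separated only after
  multiplication with the test function or its derivative.\<close>

lemma weak_partial_minus_affine:
  fixes f :: "real^'n::finite \<Rightarrow> real"
  assumes f: "has_weak_partial UNIV j f F" and a: "has_partials a (\<lambda>j x. c j)"
    and f0: "f0 \<in> borel_measurable borel" "AE x in lborel. f x - a x = f0 x"
    and F0: "F0 \<in> borel_measurable borel" "AE x in lborel. F x - c j = F0 x"
    and \<phi>: "\<phi> \<in> test_functions UNIV"
  shows "(LINT x|lborel. f0 x * partial_deriv j \<phi> x) = - (LINT x|lborel. F0 x * \<phi> x)"
proof -
  obtain R where k: "kernel R \<phi>" using test_function_kernel[OF \<phi>] by blast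
  note k' = kernel_partial_deriv[OF k, of j]
  have ca: "continuous_on UNIV a" using a by (rule has_partials_continuous)
  have loc: "locally_integrable UNIV f" "locally_integrable UNIV F"
    and eq: "(LINT x|lebesgue. f x * partial_deriv j \<phi> x) = - (LINT x|lebesgue. F x * \<phi> x)"
    using f \<phi> unfolding has_weak_partial_def set_lebesgue_integral_def by auto
  note i1 = locally_integrable_mult_kernel[OF loc(1) k'] locally_integrable_mult_kernel[OF loc(2) k]
    locally_integrable_mult_kernel[OF continuous_locally_integrable[OF ca] k']
    locally_integrable_mult_kernel[OF continuous_locally_integrable[OF continuous_on_const[where c = "c j"]] k]
  note [measurable] = kernel_measurable[OF k] kernel_measurable[OF k'] f0(1) F0(1) borel_measurable_continuous_onI[OF ca]
  have "(LINT x|lborel. f0 x * partial_deriv j \<phi> x) = (LINT x|lebesgue. f x * partial_deriv j \<phi> x - a x * partial_deriv j \<phi> x)"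
  proof (rule integral_lebesgue_AE_eq(1)[symmetric])
    show "AE x in lborel. f x * partial_deriv j \<phi> x - a x * partial_deriv j \<phi> x = f0 x * partial_deriv j \<phi> x"
      using f0(2) by eventually_elim (simp add: left_diff_distrib[symmetric])
    show "(\<lambda>x. f x * partial_deriv j \<phi> x - a x * partial_deriv j \<phi> x) \<in> borel_measurable lebesgue"
      using i1(1,3) by (intro borel_measurable_diff) (auto dest: borel_measurable_integrable)
  qed measurable
  also have "\<dots> = (LINT x|lebesgue. f x * partial_deriv j \<phi> x) - (LINT x|lebesgue. a x * partial_deriv j \<phi> x)"
    by (rule Bochner_Integration.integral_diff[OF i1(1,3)])
  also have "(LINT x|lebesgue. a x * partial_deriv j \<phi> x) = (LINT x|lborel. a x * partial_deriv j \<phi> x)"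
    by (rule integral_completion) measurable
  also have "\<dots> = - (LINT x|lborel. c j * \<phi> x)"
    by (rule integration_by_parts[OF a continuous_on_const k])
  also have "(LINT x|lborel. c j * \<phi> x) = (LINT x|lebesgue. c j * \<phi> x)"
    by (rule integral_completion[symmetric]) measurable
  also have "(LINT x|lebesgue. f x * partial_deriv j \<phi> x) - - (LINT x|lebesgue. c j * \<phi> x)
     = - ((LINT x|lebesgue. F x * \<phi> x) - (LINT x|lebesgue. c j * \<phi> x))"
    unfolding eq by simp
  also have "(LINT x|lebesgue. F x * \<phi> x) - (LINT x|lebesgue. c j * \<phi> x) = (LINT x|lebesgue. F x * \<phi> x - c j * \<phi> x)"
    by (rule Bochner_Integration.integral_diff[OF i1(2,4), symmetric])
  also have "\<dots> = (LINT x|lborel. F0 x * \<phi> x)"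
  proof (rule integral_lebesgue_AE_eq(1))
    show "AE x in lborel. F x * \<phi> x - c j * \<phi> x = F0 x * \<phi> x"
      using F0(2) by eventually_elim (simp add: left_diff_distrib[symmetric])
    show "(\<lambda>x. F x * \<phi> x - c j * \<phi> x) \<in> borel_measurable lebesgue"
      using i1(2,4) by (intro borel_measurable_diff) (auto dest: borel_measurable_integrable)
  qed measurable
  finally show ?thesis .
qed

text \<open>Resetting to 0 the values outside \<open>P\<close> or above the bound affects only a
  null set and makes the constraints hold everywhere. \<open>max 0 B\<close> allows for the value 0
  when \<open>B\<close> is negative.\<close>

lemma borel_representative_on:
  fixes f :: "real^'n::finite \<Rightarrow> real"
  assumes f: "f \<in> borel_measurable lebesgue" and P: "{x. P x} \<in> sets borel"
    and ae: "AE x in lborel. (P x \<longrightarrow> \<bar>f x\<bar> \<le> B) \<and> (\<not> P x \<longrightarrow> f x = 0)"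
  obtains f0 where "f0 \<in> borel_measurable borel" "\<And>x. \<not> P x \<Longrightarrow> f0 x = 0" "\<And>x. \<bar>f0 x\<bar> \<le> max 0 B"
    "AE x in lborel. f x = f0 x"
proof -
  obtain f1 where f1: "f1 \<in> borel_measurable lborel" "AE x in lborel. f x = f1 x"
    using completion_ex_borel_measurable_real[OF f] by blast
  have [measurable]: "f1 \<in> borel_measurable borel" using f1(1) by simp
  have [measurable]: "Measurable.pred borel P" using P unfolding pred_def by simp
  show thesis
  proof (rule that[of "\<lambda>x. if P x \<and> \<bar>f1 x\<bar> \<le> B then f1 x else 0"])
    show "(\<lambda>x. if P x \<and> \<bar>f1 x\<bar> \<le> B then f1 x else 0) \<in> borel_measurable borel" by measurable
    show "AE x in lborel. f x = (if P x \<and> \<bar>f1 x\<bar> \<le> B then f1 x else 0)"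
      using ae f1(2) by eventually_elim auto
  qed auto
qed

lemma integrable_representative_on:
  fixes f :: "real^'n::finite \<Rightarrow> real"
  assumes f: "locally_integrable UNIV f" and S: "bounded S" "S \<in> sets borel"
    and ae: "AE x in lborel. x \<notin> S \<longrightarrow> f x = 0"
  obtains f0 where "integrable lborel f0" "\<And>x. x \<notin> S \<Longrightarrow> f0 x = 0" "AE x in lborel. f x = f0 x"
proof -
  note fm = locally_integrable_measurable[OF f]
  obtain f1 where f1: "f1 \<in> borel_measurable lborel" "AE x in lborel. f x = f1 x"
    using completion_ex_borel_measurable_real[OF fm] by blast
  have [measurable]: "f1 \<in> borel_measurable borel" using f1(1) by simp
  note [measurable] = S(2)
  define f0 where "f0 x = (if x \<in> S then f1 x else 0)" for x
  have m: "f0 \<in> borel_measurable borel" unfolding f0_def[abs_def] by measurable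
  have e: "AE x in lborel. f x = f0 x" using ae f1(2) unfolding f0_def by eventually_elim auto
  obtain R where R: "\<And>x. x \<in> S \<Longrightarrow> norm x \<le> R" using S(1) unfolding bounded_iff by blast
  have i: "integrable lebesgue (\<lambda>x. indicator (cball 0 R) x *\<^sub>R f x)"
    using f unfolding locally_integrable_def set_integrable_def by auto
  have "AE x in lborel. indicator (cball 0 R) x *\<^sub>R f x = f0 x"
    using e by eventually_elim (use R in \<open>auto simp: f0_def indicator_def\<close>)
  from integral_lebesgue_AE_eq(2)[OF m this borel_measurable_integrable[OF i]] i
  have "integrable lborel f0" by simp
  then show thesis by (rule that[OF _ _ e]) (simp add: f0_def)
qed

section \<open>Admissibility and energy of the competitor\<close>

lemma power2_norm_matrix: "(norm (A :: real^'n::finite^'m::finite))\<^sup>2 = (\<Sum>i\<in>UNIV. \<Sum>j\<in>UNIV. (A $ i $ j)\<^sup>2)"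
  unfolding power2_norm_eq_inner inner_vec_def by (simp add: power2_eq_square)

lemma power2_norm_tensor:
  "(norm (A :: real^'k::finite^'n::finite^'m::finite))\<^sup>2 = (\<Sum>i\<in>UNIV. \<Sum>j\<in>UNIV. \<Sum>k\<in>UNIV. (A $ i $ j $ k)\<^sup>2)"
  unfolding power2_norm_eq_inner inner_vec_def by (simp add: power2_eq_square)

text \<open>Continuity of all functions involved reduces the L2 conditions and the weak derivatives
  to classical facts; the vanishing of \<open>w'\<close> off \<Omega> is the boundary
  condition.\<close>

lemma competitor_admissible:
  fixes \<Omega> :: "(real^'n::finite) set" and w :: "'n \<Rightarrow> real^'n \<Rightarrow> real"
  assumes \<Omega>: "open \<Omega>" "bounded \<Omega>"
    and w: "\<And>i. has_partials (w i) (w' i)" "\<And>i j. has_partials (w' i j) (w'' i j)"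
      "\<And>i j k. continuous_on UNIV (w'' i j k)" "\<And>i j x. x \<notin> \<Omega> \<Longrightarrow> w' i j x = 0"
  shows "(\<lambda>x. M *v x + (\<chi> i. w i x), \<lambda>x. \<chi> i j. M $ i $ j + w' i j x, \<lambda>x. \<chi> i j k. w'' i j k x) \<in> admissible \<Omega> M"
proof -
  have c: "continuous_on UNIV (w i)" "continuous_on UNIV (w' i j)" for i j
    using has_partials_continuous[OF w(1)] has_partials_continuous[OF w(2)] by auto
  have p: "has_partials (\<lambda>x. (M *v x + (\<chi> i. w i x)) $ i) (\<lambda>j x. M $ i $ j + w' i j x)" for i
    using has_partials_add[OF affine_has_partials[of M 0 i] w(1)] by simp
  have q: "has_partials (\<lambda>x. M $ i $ j + w' i j x) (w'' i j)" for i j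
    using has_partials_add[OF has_partials_const[of "M $ i $ j"] w(2)[of i j]] by simp
  have cu: "continuous_on UNIV (\<lambda>x. M *v x + (\<chi> i. w i x))"
    by (intro continuous_on_add continuous_on_vec_lambda c linear_continuous_on matrix_vector_mul_bounded_linear)
  have cG: "continuous_on UNIV (\<lambda>x. \<chi> i j. M $ i $ j + w' i j x)"
    by (intro continuous_on_vec_lambda continuous_on_add continuous_on_const c)
  have cH: "continuous_on UNIV (\<lambda>x. \<chi> i j k. w'' i j k x)"
    by (intro continuous_on_vec_lambda w(3))
  show ?thesis
    unfolding admissible_def has_weak_gradient_def has_weak_matrix_gradient_def
  proof (clarify, intro conjI allI)
    show "L2_loc (\<lambda>x. M *v x + (\<chi> i. w i x))" by (rule continuous_L2_loc[OF cu])
    show "L2_loc (\<lambda>x. \<chi> i j. M $ i $ j + w' i j x)" by (rule continuous_L2_loc[OF cG])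
    show "L2_on \<Omega> (\<lambda>x. \<chi> i j k. w'' i j k x)"
      using \<Omega> by (intro continuous_L2_on[OF cH]) auto
    show "AE x\<in>- closure \<Omega> in lebesgue. (\<chi> i j. M $ i $ j + w' i j x) = M"
      using w(4) closure_subset[of \<Omega>] by (intro AE_I2) (auto simp: vec_eq_iff)
    fix i j k
    show "has_weak_partial UNIV j (\<lambda>x. (M *v x + (\<chi> i. w i x)) $ i) (\<lambda>x. (\<chi> i j. M $ i $ j + w' i j x) $ i $ j)"
      using C1_has_weak_partial[OF p, of i j] c by (simp add: continuous_on_add)
    show "has_weak_partial \<Omega> k (\<lambda>x. (\<chi> i j. M $ i $ j + w' i j x) $ i $ j) (\<lambda>x. (\<chi> i j k. w'' i j k x) $ i $ j $ k)"
      using C1_has_weak_partial[OF q, of i j k] w(3) by simp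
  qed
qed

text \<open>Since \<open>G x\<close> lies in \<open>K\<close>, the distance of the competitor's
  gradient to \<open>K\<close> is at most its distance to \<open>G x\<close>, whose entries are
  \<open>w' - g\<close>. Frobenius norms make both energies sums over entries, hence the double and
  the triple sum of \<open>Q i\<close>.\<close>

lemma competitor_energy_le:
  fixes \<Omega> :: "(real^'n::finite) set" and M :: "real^'n^'n"
  assumes \<Omega>: "open \<Omega>" and G: "AE x\<in>\<Omega> in lebesgue. G x \<in> K"
    and g: "\<And>i j. g i j \<in> borel_measurable borel" "\<And>i j. AE x in lborel. G x $ i $ j - M $ i $ j = g i j x"
    and w: "\<And>i j. continuous_on UNIV (w' i j)" "\<And>i j k. continuous_on UNIV (w'' i j k)"
    and E: "E \<ge> 0" and Q: "\<And>i. Q i \<ge> 0"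
    and en: "\<And>i j. (\<integral>\<^sup>+x\<in>\<Omega>. ennreal ((w' i j x - g i j x)\<^sup>2) \<partial>lborel) \<le> ennreal (Q i * E)"
      "\<And>i j k. ennreal (\<epsilon>\<^sup>2) * (\<integral>\<^sup>+x\<in>\<Omega>. ennreal ((w'' i j k x)\<^sup>2) \<partial>lborel) \<le> ennreal (Q i * E)"
  shows "energy \<Omega> K \<epsilon> (\<lambda>x. \<chi> i j. M $ i $ j + w' i j x) (\<lambda>x. \<chi> i j k. w'' i j k x)
    \<le> ennreal (((\<Sum>i\<in>UNIV. \<Sum>j\<in>(UNIV::'n set). Q i) + (\<Sum>i\<in>UNIV. \<Sum>j\<in>(UNIV::'n set). \<Sum>k\<in>(UNIV::'n set). Q i)) * E)"
proof -
  let ?G = "\<lambda>x. \<chi> i j. M $ i $ j + w' i j x" and ?H = "\<lambda>x. \<chi> i j k. w'' i j k x"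
  note [measurable] = g(1) borel_measurable_continuous_onI[OF w(1)] borel_measurable_continuous_onI[OF w(2)]
  have [measurable]: "\<Omega> \<in> sets borel" using \<Omega> by simp
  have ae: "AE x in lborel. \<forall>i j. G x $ i $ j - M $ i $ j = g i j x"
    using g(2) by (simp add: AE_all_countable)
  have "AE x in lebesgue. ennreal ((infdist (?G x) K)\<^sup>2) * indicator \<Omega> x
      \<le> (\<Sum>i\<in>UNIV. \<Sum>j\<in>UNIV. ennreal ((w' i j x - g i j x)\<^sup>2) * indicator \<Omega> x)"
    using AE_completion[OF ae] G
  proof eventually_elim
    case (elim x)
    show ?case
    proof (cases "x \<in> \<Omega>")
      case True
      then have "infdist (?G x) K \<le> dist (?G x) (G x)" using elim(2) by (intro infdist_le) auto
      then have "(infdist (?G x) K)\<^sup>2 \<le> (norm (?G x - G x))\<^sup>2"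
        by (intro power_mono) (auto simp: dist_norm infdist_nonneg)
      also have "\<dots> = (\<Sum>i\<in>UNIV. \<Sum>j\<in>UNIV. (w' i j x - g i j x)\<^sup>2)"
        unfolding power2_norm_matrix elim(1)[rule_format, symmetric] by (simp add: diff_diff_eq2 add.commute)
      finally have "ennreal ((infdist (?G x) K)\<^sup>2) \<le> (\<Sum>i\<in>UNIV. \<Sum>j\<in>UNIV. ennreal ((w' i j x - g i j x)\<^sup>2))"
        by (simp add: sum_ennreal sum_nonneg ennreal_leI)
      then show ?thesis using True by simp
    qed simp
  qed
  then have "(\<integral>\<^sup>+x\<in>\<Omega>. ennreal ((infdist (?G x) K)\<^sup>2) \<partial>lebesgue)
      \<le> (\<integral>\<^sup>+x. (\<Sum>i\<in>UNIV. \<Sum>j\<in>UNIV. ennreal ((w' i j x - g i j x)\<^sup>2) * indicator \<Omega> x) \<partial>lebesgue)"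
    by (rule nn_integral_mono_AE)
  also have "\<dots> = (\<Sum>i\<in>UNIV. \<Sum>j\<in>UNIV. \<integral>\<^sup>+x\<in>\<Omega>. ennreal ((w' i j x - g i j x)\<^sup>2) \<partial>lborel)"
    unfolding nn_integral_completion by (subst nn_integral_sum, measurable)+
  also have "\<dots> \<le> (\<Sum>i\<in>UNIV. \<Sum>j\<in>(UNIV::'n set). ennreal (Q i * E))"
    by (intro sum_mono en)
  also have "\<dots> = ennreal (\<Sum>i\<in>UNIV. \<Sum>j\<in>(UNIV::'n set). Q i * E)"
    using E Q by (simp add: sum_ennreal sum_nonneg del: sum_constant)
  finally have 1: "(\<integral>\<^sup>+x\<in>\<Omega>. ennreal ((infdist (?G x) K)\<^sup>2) \<partial>lebesgue) \<le> \<dots>" .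
  have "(\<integral>\<^sup>+x\<in>\<Omega>. ennreal ((norm (?H x))\<^sup>2) \<partial>lebesgue)
     = (\<integral>\<^sup>+x. (\<Sum>i\<in>UNIV. \<Sum>j\<in>UNIV. \<Sum>k\<in>UNIV. ennreal ((w'' i j k x)\<^sup>2) * indicator \<Omega> x) \<partial>lborel)"
    unfolding nn_integral_completion power2_norm_tensor
  proof (intro nn_integral_cong)
    fix x
    have "ennreal (\<Sum>i\<in>UNIV. \<Sum>j\<in>UNIV. \<Sum>k\<in>UNIV. (?H x $ i $ j $ k)\<^sup>2) * indicator \<Omega> x
       = (\<Sum>i\<in>UNIV. \<Sum>j\<in>UNIV. \<Sum>k\<in>UNIV. ennreal ((w'' i j k x)\<^sup>2)) * indicator \<Omega> x"
      by (simp add: sum_ennreal sum_nonneg)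
    then show "ennreal (\<Sum>i\<in>UNIV. \<Sum>j\<in>UNIV. \<Sum>k\<in>UNIV. (?H x $ i $ j $ k)\<^sup>2) * indicator \<Omega> x
       = (\<Sum>i\<in>UNIV. \<Sum>j\<in>UNIV. \<Sum>k\<in>UNIV. ennreal ((w'' i j k x)\<^sup>2) * indicator \<Omega> x)"
      by (simp only: sum_distrib_right)
  qed
  also have "\<dots> = (\<Sum>i\<in>UNIV. \<Sum>j\<in>UNIV. \<Sum>k\<in>UNIV. \<integral>\<^sup>+x\<in>\<Omega>. ennreal ((w'' i j k x)\<^sup>2) \<partial>lborel)"
    by (subst nn_integral_sum, measurable)+
  finally have "ennreal (\<epsilon>\<^sup>2) * (\<integral>\<^sup>+x\<in>\<Omega>. ennreal ((norm (?H x))\<^sup>2) \<partial>lebesgue)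
     = (\<Sum>i\<in>UNIV. \<Sum>j\<in>UNIV. \<Sum>k\<in>UNIV. ennreal (\<epsilon>\<^sup>2) * (\<integral>\<^sup>+x\<in>\<Omega>. ennreal ((w'' i j k x)\<^sup>2) \<partial>lborel))"
    by (simp only: sum_distrib_left)
  also have "\<dots> \<le> (\<Sum>i\<in>UNIV. \<Sum>j\<in>(UNIV::'n set). \<Sum>k\<in>(UNIV::'n set). ennreal (Q i * E))"
    by (intro sum_mono en)
  also have "\<dots> = ennreal (\<Sum>i\<in>UNIV. \<Sum>j\<in>(UNIV::'n set). \<Sum>k\<in>(UNIV::'n set). Q i * E)"
    using E Q by (simp add: sum_ennreal sum_nonneg del: sum_constant)
  finally have 2: "ennreal (\<epsilon>\<^sup>2) * (\<integral>\<^sup>+x\<in>\<Omega>. ennreal ((norm (?H x))\<^sup>2) \<partial>lebesgue) \<le> \<dots>" .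
  have "energy \<Omega> K \<epsilon> ?G ?H \<le> ennreal (\<Sum>i\<in>UNIV. \<Sum>j\<in>(UNIV::'n set). Q i * E) +
       ennreal (\<Sum>i\<in>UNIV. \<Sum>j\<in>(UNIV::'n set). \<Sum>k\<in>(UNIV::'n set). Q i * E)"
    unfolding energy_def by (rule add_mono[OF 1 2])
  also have "\<dots> = ennreal ((\<Sum>i\<in>UNIV. \<Sum>j\<in>(UNIV::'n set). Q i * E) + (\<Sum>i\<in>UNIV. \<Sum>j\<in>(UNIV::'n set). \<Sum>k\<in>(UNIV::'n set). Q i * E))"
    using E Q by (intro ennreal_plus[symmetric] sum_nonneg) auto
  finally show ?thesis by (simp only: sum_distrib_right distrib_right)
qed

section \<open>The main theorem\<close>

theorem theorem1:
  fixes \<Omega> :: "(real^'n::finite) set"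
    and M :: "real^'n^'n" and K :: "(real^'n^'n) set"
    and \<alpha> :: "real \<Rightarrow> real" and \<theta> \<theta>\<^sub>c :: real
    and m :: nat and U :: "nat \<Rightarrow> real \<Rightarrow> real^'n^'n"
    and C \<epsilon>\<^sub>0 \<mu> s :: real
    and u :: "real^'n \<Rightarrow> real^'n" and G :: "real^'n \<Rightarrow> real^'n^'n"
    and b :: "real^'n"
    and v :: "real^'n \<Rightarrow> real^'n" and Gv :: "real^'n \<Rightarrow> real^'n^'n"
  assumes "open \<Omega>" and "bounded \<Omega>" and "C11_boundary \<Omega>"
    and "\<theta> \<ge> 0" and "\<theta>\<^sub>c \<ge> 0"
    and "\<And>t. t \<ge> 0 \<Longrightarrow> \<alpha> t \<ge> 0"
    and "m \<ge> 1"
    and "\<And>j t. j \<in> {1..m} \<Longrightarrow> 0 \<le> t \<Longrightarrow> t \<le> \<theta>\<^sub>c \<Longrightarrow> transpose (U j t) = U j t"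
    and "K = energy_wells \<alpha> \<theta>\<^sub>c m U \<theta>"
    and "C > 1" and "\<epsilon>\<^sub>0 > 0" and "0 < \<mu>" and "\<mu> < 1/2"
    and "\<And>\<epsilon>. 0 < \<epsilon> \<Longrightarrow> \<epsilon> < \<epsilon>\<^sub>0 \<Longrightarrow>
           ennreal (\<epsilon> powr (2 * \<mu>)) \<le> ennreal C * min_energy \<Omega> K M \<epsilon>"
    and "has_weak_gradient UNIV u G"
    and "AE x\<in>\<Omega> in lebesgue. G x \<in> K"
    and "AE x\<in>- closure \<Omega> in lebesgue. G x = M"
    and "\<And>x. v x = u x - M *v x - b"
    and "in_sobolev_H (1 + s) v"
    and "ess_support v \<subseteq> closure \<Omega>"
    and "has_weak_gradient UNIV v Gv" and "Linf Gv"
  shows "s \<le> \<mu>"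
proof (rule ccontr)
  assume "\<not> s \<le> \<mu>"
  define r where "r = min s (1/2)"
  have r: "0 < r" "r \<le> 1/2" "r \<le> s" "\<mu> < r"
    using \<open>\<not> s \<le> \<mu>\<close> \<open>0 < \<mu>\<close> \<open>\<mu> < 1/2\<close> unfolding r_def by auto
  note \<Omega> = \<open>open \<Omega>\<close> \<open>bounded \<Omega>\<close>
  have thin: "thin_at \<Omega> (frontier \<Omega>)" by (rule C11_boundary_thin[OF \<Omega> \<open>C11_boundary \<Omega>\<close>])
  \<comment> \<open>\<open>G\<close> is prescribed in \<Omega> and outside its closure; a null
    frontier leaves no gap between the two.\<close>
  have fr: "AE x in lborel. x \<notin> frontier \<Omega>" by (rule thin_at_null[OF thin]) simp
  have "bounded K" unfolding \<open>K = _\<close> by (rule bounded_energy_wells)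
  then obtain B0 where B0: "\<And>A. A \<in> K \<Longrightarrow> norm A \<le> B0" unfolding bounded_iff by blast
  define B where "B = max 0 (B0 + norm M)"
  have uG: "has_weak_partial UNIV j (\<lambda>x. u x $ i) (\<lambda>x. G x $ i $ j)" for i j
    using \<open>has_weak_gradient UNIV u G\<close> unfolding has_weak_gradient_def by blast
  have "\<exists>v0. integrable lborel v0 \<and> (\<forall>x. x \<notin> closure \<Omega> \<longrightarrow> v0 x = 0) \<and> (AE x in lborel. v x $ i = v0 x)" for i
  proof -
    have l: "locally_integrable UNIV (\<lambda>x. v x $ i)"
      using \<open>has_weak_gradient UNIV v Gv\<close> unfolding has_weak_gradient_def has_weak_partial_def by blast
    have S: "bounded (closure \<Omega>)" "closure \<Omega> \<in> sets borel" using \<Omega>(2) by auto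
    have "AE x in lebesgue. x \<notin> closure \<Omega> \<longrightarrow> v x $ i = 0"
      using ess_support_AE[of v] by eventually_elim (use \<open>ess_support v \<subseteq> closure \<Omega>\<close> in auto)
    then have "AE x in lborel. x \<notin> closure \<Omega> \<longrightarrow> v x $ i = 0" by (simp add: AE_completion_iff)
    from integrable_representative_on[OF l S this] show ?thesis by blast
  qed
  then obtain v0 where v0: "\<And>i. integrable lborel (v0 i)" "\<And>i x. x \<notin> closure \<Omega> \<Longrightarrow> v0 i x = 0"
    "\<And>i. AE x in lborel. v x $ i = v0 i x"
    by metis
  \<comment> \<open>A representative of an entry of G - M that satisfies bound and support condition
    everywhere and not just almost everywhere, as the pointwise estimates for convolutions
    require.\<close>
  define Pg where "Pg i j g \<longleftrightarrow> g \<in> borel_measurable borel \<and> (\<forall>x. x \<notin> \<Omega> \<longrightarrow> g x = 0) \<and> (\<forall>x. \<bar>g x\<bar> \<le> B) \<and>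
      (AE x in lborel. G x $ i $ j - M $ i $ j = g x)" for i j g
  have exg: "\<exists>g. Pg i j g" for i j
  proof -
    have m: "(\<lambda>x. G x $ i $ j - M $ i $ j) \<in> borel_measurable lebesgue"
      using locally_integrable_measurable[of "\<lambda>x. G x $ i $ j"] uG[of j i] unfolding has_weak_partial_def
      by (intro borel_measurable_diff) auto
    have S: "{x. x \<in> \<Omega>} \<in> sets borel" using \<Omega>(1) by simp
    have "AE x in lborel. x \<in> \<Omega> \<longrightarrow> G x \<in> K" "AE x in lborel. x \<in> - closure \<Omega> \<longrightarrow> G x = M"
      using \<open>AE x\<in>\<Omega> in lebesgue. G x \<in> K\<close> \<open>AE x\<in>- closure \<Omega> in lebesgue. G x = M\<close> by (simp_all add: AE_completion_iff)
    with fr have ae: "AE x in lborel. (x \<in> \<Omega> \<longrightarrow> \<bar>G x $ i $ j - M $ i $ j\<bar> \<le> B0 + norm M) \<and> (x \<notin> \<Omega> \<longrightarrow> G x $ i $ j - M $ i $ j = 0)"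
    proof eventually_elim
      case (elim x)
      have "\<bar>G x $ i $ j - M $ i $ j\<bar> \<le> B0 + norm M" if "x \<in> \<Omega>"
      proof -
        have "\<bar>(G x - M) $ i $ j\<bar> \<le> norm (G x - M)"
          using component_le_norm_cart[of "(G x - M) $ i" j] Finite_Cartesian_Product.norm_nth_le[of "G x - M" i] by simp
        also have "\<dots> \<le> norm (G x) + norm M" by (rule norm_triangle_ineq4)
        also have "norm (G x) \<le> B0" using B0 elim(2) that by blast
        finally show ?thesis by simp
      qed
      moreover have "x \<notin> closure \<Omega>" if "x \<notin> \<Omega>"
        using elim(1) that \<Omega>(1) by (simp add: frontier_def interior_open)
      ultimately show ?case using elim(3) by auto
    qed
    show ?thesis
    proof (rule borel_representative_on[OF m S ae])
      fix g assume "g \<in> borel_measurable borel" "\<And>x. x \<notin> \<Omega> \<Longrightarrow> g x = 0" "\<And>x. \<bar>g x\<bar> \<le> max 0 (B0 + norm M)"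
        "AE x in lborel. G x $ i $ j - M $ i $ j = g x"
      then have "Pg i j g" unfolding Pg_def B_def by blast
      then show ?thesis by blast
    qed
  qed
  define g0 where "g0 i j = (SOME g. Pg i j g)" for i j
  have "Pg i j (g0 i j)" for i j unfolding g0_def by (rule someI_ex[OF exg])
  then have g0: "\<And>i j. g0 i j \<in> borel_measurable borel" "\<And>i j x. x \<notin> \<Omega> \<Longrightarrow> g0 i j x = 0"
    "\<And>i j x. \<bar>g0 i j x\<bar> \<le> B" "\<And>i j. AE x in lborel. G x $ i $ j - M $ i $ j = g0 i j x"
    unfolding Pg_def by blast+
  obtain R where R: "\<And>x. x \<in> \<Omega> \<Longrightarrow> norm x \<le> R" using \<Omega>(2) unfolding bounded_iff by blast
  have g0i: "integrable lborel (g0 i j)" for i j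
  proof (rule integrable_lborel_bounded_support[OF g0(1)])
    show "norm (g0 i j x) \<le> B" for x using g0(3) by simp
    show "g0 i j x = 0" if "norm x > R" for x
    proof (rule g0(2))
      show "x \<notin> \<Omega>" using that R[of x] by linarith
    qed
  qed
  have weak: "(LINT x|lborel. v0 i x * partial_deriv j \<phi> x) = - (LINT x|lborel. g0 i j x * \<phi> x)"
    if "\<phi> \<in> test_functions UNIV" for i j \<phi>
  proof (rule weak_partial_minus_affine[OF uG affine_has_partials _ _ g0(1,4) that])
    show "v0 i \<in> borel_measurable borel" using v0(1)[of i] by auto
    show "AE x in lborel. u x $ i - (M *v x + b) $ i = v0 i x"
      using v0(3)[of i] unfolding \<open>\<And>x. v x = u x - M *v x - b\<close> by eventually_elim simp
  qed
  have sob: "(\<integral>\<^sup>+\<xi>. ennreal (((norm \<xi>)\<^sup>2 + 1) powr (1 + s) * (norm (ft (\<lambda>x. of_real (v0 i x)) \<xi>))\<^sup>2) \<partial>lborel) < \<infinity>" for i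
  proof (rule sobolev_H_ft)
    show "(\<lambda>x. complex_of_real (v x $ i)) \<in> sobolev_H (1 + s)"
      using \<open>in_sobolev_H (1 + s) v\<close> unfolding in_sobolev_H_def by blast
    show "integrable lborel (\<lambda>x. complex_of_real (v0 i x))" using v0(1) by simp
    show "AE x in lborel. complex_of_real (v x $ i) = complex_of_real (v0 i x)"
      using v0(3)[of i] by eventually_elim simp
    have "locally_integrable UNIV (\<lambda>x. v x $ i)"
      using \<open>has_weak_gradient UNIV v Gv\<close> unfolding has_weak_gradient_def has_weak_partial_def by blast
    from locally_integrable_measurable[OF this]
    show "(\<lambda>x. complex_of_real (v x $ i)) \<in> borel_measurable lebesgue" by measurable
  qed
  define Pc where "Pc i j c \<longleftrightarrow> c \<ge> 0 \<and>
      (\<forall>y. (\<integral>\<^sup>+x. ennreal ((g0 i j (x - y) - g0 i j x)\<^sup>2) \<partial>lborel) \<le> ennreal (c * norm y powr (2 * r)))" for i j c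
  have exc: "\<exists>c. Pc i j c" for i j
  proof -
    have "r \<le> 1" using r by simp
    show ?thesis
    proof (rule sobolev_gradient_shift[OF v0(1)[of i] g0i[of i j] weak sob r(1) \<open>r \<le> 1\<close> r(3)])
      fix c :: real
      assume "c \<ge> 0" "\<And>y. (\<integral>\<^sup>+x. ennreal ((g0 i j (x - y) - g0 i j x)\<^sup>2) \<partial>lborel) \<le> ennreal (c * norm y powr (2 * r))"
      then have "Pc i j c" unfolding Pc_def by simp
      then show ?thesis ..
    qed
  qed
  define c where "c i j = (SOME c. Pc i j c)" for i j
  have "Pc i j (c i j)" for i j unfolding c_def by (rule someI_ex[OF exc])
  then have c: "\<And>i j. c i j \<ge> 0"
    "\<And>i j y. (\<integral>\<^sup>+x. ennreal ((g0 i j (x - y) - g0 i j x)\<^sup>2) \<partial>lborel) \<le> ennreal (c i j * norm y powr (2 * r))"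
    unfolding Pc_def by blast+
  define P where "P i \<epsilon> Q w w' w'' \<longleftrightarrow> has_partials w w' \<and> (\<forall>j. has_partials (w' j) (w'' j)) \<and> (\<forall>j k. continuous_on UNIV (w'' j k)) \<and>
      (\<forall>j x. x \<notin> \<Omega> \<longrightarrow> w' j x = 0) \<and>
      (\<forall>j. (\<integral>\<^sup>+x\<in>\<Omega>. ennreal ((w' j x - g0 i j x)\<^sup>2) \<partial>lborel) \<le> ennreal (Q * \<epsilon> powr (2 * r))) \<and>
      (\<forall>j k. ennreal (\<epsilon>\<^sup>2) * (\<integral>\<^sup>+x\<in>\<Omega>. ennreal ((w'' j k x)\<^sup>2) \<partial>lborel) \<le> ennreal (Q * \<epsilon> powr (2 * r)))"
    for i \<epsilon> Q w and w' :: "'n \<Rightarrow> real^'n \<Rightarrow> real" and w'' :: "'n \<Rightarrow> 'n \<Rightarrow> real^'n \<Rightarrow> real"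
  define Pq where "Pq i q \<longleftrightarrow> fst q \<ge> 0 \<and> snd q > 0 \<and>
      (\<forall>\<epsilon>. 0 < \<epsilon> \<longrightarrow> \<epsilon> < snd q \<longrightarrow> (\<exists>w w' w''. P i \<epsilon> (fst q) w w' w''))" for i and q :: "real \<times> real"
  have exq: "\<exists>q. Pq i q" for i
  proof -
    \<comment> \<open>Summing over the columns gives the single constant per component that
      \<open>scalar_competitor\<close> expects.\<close>
    have sh: "(\<integral>\<^sup>+x. ennreal ((g0 i j (x - y) - g0 i j x)\<^sup>2) \<partial>lborel) \<le> ennreal ((\<Sum>j\<in>UNIV. c i j) * norm y powr (2 * r))" for j y
    proof (rule order_trans[OF c(2)], intro ennreal_leI mult_right_mono)
      show "c i j \<le> (\<Sum>j\<in>UNIV. c i j)" by (rule member_le_sum) (auto simp: c)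
    qed simp
    have cs: "(\<Sum>j\<in>UNIV. c i j) \<ge> 0" by (intro sum_nonneg c)
    show ?thesis
    proof (rule scalar_competitor[OF \<Omega> thin v0(1)[of i] v0(2) g0i g0(3) weak sh cs r(1,2)])
      fix Q e :: real
      assume "Q \<ge> 0" "e > 0" and comp: "\<And>\<epsilon>. 0 < \<epsilon> \<Longrightarrow> \<epsilon> < e \<Longrightarrow> \<exists>w w' w''.
        has_partials w w' \<and> (\<forall>j. has_partials (w' j) (w'' j)) \<and> (\<forall>j k. continuous_on UNIV (w'' j k)) \<and>
        (\<forall>j x. x \<notin> \<Omega> \<longrightarrow> w' j x = 0) \<and>
        (\<forall>j. (\<integral>\<^sup>+x\<in>\<Omega>. ennreal ((w' j x - g0 i j x)\<^sup>2) \<partial>lborel) \<le> ennreal (Q * \<epsilon> powr (2 * r))) \<and>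
        (\<forall>j k. ennreal (\<epsilon>\<^sup>2) * (\<integral>\<^sup>+x\<in>\<Omega>. ennreal ((w'' j k x)\<^sup>2) \<partial>lborel) \<le> ennreal (Q * \<epsilon> powr (2 * r)))"
      then have "Pq i (Q, e)" unfolding Pq_def P_def by simp
      then show ?thesis ..
    qed
  qed
  define Q e where "Q i = fst (SOME q. Pq i q)" and "e i = snd (SOME q. Pq i q)" for i
  have "Pq i (Q i, e i)" for i
    using someI_ex[OF exq[of i]] unfolding Q_def e_def by simp
  then have Q: "\<And>i. Q i \<ge> 0" "\<And>i. e i > 0" and
    comp: "\<And>i \<epsilon>. 0 < \<epsilon> \<Longrightarrow> \<epsilon> < e i \<Longrightarrow> \<exists>w w' w''. P i \<epsilon> (Q i) w w' w''"
    unfolding Pq_def by auto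
  define Qt where "Qt = (\<Sum>i\<in>UNIV. \<Sum>j\<in>(UNIV::'n set). Q i) + (\<Sum>i\<in>UNIV. \<Sum>j\<in>(UNIV::'n set). \<Sum>k\<in>(UNIV::'n set). Q i)"
  have Qt: "Qt \<ge> 0" unfolding Qt_def by (intro add_nonneg_nonneg sum_nonneg Q)
  \<comment> \<open>The components are approximated independently; finitely many positive thresholds
    have a positive minimum.\<close>
  define \<epsilon>\<^sub>2 where "\<epsilon>\<^sub>2 = Min (range e)"
  have \<epsilon>2: "\<epsilon>\<^sub>2 > 0" "\<And>i. \<epsilon>\<^sub>2 \<le> e i" unfolding \<epsilon>\<^sub>2_def using Q(2) by auto
  have upper: "\<epsilon> powr (2 * \<mu>) \<le> C * (Qt * \<epsilon> powr (2 * r))" if \<epsilon>: "0 < \<epsilon>" "\<epsilon> < \<epsilon>\<^sub>0" "\<epsilon> < \<epsilon>\<^sub>2" for \<epsilon>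
  proof -
    define W where "W i = (SOME p. P i \<epsilon> (Q i) (fst p) (fst (snd p)) (snd (snd p)))" for i
    define w w' w'' where "w i = fst (W i)" and "w' i = fst (snd (W i))" and "w'' i = snd (snd (W i))" for i
    have w: "P i \<epsilon> (Q i) (w i) (w' i) (w'' i)" for i
    proof -
      have "\<exists>p. P i \<epsilon> (Q i) (fst p) (fst (snd p)) (snd (snd p))"
        using comp[OF \<epsilon>(1) less_le_trans[OF \<epsilon>(3) \<epsilon>2(2)], of i] by auto
      then show ?thesis unfolding w_def w'_def w''_def W_def by (rule someI_ex)
    qed
    have w1: "has_partials (w i) (w' i)" "has_partials (w' i j) (w'' i j)" "continuous_on UNIV (w'' i j k)"
      "x \<notin> \<Omega> \<Longrightarrow> w' i j x = 0" for i j k x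
      using w[of i] unfolding P_def by auto
    have w2: "(\<integral>\<^sup>+x\<in>\<Omega>. ennreal ((w' i j x - g0 i j x)\<^sup>2) \<partial>lborel) \<le> ennreal (Q i * \<epsilon> powr (2 * r))"
      "ennreal (\<epsilon>\<^sup>2) * (\<integral>\<^sup>+x\<in>\<Omega>. ennreal ((w'' i j k x)\<^sup>2) \<partial>lborel) \<le> ennreal (Q i * \<epsilon> powr (2 * r))" for i j k
      using w[of i] unfolding P_def by auto
    let ?u = "\<lambda>x. M *v x + (\<chi> i. w i x)" and ?G = "\<lambda>x. \<chi> i j. M $ i $ j + w' i j x" and ?H = "\<lambda>x. \<chi> i j k. w'' i j k x"
    have "(?u, ?G, ?H) \<in> admissible \<Omega> M" by (rule competitor_admissible[OF \<Omega> w1])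
    then have "min_energy \<Omega> K M \<epsilon> \<le> energy \<Omega> K \<epsilon> ?G ?H"
      unfolding min_energy_def by (rule INF_lower2) simp
    also have "\<dots> \<le> ennreal (Qt * \<epsilon> powr (2 * r))"
      unfolding Qt_def
      by (rule competitor_energy_le[OF \<Omega>(1) \<open>AE x\<in>\<Omega> in lebesgue. G x \<in> K\<close> g0(1,4)
            has_partials_continuous[OF w1(2)] w1(3) powr_ge_zero Q(1) w2])
    finally have "ennreal C * min_energy \<Omega> K M \<epsilon> \<le> ennreal C * ennreal (Qt * \<epsilon> powr (2 * r))"
      by (rule mult_left_mono) simp
    with \<open>\<And>\<epsilon>. 0 < \<epsilon> \<Longrightarrow> \<epsilon> < \<epsilon>\<^sub>0 \<Longrightarrow> ennreal (\<epsilon> powr (2 * \<mu>)) \<le> ennreal C * min_energy \<Omega> K M \<epsilon>\<close>[OF \<epsilon>(1,2)]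
    have "ennreal (\<epsilon> powr (2 * \<mu>)) \<le> ennreal C * ennreal (Qt * \<epsilon> powr (2 * r))" by (rule order_trans)
    also have "\<dots> = ennreal (C * (Qt * \<epsilon> powr (2 * r)))" using \<open>C > 1\<close> Qt by (simp add: ennreal_mult)
    finally show ?thesis using \<open>C > 1\<close> Qt by (simp add: ennreal_le_iff)
  qed
  define t where "t = 2 * r - 2 * \<mu>"
  have t: "t > 0" unfolding t_def using r by simp
  \<comment> \<open>With \<epsilon> powr t \<le> 1 / D the energy bounds would force D \<le> C * Qt,
    while this \<open>D\<close> exceeds \<open>C * Qt\<close>; adding 1 keeps it positive even if
    \<open>Qt = 0\<close>.\<close>
  define D where "D = 2 * (C * Qt + 1)"
  have D: "D > 0" unfolding D_def using Qt \<open>C > 1\<close> by (simp add: add_nonneg_pos)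
  \<comment> \<open>The halving makes \<epsilon> strictly smaller than both thresholds; the last
    term is the root that turns \<epsilon> powr t into at most 1 / D.\<close>
  define \<epsilon> where "\<epsilon> = min (min \<epsilon>\<^sub>0 \<epsilon>\<^sub>2 / 2) ((1 / D) powr (1 / t))"
  have \<epsilon>: "0 < \<epsilon>" "\<epsilon> < \<epsilon>\<^sub>0" "\<epsilon> < \<epsilon>\<^sub>2" "\<epsilon> \<le> (1 / D) powr (1 / t)"
    unfolding \<epsilon>_def using \<open>\<epsilon>\<^sub>0 > 0\<close> \<epsilon>2(1) D by auto
  have "\<epsilon> powr t \<le> ((1 / D) powr (1 / t)) powr t" using \<epsilon> t by (intro powr_mono2) auto
  also have "\<dots> = 1 / D" using t D by (simp add: powr_powr)
  finally have small: "\<epsilon> powr t \<le> 1 / D" .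
  have "\<epsilon> powr (2 * r) = \<epsilon> powr (2 * \<mu>) * \<epsilon> powr t"
    unfolding t_def by (simp add: powr_add[symmetric])
  then have "\<epsilon> powr (2 * \<mu>) * 1 \<le> \<epsilon> powr (2 * \<mu>) * (C * Qt * \<epsilon> powr t)"
    using upper[OF \<epsilon>(1-3)] by (simp add: mult_ac)
  then have "1 \<le> C * Qt * \<epsilon> powr t" using \<epsilon>(1) by (subst (asm) mult_le_cancel_left_pos) auto
  also have "\<dots> \<le> C * Qt * (1 / D)" using Qt \<open>C > 1\<close> by (intro mult_left_mono small) auto
  finally have "D \<le> C * Qt" using D by (simp add: field_simps)
  moreover have "C * Qt \<ge> 0" using Qt \<open>C > 1\<close> by simp
  ultimately show False unfolding D_def by simp
qed

end
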